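(* Let $n\ge 2$, let $Q\subseteq\{1,\dots,n-1\}$ be nonempty, let $\lambda$ be an $n$-partition with $Q(\lambda)\subseteq Q$, and let $\pi$ be a $Q$-chain. Let $H$ be the group of invertible diagonal $n\times n$ complex matrices, whose elements are written $\mathrm{diag}(y_1^{-1},\dots,y_n^{-1})$, acting on $\Gamma_\lambda(\pi)=\Gamma_\lambda/Z_\lambda(\pi)$ by the action induced from $(h.\xi)(f)=\xi(h^{-1}f)$ on $\Gamma_\lambda$. Then the character of $H$ on $\Gamma_\lambda(\pi)$ is $$\sum_T y^T,$$ where the sum runs over all $\pi$-Demazure tableaux $T$ of shape $\lambda$, and $y^T:=\prod_{i=1}^n y_i^{c_i}$ with $c_i$ the number of values of $T$ equal to $i$.
   Context: Shapes and tabloids. Write $[n]=\{1,\dots,n\}$. An $n$-partition is $\lambda=(\lambda_1\ge\lambda_2\ge\dots\ge\lambda_n\ge 0)$ (integers), with $\lambda_{n+1}:=0$. Its shape, also denoted $\lambda$, is a left-justified array of boxes with $\lambda_r$ boxes in row $r$ (rows numbered from top to bottom); its column lengths are $n\ge\zeta_1\ge\dots\ge\zeta_{\lambda_1}$, and $(r,c)\in\lambda$ denotes the location in row $r$ and column $c$. $Q(\lambda)$ is the set of distinct column lengths of $\lambda$ that are less than $n$. A tabloid of shape $\lambda$ is a filling $T$ of the shape with values $T(r,c)\in[n]$ that strictly increase down each column; a tableau is a tabloid whose values weakly increase from left to right along each row. For tabloids of the same shape, $T\preceq U$ means $T(r,c)\le U(r,c)$ for all $(r,c)$. For $P\subseteq[n]$,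 $Y(P)$ denotes the single column of length $|P|$ filled with the elements of $P$ in increasing order from top to bottom. $Q$-chains. Write $Q=\{q_1<\dots<q_k\}$ and $q_{k+1}:=n$. A $Q$-chain is a sequence $\pi=(P_1\subset P_2\subset\dots\subset P_k)$ of subsets of $[n]$ with $|P_j|=q_j$. If $Q(\lambda)\subseteq Q$, the $\lambda$-key $Y_\lambda(\pi)$ is the tableau of shape $\lambda$ whose columns of length $n$ are all $Y([n])$ and whose columns of length $q_j$ are all $Y(P_j)$ ($1\le j\le k$). Scanning tableau. The earliest weakly increasing subsequence (EWIS) of a sequence $(b_1,b_2,\dots)$ is $(b_{i_1},b_{i_2},\dots)$ where $i_1=1$ and for $j>1$, $i_j$ is the smallest index larger than $i_{j-1}$ with $b_{i_j}\ge b_{i_{j-1}}$ (stop when none exists). Let $T$ be a tableau of shape $\lambda$. Its scanning tableau $S(T)$ is the filling of $\lambda$ obtained as follows. To fill column $c$, consider only columns $c,c+1,\dots,\lambda_1$ of $T$, with all locations unmarked. Form the sequence, from left to right, of the bottom-most unmarked values of the columns that still have unmarked locations, find its EWIS, and mark the locations in $T$ of the members of the EWIS; place the last member of the EWIS in the lowest unfilled location of column $c$ of $S(T)$. Repeat, treating marked locations as no longer part of $T$, until column $c$ of $S(T)$ is filled from the bottom row $\zeta_c$ up to row $1$. Do this for every $c=1,\dots,\lambda_1$ (erasing all marks before starting each column). A tableau $T$ of shape $\lambda$ is $\pi$-Demazure if $S(T)\preceq Y_\lambda(\pi)$. Monomials. Let $\mathbb{C}[x_{ij}]$ be the polynomial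 ring in the $n^2$ entries of an $n\times n$ matrix $(x_{ij})$. For $r_1,\dots,r_q\in[n]$, the $q$-initial minor with rows $r_1,\dots,r_q$ is the determinant of the $q\times q$ matrix whose $i$-th row consists of the first $q$ entries of row $r_i$ of $(x_{ij})$. The monomial of a tabloid $T$ of shape $\lambda$ is the product over $1\le c\le\lambda_1$ of the $\zeta_c$-initial minors with rows $T(1,c),\dots,T(\zeta_c,c)$. $\Gamma_\lambda\subseteq\mathbb{C}[x_{ij}]$ is the linear span of the monomials of all tabloids of shape $\lambda$; $Z_\lambda(\pi)\subseteq\Gamma_\lambda$ is the linear span of the monomials of the tabloids $T$ of shape $\lambda$ with $T\not\preceq Y_\lambda(\pi)$; and $\Gamma_\lambda(\pi):=\Gamma_\lambda/Z_\lambda(\pi)$. Action and character. An element $h\in H$ acts on $\xi\in\Gamma_\lambda$ by $(h.\xi)(f)=\xi(h^{-1}f)$ for invertible $n\times n$ matrices $f$. This preserves $\Gamma_\lambda$ and $Z_\lambda(\pi)$, hence induces an action on $\Gamma_\lambda(\pi)$. The character of $H$ on a finite-dimensional representation is the trace of $h=\mathrm{diag}(y_1^{-1},\dots,y_n^{-1})$ as a function of $y_1,\dots,y_n\in\mathbb{C}\setminus\{0\}$. *)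

theory Defs
  imports
    "HOL-Library.FuncSet"
    "HOL-Library.Poly_Mapping"
    "Jordan_Normal_Form.Determinant"
    "Jordan_Normal_Form.Gauss_Jordan_Elimination"
begin

section \<open>Shapes, tabloids and keys\<close>

text \<open>
  Rows, columns and values are numbered from 1. A partition is a function on the row numbers;
  it vanishes beyond row n (so its value at n + 1 is 0), and its value at 0 is never used.
\<close>

definition n_partition :: "nat \<Rightarrow> (nat \<Rightarrow> nat) \<Rightarrow> bool" where
  "n_partition n lam \<longleftrightarrow> (\<forall>r\<ge>1. lam (Suc r) \<le> lam r) \<and> (\<forall>r>n. lam r = 0)"

definition shape :: "nat \<Rightarrow> (nat \<Rightarrow> nat) \<Rightarrow> (nat \<times> nat) set" where
  "shape n lam = {(r, c). 1 \<le> r \<and> r \<le> n \<and> 1 \<le> c \<and> c \<le> lam r}"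

definition col_len :: "nat \<Rightarrow> (nat \<Rightarrow> nat) \<Rightarrow> nat \<Rightarrow> nat" where
  "col_len n lam c = card {r. (r, c) \<in> shape n lam}"

definition short_col_lens :: "nat \<Rightarrow> (nat \<Rightarrow> nat) \<Rightarrow> nat set" where
  "short_col_lens n lam = {q \<in> col_len n lam ` {1..lam 1}. q < n}"

text \<open>Fillings are extensional functions, so that each one is counted exactly once.\<close>

definition tabloids :: "nat \<Rightarrow> (nat \<Rightarrow> nat) \<Rightarrow> (nat \<times> nat \<Rightarrow> nat) set" where
  "tabloids n lam = {T \<in> shape n lam \<rightarrow>\<^sub>E {1..n}.
     \<forall>r r' c. (r, c) \<in> shape n lam \<and> (r', c) \<in> shape n lam \<and> r < r' \<longrightarrow> T (r, c) < T (r', c)}"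

definition tableaux :: "nat \<Rightarrow> (nat \<Rightarrow> nat) \<Rightarrow> (nat \<times> nat \<Rightarrow> nat) set" where
  "tableaux n lam = {T \<in> tabloids n lam.
     \<forall>r c c'. (r, c) \<in> shape n lam \<and> (r, c') \<in> shape n lam \<and> c < c' \<longrightarrow> T (r, c) \<le> T (r, c')}"

definition filling_le ::
    "nat \<Rightarrow> (nat \<Rightarrow> nat) \<Rightarrow> (nat \<times> nat \<Rightarrow> nat) \<Rightarrow> (nat \<times> nat \<Rightarrow> nat) \<Rightarrow> bool" where
  "filling_le n lam T U \<longleftrightarrow> (\<forall>x \<in> shape n lam. T x \<le> U x)"

definition Y_col :: "nat set \<Rightarrow> nat \<Rightarrow> nat" where
  "Y_col P r = sorted_list_of_set P ! (r - 1)"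

definition Q_chain :: "nat \<Rightarrow> nat set \<Rightarrow> nat set list \<Rightarrow> bool" where
  "Q_chain n Q \<pi> \<longleftrightarrow> (\<forall>P \<in> set \<pi>. P \<subseteq> {1..n}) \<and> sorted_wrt (\<subset>) \<pi> \<and>
     map card \<pi> = sorted_list_of_set Q"

definition key_tableau :: "nat \<Rightarrow> (nat \<Rightarrow> nat) \<Rightarrow> nat set list \<Rightarrow> nat \<times> nat \<Rightarrow> nat" where
  "key_tableau n lam \<pi> = restrict (\<lambda>(r, c).
     Y_col (if col_len n lam c = n then {1..n}
            else THE P. P \<in> set \<pi> \<and> card P = col_len n lam c) r) (shape n lam)"

section \<open>Scanning tableaux\<close>

text \<open>
  The earliest weakly increasing subsequence is computed on a list of locations, compared by their
  values under \<open>f\<close>, so that the locations of its members can be marked.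
\<close>

fun ewis_from :: "('a \<Rightarrow> nat) \<Rightarrow> nat \<Rightarrow> 'a list \<Rightarrow> 'a list" where
  "ewis_from f v [] = []"
| "ewis_from f v (x # xs) = (if f x \<ge> v then x # ewis_from f (f x) xs else ewis_from f v xs)"

fun ewis :: "('a \<Rightarrow> nat) \<Rightarrow> 'a list \<Rightarrow> 'a list" where
  "ewis f [] = []"
| "ewis f (x # xs) = x # ewis_from f (f x) xs"

text \<open>\<open>M\<close> is the set of marked locations; only columns \<open>c\<close>, \<dots>, \<open>lam 1\<close> are considered.\<close>

definition bottom_locs ::
    "nat \<Rightarrow> (nat \<Rightarrow> nat) \<Rightarrow> nat \<Rightarrow> (nat \<times> nat) set \<Rightarrow> (nat \<times> nat) list" where
  "bottom_locs n lam c M =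
     map (\<lambda>d. (Max {r. (r, d) \<in> shape n lam - M}, d))
       (filter (\<lambda>d. \<exists>r. (r, d) \<in> shape n lam - M) [c..<Suc (lam 1)])"

text \<open>The locations marked after \<open>k\<close> rounds of the filling of column \<open>c\<close>.\<close>

primrec scan_marks ::
    "nat \<Rightarrow> (nat \<Rightarrow> nat) \<Rightarrow> (nat \<times> nat \<Rightarrow> nat) \<Rightarrow> nat \<Rightarrow> nat \<Rightarrow> (nat \<times> nat) set" where
  "scan_marks n lam T c 0 = {}"
| "scan_marks n lam T c (Suc k) =
     scan_marks n lam T c k \<union> set (ewis T (bottom_locs n lam c (scan_marks n lam T c k)))"

text \<open>
  Columns are filled from the bottom up, so row \<open>r\<close> of column \<open>c\<close> is filled after
  \<open>col_len n lam c - r\<close> rounds.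
\<close>

definition scanning :: "nat \<Rightarrow> (nat \<Rightarrow> nat) \<Rightarrow> (nat \<times> nat \<Rightarrow> nat) \<Rightarrow> nat \<times> nat \<Rightarrow> nat" where
  "scanning n lam T = restrict (\<lambda>(r, c).
     T (last (ewis T (bottom_locs n lam c (scan_marks n lam T c (col_len n lam c - r))))))
     (shape n lam)"

definition demazure_tableaux ::
    "nat \<Rightarrow> (nat \<Rightarrow> nat) \<Rightarrow> nat set list \<Rightarrow> (nat \<times> nat \<Rightarrow> nat) set" where
  "demazure_tableaux n lam \<pi> =
     {T \<in> tableaux n lam. filling_le n lam (scanning n lam T) (key_tableau n lam \<pi>)}"

definition tableau_weight ::
    "nat \<Rightarrow> (nat \<Rightarrow> nat) \<Rightarrow> (nat \<Rightarrow> complex) \<Rightarrow> (nat \<times> nat \<Rightarrow> nat) \<Rightarrow> complex" where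
  "tableau_weight n lam y T = (\<Prod>i = 1..n. y i ^ card {x \<in> shape n lam. T x = i})"

section \<open>Quotients of vector spaces and traces of induced maps\<close>

text \<open>
  \<open>V\<close> and \<open>W \<subseteq> V\<close> are subspaces of a vector space with scalar multiplication \<open>scale\<close>. The
  elements of the quotient are the cosets of \<open>W\<close>; its zero is \<open>W\<close> itself.
\<close>

definition coset :: "'b::ab_group_add set \<Rightarrow> 'b \<Rightarrow> 'b set" where
  "coset W v = (\<lambda>w. v + w) ` W"

definition quot_space :: "'b::ab_group_add set \<Rightarrow> 'b set \<Rightarrow> 'b set set" where
  "quot_space V W = coset W ` V"

definition quot_add :: "'b::ab_group_add set \<Rightarrow> 'b set \<Rightarrow> 'b set" where
  "quot_add A B = {a + b | a b. a \<in> A \<and> b \<in> B}"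

definition quot_scale ::
    "('k::field \<Rightarrow> 'b::ab_group_add \<Rightarrow> 'b) \<Rightarrow> 'b set \<Rightarrow> 'k \<Rightarrow> 'b set \<Rightarrow> 'b set" where
  "quot_scale scale W k A = {scale k a + w | a w. a \<in> A \<and> w \<in> W}"

definition quot_lincomb ::
    "('k::field \<Rightarrow> 'b::ab_group_add \<Rightarrow> 'b) \<Rightarrow> 'b set \<Rightarrow> 'k list \<Rightarrow> 'b set list \<Rightarrow> 'b set" where
  "quot_lincomb scale W ks Bs =
     foldr (\<lambda>(k, B) S. quot_add (quot_scale scale W k B) S) (zip ks Bs) W"

definition quot_basis ::
    "('k::field \<Rightarrow> 'b::ab_group_add \<Rightarrow> 'b) \<Rightarrow> 'b set \<Rightarrow> 'b set \<Rightarrow> 'b set list \<Rightarrow> bool" where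
  "quot_basis scale V W Bs \<longleftrightarrow> set Bs \<subseteq> quot_space V W \<and>
     (\<forall>A \<in> quot_space V W. \<exists>!ks. length ks = length Bs \<and> quot_lincomb scale W ks Bs = A)"

text \<open>The map of the quotient by \<open>W\<close> induced by a map \<open>f\<close> that preserves \<open>W\<close>.\<close>

definition induced_map :: "'b::ab_group_add set \<Rightarrow> ('b \<Rightarrow> 'b) \<Rightarrow> 'b set \<Rightarrow> 'b set" where
  "induced_map W f A = (\<Union>a \<in> A. coset W (f a))"

definition quot_matrix ::
    "('k::field \<Rightarrow> 'b::ab_group_add \<Rightarrow> 'b) \<Rightarrow> 'b set \<Rightarrow> 'b set list \<Rightarrow> ('b set \<Rightarrow> 'b set) \<Rightarrow>
      'k mat \<Rightarrow> bool" where
  "quot_matrix scale W Bs F M \<longleftrightarrow> M \<in> carrier_mat (length Bs) (length Bs) \<and>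
     (\<forall>j < length Bs. F (Bs ! j) = quot_lincomb scale W (list_of_vec (col M j)) Bs)"

definition quot_trace ::
    "('k::field \<Rightarrow> 'b::ab_group_add \<Rightarrow> 'b) \<Rightarrow> 'b set \<Rightarrow> 'b set \<Rightarrow> ('b set \<Rightarrow> 'b set) \<Rightarrow> 'k" where
  "quot_trace scale V W F = (THE t. \<exists>Bs M. quot_basis scale V W Bs \<and>
     quot_matrix scale W Bs F M \<and> t = (\<Sum>i < length Bs. M $$ (i, i)))"

section \<open>Polynomials in the entries of a matrix\<close>

text \<open>
  The variable with index \<open>(i, j)\<close> is the entry of a matrix in row \<open>i\<close> and column \<open>j\<close>,
  counted from 1; entries of type \<^typ>\<open>complex mat\<close> are counted from 0.
\<close>

type_synonym entry_poly = "(nat \<times> nat \<Rightarrow>\<^sub>0 nat) \<Rightarrow>\<^sub>0 complex"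

definition const_poly :: "complex \<Rightarrow> entry_poly" where
  "const_poly k = Poly_Mapping.single 0 k"

definition entry :: "nat \<Rightarrow> nat \<Rightarrow> entry_poly" where
  "entry i j = Poly_Mapping.single (Poly_Mapping.single (i, j) 1) 1"

definition scale_poly :: "complex \<Rightarrow> entry_poly \<Rightarrow> entry_poly" where
  "scale_poly k p = const_poly k * p"

interpretation poly: vector_space scale_poly
proof
  fix a b :: complex and x y :: entry_poly
  show "scale_poly a (x + y) = scale_poly a x + scale_poly a y"
    by (simp add: scale_poly_def distrib_left)
  show "scale_poly (a + b) x = scale_poly a x + scale_poly b x"
    by (simp add: scale_poly_def const_poly_def single_add distrib_right)
  show "scale_poly a (scale_poly b x) = scale_poly (a * b) x"
    by (simp add: scale_poly_def const_poly_def mult_single mult.assoc [symmetric])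
  show "scale_poly 1 x = x"
    by (simp add: scale_poly_def const_poly_def)
qed

text \<open>
  Evaluation at a point \<open>\<sigma>\<close> of a commutative ring, with coefficients mapped by \<open>\<phi>\<close>.
\<close>

definition poly_at ::
    "(complex \<Rightarrow> 'r::comm_ring_1) \<Rightarrow> (nat \<times> nat \<Rightarrow> 'r) \<Rightarrow> entry_poly \<Rightarrow> 'r" where
  "poly_at \<phi> \<sigma> p = (\<Sum>m \<in> Poly_Mapping.keys p. \<phi> (Poly_Mapping.lookup p m) *
     (\<Prod>v \<in> Poly_Mapping.keys m. \<sigma> v ^ Poly_Mapping.lookup m v))"

abbreviation eval_poly :: "(nat \<times> nat \<Rightarrow> complex) \<Rightarrow> entry_poly \<Rightarrow> complex" where
  "eval_poly \<equiv> poly_at (\<lambda>k. k)"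

abbreviation subst_poly :: "(nat \<times> nat \<Rightarrow> entry_poly) \<Rightarrow> entry_poly \<Rightarrow> entry_poly" where
  "subst_poly \<equiv> poly_at const_poly"

definition eval_at_mat :: "complex mat \<Rightarrow> entry_poly \<Rightarrow> complex" where
  "eval_at_mat f = eval_poly (\<lambda>(i, j). f $$ (i - 1, j - 1))"

text \<open>
  \<open>(h.\<xi>)(f) = \<xi>(h\<^sup>-\<^sup>1 f)\<close>, i.e. the entry \<open>(i, j)\<close> of the generic matrix is replaced by
  the entry \<open>(i, j)\<close> of \<open>h\<^sup>-\<^sup>1\<close> times the generic matrix; the lemma \<open>eval_act\<close> below
  confirms this.
\<close>

definition act :: "nat \<Rightarrow> complex mat \<Rightarrow> entry_poly \<Rightarrow> entry_poly" where
  "act n h \<xi> = subst_poly (\<lambda>(i, j).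
     \<Sum>k = 1..n. const_poly (the (mat_inverse h) $$ (i - 1, k - 1)) * entry k j) \<xi>"

lemma poly_at_mono_add:
  fixes \<sigma> :: "nat \<times> nat \<Rightarrow> 'r::comm_ring_1"
  shows "(\<Prod>v \<in> Poly_Mapping.keys (a + b). \<sigma> v ^ Poly_Mapping.lookup (a + b) v) =
    (\<Prod>v \<in> Poly_Mapping.keys a. \<sigma> v ^ Poly_Mapping.lookup a v) *
    (\<Prod>v \<in> Poly_Mapping.keys b. \<sigma> v ^ Poly_Mapping.lookup b v)"
proof -
  let ?A = "Poly_Mapping.keys a \<union> Poly_Mapping.keys b"
  have *: "(\<Prod>v \<in> Poly_Mapping.keys m. \<sigma> v ^ Poly_Mapping.lookup m v) =
      (\<Prod>v \<in> ?A. \<sigma> v ^ Poly_Mapping.lookup m v)" if "Poly_Mapping.keys m \<subseteq> ?A" for m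
    using that by (intro prod.mono_neutral_left) (auto simp: in_keys_iff)
  have "Poly_Mapping.keys (a + b) \<subseteq> ?A"
    by (rule keys_add)
  then show ?thesis
    unfolding *[OF \<open>Poly_Mapping.keys (a + b) \<subseteq> ?A\<close>] *[OF Un_upper1] *[OF Un_upper2]
    by (simp add: lookup_add power_add prod.distrib)
qed

lemma eval_poly_single:
  "eval_poly \<sigma> (Poly_Mapping.single m k) =
    k * (\<Prod>v \<in> Poly_Mapping.keys m. \<sigma> v ^ Poly_Mapping.lookup m v)"
  by (simp add: poly_at_def)

lemma eval_poly_add: "eval_poly \<sigma> (p + q) = eval_poly \<sigma> p + eval_poly \<sigma> q"
  unfolding poly_at_def by (rule setsum_keys_plus_distrib) (auto simp: distrib_right)

lemma eval_poly_sum: "eval_poly \<sigma> (sum g A) = (\<Sum>x \<in> A. eval_poly \<sigma> (g x))"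
  by (induction A rule: infinite_finite_induct) (auto simp: eval_poly_add, auto simp: poly_at_def)

lemma sum_single_keys:
  "(\<Sum>m \<in> Poly_Mapping.keys p. Poly_Mapping.single m (Poly_Mapping.lookup p m)) = p"
  by (rule poly_mapping_eqI)
    (auto simp: lookup_sum lookup_single when_def in_keys_iff)

lemma eval_poly_mult: "eval_poly \<sigma> (p * q) = eval_poly \<sigma> p * eval_poly \<sigma> q"
proof -
  let ?s = "\<lambda>p m. Poly_Mapping.single m (Poly_Mapping.lookup p m)"
  have "p * q = (\<Sum>m \<in> Poly_Mapping.keys p. ?s p m) * (\<Sum>m' \<in> Poly_Mapping.keys q. ?s q m')"
    by (simp add: sum_single_keys)
  also have "\<dots> = (\<Sum>m \<in> Poly_Mapping.keys p. \<Sum>m' \<in> Poly_Mapping.keys q. ?s p m * ?s q m')"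
    by (rule sum_product)
  finally have "eval_poly \<sigma> (p * q) =
      (\<Sum>m \<in> Poly_Mapping.keys p. \<Sum>m' \<in> Poly_Mapping.keys q.
        eval_poly \<sigma> (?s p m) * eval_poly \<sigma> (?s q m'))"
    by (simp add: eval_poly_sum mult_single eval_poly_single poly_at_mono_add mult_ac)
  also have "\<dots> = eval_poly \<sigma> (\<Sum>m \<in> Poly_Mapping.keys p. ?s p m) *
      eval_poly \<sigma> (\<Sum>m' \<in> Poly_Mapping.keys q. ?s q m')"
    by (simp only: sum_product eval_poly_sum)
  finally show ?thesis by (simp add: sum_single_keys)
qed

lemma eval_poly_const: "eval_poly \<sigma> (const_poly k) = k"
  by (simp add: const_poly_def eval_poly_single)

lemma eval_poly_one: "eval_poly \<sigma> 1 = 1"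
  using eval_poly_const [of \<sigma> 1] by (simp add: const_poly_def)

lemma eval_poly_entry: "eval_poly \<sigma> (entry i j) = \<sigma> (i, j)"
  by (simp add: entry_def eval_poly_single)

lemma eval_poly_power: "eval_poly \<sigma> (p ^ k) = eval_poly \<sigma> p ^ k"
  by (induction k) (simp_all add: eval_poly_mult eval_poly_one)

lemma eval_poly_prod: "eval_poly \<sigma> (prod g A) = (\<Prod>x \<in> A. eval_poly \<sigma> (g x))"
  by (induction A rule: infinite_finite_induct) (auto simp: eval_poly_mult eval_poly_one)

lemma eval_subst_poly: "eval_poly \<sigma> (subst_poly \<tau> p) = eval_poly (\<lambda>v. eval_poly \<sigma> (\<tau> v)) p"
  unfolding poly_at_def [of const_poly] poly_at_def [of "\<lambda>k. k" "\<lambda>v. eval_poly \<sigma> (\<tau> v)"]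
  by (simp add: eval_poly_sum eval_poly_mult eval_poly_prod eval_poly_power eval_poly_const)

lemma eval_act:
  assumes h: "h \<in> carrier_mat n n" "mat_inverse h = Some g" and f: "f \<in> carrier_mat n n"
    and \<xi>: "\<And>m. m \<in> Poly_Mapping.keys \<xi> \<Longrightarrow> Poly_Mapping.keys m \<subseteq> {1..n} \<times> {1..n}"
  shows "eval_at_mat f (act n h \<xi>) = eval_at_mat (g * f) \<xi>"
proof -
  have g: "g \<in> carrier_mat n n"
    using mat_inverse(2)[OF h] by blast
  have *: "(\<Sum>k = 1..n. g $$ (i - 1, k - 1) * f $$ (k - 1, j - 1)) = (g * f) $$ (i - 1, j - 1)"
    if "i \<in> {1..n}" "j \<in> {1..n}" for i j
  proof -
    have "(\<Sum>k = 1..n. g $$ (i - 1, k - 1) * f $$ (k - 1, j - 1)) =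
        (\<Sum>k = 0..<n. g $$ (i - 1, k) * f $$ (k, j - 1))"
      by (rule sum.reindex_bij_witness [of _ Suc "\<lambda>k. k - 1"]) auto
    also have "\<dots> = (g * f) $$ (i - 1, j - 1)"
      using that g f by (auto simp: scalar_prod_def)
    finally show ?thesis .
  qed
  show ?thesis
    unfolding eval_at_mat_def act_def eval_subst_poly poly_at_def [of "\<lambda>k. k" _ \<xi>]
  proof (intro sum.cong prod.cong refl arg_cong2 [of _ _ _ _ "(*)"] arg_cong2 [of _ _ _ _ "(^)"])
    fix m v assume mv: "m \<in> Poly_Mapping.keys \<xi>" "v \<in> Poly_Mapping.keys m"
    obtain i j where v: "v = (i, j)" by (cases v)
    have "i \<in> {1..n}" "j \<in> {1..n}"
      using \<xi>[OF mv(1)] mv(2) v by auto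
    then show "eval_poly (\<lambda>(i, j). f $$ (i - 1, j - 1))
        (case v of (i, j) \<Rightarrow>
          \<Sum>k = 1..n. const_poly (the (mat_inverse h) $$ (i - 1, k - 1)) * entry k j) =
        (case v of (i, j) \<Rightarrow> (g * f) $$ (i - 1, j - 1))"
      using * h(2) v
      by (simp add: eval_poly_sum eval_poly_mult eval_poly_const eval_poly_entry)
  qed
qed

section \<open>The modules and their characters\<close>

definition initial_minor :: "nat \<Rightarrow> (nat \<Rightarrow> nat) \<Rightarrow> entry_poly" where
  "initial_minor q \<rho> = det (mat q q (\<lambda>(i, j). entry (\<rho> (i + 1)) (j + 1)))"

definition tabloid_monomial :: "nat \<Rightarrow> (nat \<Rightarrow> nat) \<Rightarrow> (nat \<times> nat \<Rightarrow> nat) \<Rightarrow> entry_poly" where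
  "tabloid_monomial n lam T =
     (\<Prod>c = 1..lam 1. initial_minor (col_len n lam c) (\<lambda>r. T (r, c)))"

definition Gamma_space :: "nat \<Rightarrow> (nat \<Rightarrow> nat) \<Rightarrow> entry_poly set" where
  "Gamma_space n lam = poly.span (tabloid_monomial n lam ` tabloids n lam)"

definition Z_space :: "nat \<Rightarrow> (nat \<Rightarrow> nat) \<Rightarrow> nat set list \<Rightarrow> entry_poly set" where
  "Z_space n lam \<pi> = poly.span (tabloid_monomial n lam `
     {T \<in> tabloids n lam. \<not> filling_le n lam T (key_tableau n lam \<pi>)})"

definition torus_element :: "nat \<Rightarrow> (nat \<Rightarrow> complex) \<Rightarrow> complex mat" where
  "torus_element n y = mat_diag n (\<lambda>i. inverse (y (i + 1)))"

text \<open>The trace of \<open>h\<close> on the quotient of \<open>Gamma_space\<close> by \<open>Z_space\<close>.\<close>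

definition Gamma_character :: "nat \<Rightarrow> (nat \<Rightarrow> nat) \<Rightarrow> nat set list \<Rightarrow> complex mat \<Rightarrow> complex" where
  "Gamma_character n lam \<pi> h =
     quot_trace scale_poly (Gamma_space n lam) (Z_space n lam \<pi>)
       (induced_map (Z_space n lam \<pi>) (act n h))"

end

theory Submission
  imports Defs
begin

text \<open>
  Extend the chain to a permutation \<open>w\<close>. A tabloid is treated as the list of its columns from right to
  left, and the Demazure condition becomes recursive: the last column \<open>C\<close> has to lie below \<open>w\<close>, and
  the other columns have to satisfy the condition for a smaller bound \<open>upd\<close>, which depends on \<open>C\<close>. In
  terms of upper counts (how many entries exceed \<open>t\<close>) passing a scan through one more column is
  adjoint to \<open>upd\<close>, which gives the equivalence with scanning.

  Spanning: if a column \<open>F\<close> left of \<open>C\<close> violates \<open>upd\<close>, alternating over suitable rows of \<open>F\<close> and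
  \<open>C\<close> and exchanging rows expresses the product of the two minors by products in which the
  column replacing \<open>C\<close> has a larger sum or the column replacing \<open>F\<close> does not lie below \<open>w\<close>.

  Independence: \<open>upd\<close> for \<open>w\<close> and \<open>C\<close> is the bound given by another permutation \<open>v\<close> whose first
  values are \<open>C\<close> and whose Bruhat cell lies in the closure of that of \<open>w\<close>. In a relation on the
  cell of \<open>w\<close> take \<open>C\<close> minimal among the last columns; on the cell of \<open>v\<close> only the terms with last
  column \<open>C\<close> survive, and there the minor of \<open>C\<close> has no zeros and cancels.

  The resulting monomial basis of the quotient consists of eigenvectors of the torus.
\<close>

section \<open>Minors and the exchange relation\<close>

text \<open>Independence is needed modulo \<open>Z_space\<close>, which is more than independence of
  the monomials. Evaluation on the cell of \<open>w\<close> settles this: every product generating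
  \<open>Z_space\<close> contains a minor that vanishes there, so a relation modulo
  \<open>Z_space\<close> becomes a relation between functions on the cell. Spanning is proved for an
  arbitrary family \<open>g\<close> of bounds, because \<open>upd\<close> need not come from a
  permutation when \<open>C\<close> does not lie below \<open>w\<close>; lists with such a
  \<open>C\<close> generate \<open>Z_space\<close> and may stay in the spanning set. Independence
  needs a permutation at every stage, and there each \<open>C\<close> does lie below the current
  one. A family of bounds, one for each length, is updated at once, since a column constrains all
  columns to its left. Weakly increasing rows are not demanded in the recursion: they are forced by
  the bound at threshold 0, which never exceeds the column length. Exchanging rows yields positive
  integer multiples of the wanted products; the integers are inverted in the complex field.\<close>

definition rowdet :: "(nat \<Rightarrow> nat \<Rightarrow> 'a::comm_ring_1) \<Rightarrow> nat \<Rightarrow> (nat \<Rightarrow> nat) \<Rightarrow> 'a" where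
  "rowdet x q \<rho> = det (mat q q (\<lambda>(i, j). x (\<rho> i) (Suc j)))"

text \<open>\<open>rowdet\<close> takes a row function, so that exchanges may create repeated or
  unsorted rows; \<open>minor\<close> is the sorted representative. The ring is left open because
  both serve for \<open>entry\<close> and for the values at a point of a cell.\<close>

definition minor :: "(nat \<Rightarrow> nat \<Rightarrow> 'a::comm_ring_1) \<Rightarrow> nat set \<Rightarrow> 'a" where
  "minor x C = rowdet x (card C) (\<lambda>i. sorted_list_of_set C ! i)"

definition col_monom :: "(nat \<Rightarrow> nat \<Rightarrow> 'a::comm_ring_1) \<Rightarrow> nat set list \<Rightarrow> 'a" where
  "col_monom x Cs = (\<Prod>C\<leftarrow>Cs. minor x C)"

lemma rowdet_cong:
  assumes "\<And>i. i < q \<Longrightarrow> \<rho> i = \<tau> i"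
  shows "rowdet x q \<rho> = rowdet x q \<tau>"
  unfolding rowdet_def using assms by (intro arg_cong [where f = det] eq_matI) auto

lemma rowdet_permute:
  assumes "\<pi> permutes {0..<q}"
  shows "rowdet x q (\<rho> \<circ> \<pi>) = of_int (sign \<pi>) * rowdet x q \<rho>"
proof -
  let ?A = "mat q q (\<lambda>(i, j). x (\<rho> i) (Suc j))"
  have "rowdet x q (\<rho> \<circ> \<pi>) = det (mat q q (\<lambda>(i, j). ?A $$ (\<pi> i, j)))"
    unfolding rowdet_def using permutes_in_image [OF assms]
    by (intro arg_cong [where f = det] eq_matI) auto
  then show ?thesis
    using det_permute_rows [OF _ assms, of ?A] by (simp add: rowdet_def)
qed

lemma rowdet_not_inj:
  assumes "\<not> inj_on \<rho> {0..<q}"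
  shows "rowdet x q \<rho> = 0"
proof -
  obtain i j where ij: "i < q" "j < q" "i \<noteq> j" "\<rho> i = \<rho> j"
    using assms by (auto simp: inj_on_def)
  show ?thesis
    unfolding rowdet_def
    by (rule Determinant.det_identical_rows [OF _ ij(3,1,2)]) (use ij in \<open>auto intro!: eq_vecI\<close>)
qed

lemma rowdet_sort:
  assumes "inj_on \<rho> {0..<q}"
  obtains \<pi> where "\<pi> permutes {0..<q}"
    and "rowdet x q \<rho> = of_int (sign \<pi>) * minor x (\<rho> ` {0..<q})"
proof -
  let ?C = "\<rho> ` {0..<q}"
  let ?L = "sorted_list_of_set ?C"
  have card: "card ?C = q"
    using card_image [OF assms] by simp
  have L: "bij_betw ((!) ?L) {0..<q} ?C"
    using card by (intro bij_betw_nth) (auto simp: atLeast0LessThan)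
  have \<rho>: "bij_betw \<rho> {0..<q} ?C"
    using assms by (simp add: bij_betw_def)
  define \<pi> where "\<pi> i = (if i < q then the_inv_into {0..<q} ((!) ?L) (\<rho> i) else i)" for i
  have "bij_betw (the_inv_into {0..<q} ((!) ?L) \<circ> \<rho>) {0..<q} {0..<q}"
    using bij_betw_trans [OF \<rho> bij_betw_the_inv_into [OF L]] .
  then have "bij_betw \<pi> {0..<q} {0..<q}"
    by (rule bij_betw_cong [THEN iffD1, rotated]) (simp add: \<pi>_def)
  then have \<pi>: "\<pi> permutes {0..<q}"
    by (rule bij_imp_permutes) (simp add: \<pi>_def)
  have "?L ! \<pi> i = \<rho> i" if "i < q" for i
    using f_the_inv_into_f_bij_betw [OF L, of "\<rho> i"] that by (simp add: \<pi>_def)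
  then have "rowdet x q \<rho> = rowdet x q ((!) ?L \<circ> \<pi>)"
    by (intro rowdet_cong) simp
  then show ?thesis
    using that [OF \<pi>] rowdet_permute [OF \<pi>, of x "(!) ?L"] by (simp add: minor_def card)
qed

text \<open>Cramer's rule without division. With F the matrix of the rows \<open>\<rho>\<close>,
  replacing row i of F by row \<open>c\<close> and taking determinants gives the entries of the row
  vector c adj F, and adj F times F is det F times the identity.\<close>

lemma rowdet_cramer:
  assumes k: "k < p"
  shows "(\<Sum>i<p. rowdet x p (\<rho>(i := c)) * x (\<rho> i) (Suc k)) = rowdet x p \<rho> * x c (Suc k)"
proof -
  let ?F = "mat p p (\<lambda>(i, j). x (\<rho> i) (Suc j))"
  have F: "?F \<in> carrier_mat p p"
    by simp
  have row: "rowdet x p (\<rho>(i := c)) = (\<Sum>l<p. x c (Suc l) * cofactor ?F i l)" if i: "i < p" for i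
  proof -
    let ?G = "mat p p (\<lambda>(i', j). x ((\<rho>(i := c)) i') (Suc j))"
    have "mat_delete ?G i l = mat_delete ?F i l" if "l < p" for l
      unfolding mat_delete_def using i that by (intro eq_matI) auto
    then have "(\<Sum>l<p. ?G $$ (i, l) * cofactor ?G i l) = (\<Sum>l<p. x c (Suc l) * cofactor ?F i l)"
      using i by (intro sum.cong) (simp_all add: cofactor_def)
    then show ?thesis
      unfolding rowdet_def using laplace_expansion_row [of ?G p i] i by simp
  qed
  have orth: "(\<Sum>i<p. cofactor ?F i l * x (\<rho> i) (Suc k)) = (if l = k then det ?F else 0)"
    if l: "l < p" for l
  proof -
    have "(adj_mat ?F * ?F) $$ (l, k) = (\<Sum>i = 0..<p. cofactor ?F i l * x (\<rho> i) (Suc k))"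
      using l k by (simp add: adj_mat_def scalar_prod_def)
    then show ?thesis
      using adj_mat(3) [OF F] l k by (auto simp: atLeast0LessThan)
  qed
  have "(\<Sum>i<p. rowdet x p (\<rho>(i := c)) * x (\<rho> i) (Suc k)) =
      (\<Sum>i<p. \<Sum>l<p. x c (Suc l) * (cofactor ?F i l * x (\<rho> i) (Suc k)))"
    by (simp add: row sum_distrib_right mult.assoc)
  also have "\<dots> = (\<Sum>l<p. x c (Suc l) * (\<Sum>i<p. cofactor ?F i l * x (\<rho> i) (Suc k)))"
    by (subst sum.swap) (simp add: sum_distrib_left)
  also have "\<dots> = (\<Sum>l<p. if l = k then x c (Suc l) * det ?F else 0)"
    by (intro sum.cong) (simp_all add: orth)
  also have "\<dots> = rowdet x p \<rho> * x c (Suc k)"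
    using k by (simp add: rowdet_def)
  finally show ?thesis .
qed

text \<open>Pluecker exchange of a single row: expand the shorter determinant along its row
  \<open>k\<close> and apply \<open>rowdet_cramer\<close> in each of its columns. By
  \<open>q \<le> p\<close> these are also columns of the longer determinant.\<close>

lemma rowdet_exchange:
  assumes "q \<le> p" and k: "k < q"
  shows "rowdet x p \<rho> * rowdet x q \<tau> =
    (\<Sum>i<p. rowdet x p (\<rho>(i := \<tau> k)) * rowdet x q (\<tau>(k := \<rho> i)))"
proof -
  let ?C = "mat q q (\<lambda>(i, j). x (\<tau> i) (Suc j))"
  have row: "rowdet x q (\<tau>(k := c)) = (\<Sum>l<q. x c (Suc l) * cofactor ?C k l)" for c
  proof -
    let ?G = "mat q q (\<lambda>(i', j). x ((\<tau>(k := c)) i') (Suc j))"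
    have "mat_delete ?G k l = mat_delete ?C k l" if "l < q" for l
      unfolding mat_delete_def using k that by (intro eq_matI) auto
    then have "(\<Sum>l<q. ?G $$ (k, l) * cofactor ?G k l) = (\<Sum>l<q. x c (Suc l) * cofactor ?C k l)"
      using k by (intro sum.cong) (simp_all add: cofactor_def)
    then show ?thesis
      unfolding rowdet_def using laplace_expansion_row [of ?G q k] k by simp
  qed
  have "(\<Sum>i<p. rowdet x p (\<rho>(i := \<tau> k)) * rowdet x q (\<tau>(k := \<rho> i))) =
      (\<Sum>l<q. (\<Sum>i<p. rowdet x p (\<rho>(i := \<tau> k)) * x (\<rho> i) (Suc l)) * cofactor ?C k l)"
    unfolding row sum_distrib_left sum_distrib_right mult.assoc by (rule sum.swap)
  also have "\<dots> = (\<Sum>l<q. rowdet x p \<rho> * x (\<tau> k) (Suc l) * cofactor ?C k l)"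
    using assms by (intro sum.cong) (simp_all add: rowdet_cramer)
  also have "\<dots> = rowdet x p \<rho> * rowdet x q (\<tau>(k := \<tau> k))"
    unfolding row by (simp add: sum_distrib_left mult.assoc)
  finally show ?thesis by simp
qed

section \<open>Straightening\<close>

text \<open>The rows of both determinants form one sequence, those of the first in the positions
  below \<open>p\<close>, so that an exchange becomes precomposition with a transposition.\<close>

definition pairdet :: "(nat \<Rightarrow> nat \<Rightarrow> 'a::comm_ring_1) \<Rightarrow> nat \<Rightarrow> nat \<Rightarrow> (nat \<Rightarrow> nat) \<Rightarrow> 'a" where
  "pairdet x p q \<rho> = rowdet x p \<rho> * rowdet x q (\<lambda>i. \<rho> (p + i))"

lemma pairdet_exchange:
  assumes "q \<le> p" and k: "k \<in> {p..<p + q}"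
  shows "pairdet x p q \<rho> = (\<Sum>i<p. pairdet x p q (\<rho> \<circ> transpose k i))"
proof -
  let ?\<tau> = "\<lambda>i. \<rho> (p + i)"
  have "pairdet x p q \<rho> =
      (\<Sum>i<p. rowdet x p (\<rho>(i := ?\<tau> (k - p))) * rowdet x q (?\<tau>(k - p := \<rho> i)))"
    unfolding pairdet_def using assms by (intro rowdet_exchange) auto
  also have "\<dots> = (\<Sum>i<p. pairdet x p q (\<rho> \<circ> transpose k i))"
    unfolding pairdet_def using k
    by (intro sum.cong refl arg_cong2 [where f = "(*)"] rowdet_cong)
      (auto simp: transpose_def)
  finally show ?thesis .
qed

lemma pairdet_transpose:
  assumes "a \<noteq> b" and "{a, b} \<subseteq> {..<p} \<or> {a, b} \<subseteq> {p..<p + q}"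
  shows "pairdet x p q (\<rho> \<circ> transpose a b) = - pairdet x p q \<rho>"
  using assms(2)
proof
  assume ab: "{a, b} \<subseteq> {..<p}"
  have "rowdet x p (\<rho> \<circ> transpose a b) = - rowdet x p \<rho>"
    using ab assms(1) by (subst rowdet_permute) (auto intro!: permutes_swap_id simp: sign_swap_id)
  moreover have "rowdet x q (\<lambda>i. (\<rho> \<circ> transpose a b) (p + i)) = rowdet x q (\<lambda>i. \<rho> (p + i))"
    using ab by (intro rowdet_cong) (auto simp: transpose_def)
  ultimately show ?thesis by (simp add: pairdet_def)
next
  assume ab: "{a, b} \<subseteq> {p..<p + q}"
  let ?t = "transpose (a - p) (b - p)"
  have "rowdet x q (\<lambda>i. (\<rho> \<circ> transpose a b) (p + i)) = rowdet x q ((\<lambda>i. \<rho> (p + i)) \<circ> ?t)"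
    using ab by (intro rowdet_cong) (auto simp: transpose_def)
  also have "\<dots> = - rowdet x q (\<lambda>i. \<rho> (p + i))"
    using ab assms(1) by (subst rowdet_permute) (auto intro!: permutes_swap_id simp: sign_swap_id)
  moreover have "rowdet x p (\<rho> \<circ> transpose a b) = rowdet x p \<rho>"
    using ab by (intro rowdet_cong) (auto simp: transpose_def)
  ultimately show ?thesis by (simp add: pairdet_def)
qed

lemma pairdet_permute:
  assumes "\<pi> permutes S" and "S \<subseteq> {..<p} \<or> S \<subseteq> {p..<p + q}"
  shows "pairdet x p q (\<rho> \<circ> \<pi>) = of_int (sign \<pi>) * pairdet x p q \<rho>"
proof -
  have fin: "finite S"
    using assms(2) finite_subset by blast
  have perm: "\<sigma> permutes S \<Longrightarrow> permutation \<sigma>" for \<sigma>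
    using fin permutation_permutes by blast
  from assms(1) fin
  have "\<pi> permutes S \<and> (\<forall>\<rho>. pairdet x p q (\<rho> \<circ> \<pi>) = of_int (sign \<pi>) * pairdet x p q \<rho>)"
  proof (induction rule: permutes_induct)
    case id
    then show ?case by (simp add: permutes_def)
  next
    case (swap a b \<pi>)
    have "transpose a b \<circ> \<pi> permutes S"
      using swap by (intro permutes_compose permutes_swap_id) auto
    moreover have "pairdet x p q (\<rho> \<circ> (transpose a b \<circ> \<pi>)) =
        of_int (sign (transpose a b \<circ> \<pi>)) * pairdet x p q \<rho>" for \<rho>
    proof (cases "a = b")
      case True
      then show ?thesis using swap by (simp add: transpose_same)
    next
      case False
      have "pairdet x p q (\<rho> \<circ> (transpose a b \<circ> \<pi>)) =
          of_int (sign \<pi>) * pairdet x p q (\<rho> \<circ> transpose a b)"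
        using swap by (metis comp_assoc)
      also have "\<dots> = - (of_int (sign \<pi>) * pairdet x p q \<rho>)"
        using False swap assms(2) by (subst pairdet_transpose) auto
      also have "\<dots> = of_int (sign (transpose a b \<circ> \<pi>)) * pairdet x p q \<rho>"
        using False swap perm
        by (simp add: sign_compose permutation_swap_id sign_swap_id)
      finally show ?thesis .
    qed
    ultimately show ?case by blast
  qed
  then show ?thesis by blast
qed

section \<open>Alternating sums over rows of two minors\<close>

definition alternation ::
    "(nat \<Rightarrow> nat \<Rightarrow> 'a::comm_ring_1) \<Rightarrow> nat \<Rightarrow> nat \<Rightarrow> (nat \<Rightarrow> nat) \<Rightarrow> nat set \<Rightarrow> 'a" where
  "alternation x p q \<rho> J = (\<Sum>\<pi> | \<pi> permutes J. of_int (sign \<pi>) * pairdet x p q (\<rho> \<circ> \<pi>))"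

text \<open>Apply \<open>pairdet_exchange\<close> at position \<open>k\<close> to every term. A
  partner \<open>i\<close> in \<open>I\<close> only permutes the alternated positions and returns
  minus the whole sum; these \<open>card I\<close> copies move to the left side. For any other
  \<open>i\<close>, conjugation by the transposition gives an alternating sum with \<open>i\<close>
  in place of \<open>k\<close>: one alternated position has moved from the second block to the
  first.\<close>

lemma alternation_exchange:
  assumes "q \<le> p" and I: "I \<subseteq> {..<p}" and K: "K \<subseteq> {p..<p + q}" and k: "k \<in> K"
  shows "of_nat (Suc (card I)) * alternation x p q \<rho> (I \<union> K) =
    (\<Sum>i \<in> {..<p} - I. alternation x p q (\<rho> \<circ> transpose k i) (insert i I \<union> (K - {k})))"
proof -
  let ?S = "\<lambda>i. \<Sum>\<pi> | \<pi> permutes I \<union> K.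
    of_int (sign \<pi>) * pairdet x p q (\<rho> \<circ> \<pi> \<circ> transpose k i)"
  let ?A = "alternation x p q \<rho> (I \<union> K)"
  have fin: "finite (I \<union> K)" "finite I"
    using I K finite_subset by blast+
  have perm: "\<sigma> permutes I \<union> K \<Longrightarrow> permutation \<sigma>" for \<sigma>
    using fin(1) permutation_permutes by metis
  have kp: "k \<in> {p..<p + q}" using k K by auto
  have "?A = (\<Sum>i<p. ?S i)"
    unfolding alternation_def pairdet_exchange [OF assms(1) kp, of x "\<rho> \<circ> _"] sum_distrib_left
    by (rule sum.swap)
  also have "\<dots> = (\<Sum>i \<in> I. ?S i) + (\<Sum>i \<in> {..<p} - I. ?S i)"
    using I by (subst sum.subset_diff [of I]) auto
  also have "(\<Sum>i \<in> I. ?S i) = (\<Sum>i \<in> I. - ?A)"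
  proof (rule sum.cong [OF refl])
    fix i assume i: "i \<in> I"
    have ne: "k \<noteq> i" using kp i I by auto
    have t: "transpose k i permutes I \<union> K"
      using i k by (intro permutes_swap_id) auto
    have "?A = (\<Sum>\<pi> | \<pi> permutes I \<union> K. of_int (sign (\<pi> \<circ> transpose k i)) *
        pairdet x p q (\<rho> \<circ> (\<pi> \<circ> transpose k i)))"
      unfolding alternation_def by (rule sum_permutations_compose_right [OF t])
    also have "\<dots> = (\<Sum>\<pi> | \<pi> permutes I \<union> K. - (of_int (sign \<pi>) *
        pairdet x p q (\<rho> \<circ> \<pi> \<circ> transpose k i)))"
      using ne perm by (intro sum.cong)
        (simp_all add: sign_compose permutation_swap_id sign_swap_id comp_assoc)
    finally show "?S i = - ?A" by (simp add: sum_negf)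
  qed
  also have "(\<Sum>i \<in> {..<p} - I. ?S i) =
    (\<Sum>i \<in> {..<p} - I. alternation x p q (\<rho> \<circ> transpose k i) (insert i I \<union> (K - {k})))"
  proof (rule sum.cong [OF refl])
    fix i assume i: "i \<in> {..<p} - I"
    let ?t = "transpose k i"
    let ?J = "insert i I \<union> (K - {k})"
    have im: "?t ` (I \<union> K) = ?J" "?t ` ?J = I \<union> K"
      using i kp I K k by (auto simp: transpose_def image_iff)
    have conj: "?t \<circ> \<pi> \<circ> ?t permutes ?t ` J" if "\<pi> permutes J" for \<pi> J
    proof -
      have "bij (?t \<circ> \<pi> \<circ> ?t)"
        using permutes_bij [OF that] by (intro bij_comp) auto
      moreover have "(?t \<circ> \<pi> \<circ> ?t) y = y" if "y \<notin> ?t ` J" for y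
      proof -
        have "?t y \<notin> J"
          using that by (metis imageI transpose_involutory)
        then show ?thesis
          using permutes_not_in [OF \<open>\<pi> permutes J\<close>] by simp
      qed
      ultimately show ?thesis
        unfolding permutes_def bij_iff by blast
    qed
    have sgn: "sign (?t \<circ> \<pi> \<circ> ?t) = sign \<pi>" if "permutation \<pi>" for \<pi>
      using that by (simp add: sign_compose permutation_swap_id permutation_compose sign_swap_id)
    let ?c = "\<lambda>\<pi>. ?t \<circ> \<pi> \<circ> ?t"
    have inv: "?c (?c \<pi>) = \<pi>" for \<pi> :: "nat \<Rightarrow> nat"
      by (simp add: fun_eq_iff)
    show "?S i = alternation x p q (\<rho> \<circ> ?t) ?J"
      unfolding alternation_def
    proof (rule sum.reindex_bij_witness [of _ ?c ?c])
      fix \<pi> assume "\<pi> \<in> {\<pi>. \<pi> permutes I \<union> K}"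
      then have \<pi>: "\<pi> permutes I \<union> K" by simp
      show "?c \<pi> \<in> {\<pi>. \<pi> permutes ?J}"
        using conj [OF \<pi>] unfolding im by simp
      have "\<rho> \<circ> ?t \<circ> ?c \<pi> = \<rho> \<circ> \<pi> \<circ> ?t"
        by (simp add: fun_eq_iff)
      then show "of_int (sign (?c \<pi>)) * pairdet x p q (\<rho> \<circ> ?t \<circ> ?c \<pi>) =
          of_int (sign \<pi>) * pairdet x p q (\<rho> \<circ> \<pi> \<circ> ?t)"
        using sgn [OF perm [OF \<pi>]] by simp
    next
      fix \<pi> assume "\<pi> \<in> {\<pi>. \<pi> permutes ?J}"
      then have "\<pi> permutes ?J" by simp
      from conj [OF this] show "?c \<pi> \<in> {\<pi>. \<pi> permutes I \<union> K}"
        unfolding im by simp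
    qed (rule inv)+
  qed
  finally show ?thesis
    using fin by (simp add: algebra_simps)
qed

lemma poly_scale_of_nat: "scale_poly (of_nat k) v = of_nat k * v"
  by (simp add: scale_poly_def const_poly_def single_of_nat)

text \<open>Characteristic zero enters here. The multiples to be removed are
  \<open>Suc (card I)\<close> from \<open>alternation_exchange\<close> and the number of block
  permutations in \<open>straighten\<close>.\<close>

lemma poly_subspace_of_nat_mult:
  assumes W: "poly.subspace W" and "of_nat k * v \<in> W" and "k \<noteq> 0"
  shows "v \<in> W"
proof -
  have "scale_poly (inverse (of_nat k)) (of_nat k * v) = v"
    unfolding poly_scale_of_nat [symmetric] poly.scale_scale using assms(3) by simp
  then show ?thesis
    using poly.subspace_scale [OF W assms(2), of "inverse (of_nat k)"] by simp
qed

lemma poly_subspace_sign_mult: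
  assumes W: "poly.subspace W" and "v \<in> W"
  shows "of_int (sign \<pi>) * v \<in> W"
  using assms poly.subspace_neg [OF W] by (cases \<pi> rule: sign_cases) auto

text \<open>Reordering rows costs only a sign and a repeated row gives zero, so only products of
  minors of row sets have to be examined.\<close>

lemma pairdet_in_subspace:
  assumes W: "poly.subspace W"
    and "\<lbrakk>inj_on \<rho> {..<p}; inj_on \<rho> {p..<p + q}\<rbrakk> \<Longrightarrow>
      minor entry (\<rho> ` {..<p}) * minor entry (\<rho> ` {p..<p + q}) \<in> W"
  shows "pairdet entry p q \<rho> \<in> W"
proof (cases "inj_on \<rho> {..<p} \<and> inj_on \<rho> {p..<p + q}")
  case True
  have im: "(\<lambda>i. \<rho> (p + i)) ` {0..<q} = \<rho> ` {p..<p + q}"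
    unfolding image_image [of \<rho> "(+) p", symmetric] by (simp add: add.commute)
  have "inj_on \<rho> {0..<p}"
    using True by (simp add: atLeast0LessThan)
  then obtain \<pi> :: "nat \<Rightarrow> nat" where \<pi>: "rowdet entry p \<rho> = of_int (sign \<pi>) * minor entry (\<rho> ` {0..<p})"
    by (rule rowdet_sort [where x = entry])
  have "inj_on (\<lambda>i. \<rho> (p + i)) {0..<q}"
  proof (rule inj_onI)
    fix i j assume "i \<in> {0..<q}" "j \<in> {0..<q}" "\<rho> (p + i) = \<rho> (p + j)"
    then show "i = j"
      using inj_onD [OF conjunct2 [OF True], of "p + i" "p + j"] by simp
  qed
  then obtain \<pi>' :: "nat \<Rightarrow> nat" where \<pi>': "rowdet entry q (\<lambda>i. \<rho> (p + i)) =
      of_int (sign \<pi>') * minor entry ((\<lambda>i. \<rho> (p + i)) ` {0..<q})"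
    by (rule rowdet_sort [where x = entry])
  have "of_int (sign \<pi>) * (of_int (sign \<pi>') *
      (minor entry (\<rho> ` {..<p}) * minor entry (\<rho> ` {p..<p + q}))) \<in> W"
    using assms True by (intro poly_subspace_sign_mult) auto
  then show ?thesis
    unfolding pairdet_def \<pi> \<pi>' im by (simp only: mult_ac atLeast0LessThan)
next
  case False
  have "rowdet entry p \<rho> = 0 \<or> rowdet entry q (\<lambda>i. \<rho> (p + i)) = 0"
  proof (rule ccontr)
    assume "\<not> ?thesis"
    then have inj: "inj_on \<rho> {0..<p}" "inj_on (\<lambda>i. \<rho> (p + i)) {0..<q}"
      using rowdet_not_inj [of \<rho> p entry] rowdet_not_inj [of "\<lambda>i. \<rho> (p + i)" q entry] by blast+
    have "inj_on \<rho> {p..<p + q}"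
    proof (rule inj_onI)
      fix i j assume ij: "i \<in> {p..<p + q}" "j \<in> {p..<p + q}" "\<rho> i = \<rho> j"
      then have "i - p = j - p"
        using inj_onD [OF inj(2), of "i - p" "j - p"] by auto
      then show "i = j"
        using ij(1,2) by (simp add: eq_diff_iff)
    qed
    then show False
      using False inj(1) by (simp add: atLeast0LessThan)
  qed
  then show ?thesis
    using poly.subspace_0 [OF W] by (auto simp: pairdet_def)
qed

text \<open>Each use of \<open>alternation_exchange\<close> moves one alternated row into the longer
  determinant and keeps the set of alternated rows. Once \<open>K\<close> is empty, the terms only
  permute rows inside that determinant, so it contains all rows that were alternated at the
  start.\<close>

lemma alternation_in_subspace:
  assumes W: "poly.subspace W" and "q \<le> p" and I: "I \<subseteq> {..<p}" and K: "K \<subseteq> {p..<p + q}"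
    and "\<And>\<pi>. \<lbrakk>\<pi> permutes {..<p + q}; \<rho> ` (I \<union> K) \<subseteq> (\<rho> \<circ> \<pi>) ` {..<p}\<rbrakk> \<Longrightarrow>
      pairdet entry p q (\<rho> \<circ> \<pi>) \<in> W"
  shows "alternation entry p q \<rho> (I \<union> K) \<in> W"
  using I K assms(5)
proof (induction "card K" arbitrary: \<rho> I K)
  case 0
  then have [simp]: "K = {}"
    using finite_subset [OF 0(3)] by simp
  have "pairdet entry p q (\<rho> \<circ> \<pi>) \<in> W" if \<pi>: "\<pi> permutes I" for \<pi>
  proof (rule 0(4))
    show "\<pi> permutes {..<p + q}"
      by (rule permutes_subset [OF \<pi>]) (use 0(2) in auto)
    show "\<rho> ` (I \<union> K) \<subseteq> (\<rho> \<circ> \<pi>) ` {..<p}"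
      using image_mono [OF 0(2), of "\<rho> \<circ> \<pi>"] unfolding image_comp [symmetric] permutes_image [OF \<pi>]
      by simp
  qed
  then show ?case
    unfolding alternation_def using W
    by (auto intro!: poly.subspace_sum poly_subspace_sign_mult)
next
  case (Suc c)
  have fin: "finite K"
    using Suc(4) finite_subset by blast
  obtain k where k: "k \<in> K"
    using Suc(2) by force
  have kp: "k < p + q" "p \<le> k"
    using k Suc(4) by auto
  have "alternation entry p q (\<rho> \<circ> transpose k i) (insert i I \<union> (K - {k})) \<in> W"
    if i: "i \<in> {..<p} - I" for i
  proof (rule Suc(1))
    show "c = card (K - {k})" "insert i I \<subseteq> {..<p}" "K - {k} \<subseteq> {p..<p + q}"
      using k Suc i fin by auto
    fix \<pi> assume \<pi>: "\<pi> permutes {..<p + q}"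
      and sub: "(\<rho> \<circ> transpose k i) ` (insert i I \<union> (K - {k})) \<subseteq> (\<rho> \<circ> transpose k i \<circ> \<pi>) ` {..<p}"
    have "transpose k i ` (insert i I \<union> (K - {k})) = I \<union> K"
      using i k Suc(3,4) kp by (auto simp: transpose_def image_iff)
    then have "(\<rho> \<circ> transpose k i) ` (insert i I \<union> (K - {k})) = \<rho> ` (I \<union> K)"
      by (metis image_comp)
    then have "pairdet entry p q (\<rho> \<circ> (transpose k i \<circ> \<pi>)) \<in> W"
      using sub i kp by (intro Suc(5) permutes_compose [OF \<pi>] permutes_swap_id) (auto simp: comp_assoc)
    then show "pairdet entry p q (\<rho> \<circ> transpose k i \<circ> \<pi>) \<in> W"
      by (simp add: comp_assoc)
  qed
  then have "of_nat (Suc (card I)) * alternation entry p q \<rho> (I \<union> K) \<in> W"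
    unfolding alternation_exchange [OF assms(2) Suc(3,4) k] by (intro poly.subspace_sum [OF W])
  then show ?case
    using poly_subspace_of_nat_mult [OF W] by blast
qed


text \<open>\<open>J\<close> stands for the positions of the shorter determinant. A permutation that
  does not preserve \<open>K\<close> brings rows larger than \<open>s\<close> from \<open>I\<close>
  into \<open>K\<close> and removes equally many rows of size at most \<open>s\<close>; in
  \<open>J\<close> outside \<open>K\<close> nothing changes.\<close>

lemma exchange_second_sum:
  fixes \<rho> :: "nat \<Rightarrow> nat"
  assumes fin: "finite I" "finite K" and disj: "I \<inter> K = {}" and J: "finite J" "K \<subseteq> J" "J \<inter> I = {}"
    and \<pi>: "\<pi> permutes I \<union> K" and ne: "\<pi> ` K \<noteq> K"
    and inj: "inj_on (\<rho> \<circ> \<pi>) J" "inj_on \<rho> J"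
    and I: "\<And>i. i \<in> I \<Longrightarrow> s < \<rho> i" and K: "\<And>i. i \<in> K \<Longrightarrow> \<rho> i \<le> s"
  shows "\<Sum> (\<rho> ` J) < \<Sum> ((\<rho> \<circ> \<pi>) ` J)"
proof -
  have inj\<pi>: "inj_on \<pi> A" for A
    using permutes_inj_on [OF \<pi>] .
  have sub: "\<pi> ` K \<subseteq> I \<union> K"
    using permutes_image [OF \<pi>] by blast
  have card: "card (\<pi> ` K) = card K"
    by (rule card_image [OF inj\<pi>])
  have cardD: "card (\<pi> ` K - K) = card (K - \<pi> ` K)"
    using card card_Int_Diff [of "\<pi> ` K" K] card_Int_Diff [of K "\<pi> ` K"] fin
    by (simp add: Int_commute)
  have neD: "\<pi> ` K - K \<noteq> {}"
    using ne card fin card_subset_eq [of K "\<pi> ` K"] by auto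
  have "sum \<rho> (K - \<pi> ` K) \<le> (\<Sum>i \<in> K - \<pi> ` K. s)"
    using K by (intro sum_mono) auto
  also have "\<dots> = (\<Sum>i \<in> \<pi> ` K - K. s)"
    by (simp add: cardD)
  also have "\<dots> < sum \<rho> (\<pi> ` K - K)"
    using neD fin sub I by (intro sum_strict_mono) auto
  finally have "sum \<rho> (K - \<pi> ` K) < sum \<rho> (\<pi> ` K - K)" .
  moreover have "sum \<rho> K = sum \<rho> (K \<inter> \<pi> ` K) + sum \<rho> (K - \<pi> ` K)"
    using fin by (intro sum.Int_Diff)
  moreover have "sum \<rho> (\<pi> ` K) = sum \<rho> (\<pi> ` K \<inter> K) + sum \<rho> (\<pi> ` K - K)"
    using fin by (intro sum.Int_Diff) simp
  ultimately have lt: "sum \<rho> K < sum (\<rho> \<circ> \<pi>) K"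
    by (simp add: sum.reindex [OF inj\<pi>] Int_commute)
  have same: "(\<rho> \<circ> \<pi>) i = \<rho> i" if "i \<in> J - K" for i
  proof -
    have "i \<notin> I \<union> K"
      using that J by auto
    from permutes_not_in [OF \<pi> this] show ?thesis by simp
  qed
  have "sum \<rho> J < sum (\<rho> \<circ> \<pi>) J"
    using lt sum.cong [OF refl same, of "J - K" "\<lambda>i. i"]
    unfolding sum.subset_diff [OF J(2,1)] by (simp add: comp_def)
  then show ?thesis
    using sum.reindex [OF inj(1), of "\<lambda>x. x"] sum.reindex [OF inj(2), of "\<lambda>x. x"]
    by (simp add: comp_def)
qed

text \<open>Preserving \<open>K\<close> forces \<open>\<pi>\<close> to preserve \<open>I\<close> as
  well, so it splits into one permutation for each determinant. The sign from reordering the rows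
  cancels the sign of \<open>\<pi>\<close>.\<close>

lemma pairdet_block_permute:
  assumes I: "I \<subseteq> {..<p}" and K: "K \<subseteq> {p..<p + q}" and \<pi>: "\<pi> permutes I \<union> K" and im: "\<pi> ` K = K"
  shows "of_int (sign \<pi>) * pairdet x p q (\<rho> \<circ> \<pi>) = pairdet x p q \<rho>"
proof -
  have fin: "finite I" "finite K"
    using I K finite_subset by blast+
  have disj: "I \<inter> K = {}"
    using I K by fastforce
  define \<alpha> where "\<alpha> i = (if i \<in> K then i else \<pi> i)" for i
  define \<beta> where "\<beta> i = (if i \<in> K then \<pi> i else i)" for i
  have inj\<pi>: "inj_on \<pi> A" for A
    using permutes_inj_on [OF \<pi>] .
  have imI: "\<pi> ` I = I"
  proof -
    have "\<pi> ` ((I \<union> K) - K) = (I \<union> K) - K"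
      using image_set_diff [OF inj\<pi>, of "I \<union> K" K] permutes_image [OF \<pi>] im by simp
    moreover have "(I \<union> K) - K = I"
      using disj by blast
    ultimately show ?thesis by simp
  qed
  have \<beta>: "\<beta> permutes K"
    by (rule bij_imp_permutes) (auto simp: \<beta>_def bij_betw_def inj\<pi> im cong: inj_on_cong image_cong)
  have \<alpha>I: "\<alpha> i = \<pi> i" if "i \<in> I" for i
    using that disj by (auto simp: \<alpha>_def)
  have \<alpha>: "\<alpha> permutes I"
  proof (rule bij_imp_permutes)
    show "bij_betw \<alpha> I I"
      using \<alpha>I inj\<pi> [of I] imI by (simp add: bij_betw_def cong: inj_on_cong image_cong)
    show "\<alpha> i = i" if "i \<notin> I" for i
      using that permutes_not_in [OF \<pi>, of i] by (auto simp: \<alpha>_def)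
  qed
  have "\<alpha> (\<beta> i) = \<pi> i" for i
    using im by (auto simp: \<alpha>_def \<beta>_def)
  then have \<pi>_eq: "\<pi> = \<alpha> \<circ> \<beta>"
    by (simp add: fun_eq_iff)
  have "permutation \<alpha>" "permutation \<beta>"
    using \<alpha> \<beta> fin permutation_permutes by metis+
  then have "sign \<pi> = sign \<alpha> * sign \<beta>"
    by (simp add: \<pi>_eq sign_compose)
  moreover have "pairdet x p q (\<rho> \<circ> \<pi>) = of_int (sign \<beta>) * (of_int (sign \<alpha>) * pairdet x p q \<rho>)"
    unfolding \<pi>_eq comp_assoc [symmetric]
    using pairdet_permute [OF \<alpha>] pairdet_permute [OF \<beta>] I K by metis
  ultimately show ?thesis
    by (cases \<alpha> rule: sign_cases; cases \<beta> rule: sign_cases) simp_all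
qed

text \<open>
  Alternating over the rows of \<open>F\<close> above \<open>s\<close> and the rows of \<open>C\<close> between \<open>t\<close> and \<open>s\<close> moves
  all of them into the longer minor, up to terms that enlarge \<open>C\<close>.
\<close>

lemma straighten:
  assumes W: "poly.subspace W" and fin: "finite C" "finite F" and le: "card C \<le> card F" "t \<le> s"
    and W1: "\<And>C' F'. \<lbrakk>C' \<subseteq> C \<union> F; F' \<subseteq> C \<union> F; card C' = card C; card F' = card F;
      \<Sum> C < \<Sum> C' \<or> card (F \<inter> {s<..}) + card (C \<inter> {t<..s}) \<le> card (F' \<inter> {t<..})\<rbrakk> \<Longrightarrow>
      minor entry C' * minor entry F' \<in> W"
  shows "minor entry C * minor entry F \<in> W"
proof -
  define p q where "p = card F" and "q = card C"
  define \<rho> where "\<rho> i = (if i < p then sorted_list_of_set F ! i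
    else sorted_list_of_set C ! (i - p))" for i
  have "bij_betw ((!) (sorted_list_of_set F)) {..<p} F"
    using fin by (intro bij_betw_nth) (auto simp: p_def)
  then have bF: "bij_betw \<rho> {..<p} F"
    by (rule bij_betw_cong [THEN iffD1, rotated]) (simp add: \<rho>_def)
  have "bij_betw ((!) (sorted_list_of_set C)) {..<q} C"
    using fin by (intro bij_betw_nth) (auto simp: q_def)
  moreover have "bij_betw (\<lambda>i. i - p) {p..<p + q} {..<q}"
    by (rule bij_betw_byWitness [where f' = "\<lambda>i. i + p"]) auto
  ultimately have "bij_betw ((!) (sorted_list_of_set C) \<circ> (\<lambda>i. i - p)) {p..<p + q} C"
    using bij_betw_trans by blast
  then have bC: "bij_betw \<rho> {p..<p + q} C"
    by (rule bij_betw_cong [THEN iffD1, rotated]) (simp add: \<rho>_def)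
  have \<rho>_im: "\<rho> ` {..<p} = F" "\<rho> ` {p..<p + q} = C"
    using bF bC by (auto simp: bij_betw_def)
  have \<rho>_all: "\<rho> ` {..<p + q} = C \<union> F"
  proof -
    have "{..<p + q} = {p..<p + q} \<union> {..<p}" by auto
    then show ?thesis
      using \<rho>_im by (metis image_Un)
  qed
  have pair: "pairdet entry p q \<rho> = minor entry C * minor entry F"
  proof -
    have "rowdet entry p \<rho> = minor entry F" "rowdet entry q (\<lambda>i. \<rho> (p + i)) = minor entry C"
      unfolding minor_def p_def [symmetric] q_def [symmetric]
      by (auto intro!: rowdet_cong simp: \<rho>_def)
    then show ?thesis by (simp add: pairdet_def mult.commute)
  qed
  define I where "I = {i \<in> {..<p}. s < \<rho> i}"
  define K where "K = {i \<in> {p..<p + q}. t < \<rho> i \<and> \<rho> i \<le> s}"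
  have IK: "I \<subseteq> {..<p}" "K \<subseteq> {p..<p + q}"
    by (auto simp: I_def K_def)
  have finIK: "finite I" "finite K"
    by (auto simp: I_def K_def)
  have \<rho>I: "\<rho> ` I = F \<inter> {s<..}"
    using \<rho>_im(1) by (auto simp: I_def)
  have \<rho>K: "\<rho> ` K = C \<inter> {t<..s}"
    using \<rho>_im(2) by (auto simp: K_def)
  have pd: "pairdet entry p q (\<rho> \<circ> \<pi>) \<in> W"
    if \<pi>: "\<pi> permutes {..<p + q}"
      and alt: "\<lbrakk>inj_on (\<rho> \<circ> \<pi>) {..<p}; inj_on (\<rho> \<circ> \<pi>) {p..<p + q}\<rbrakk> \<Longrightarrow>
        \<Sum> C < \<Sum> ((\<rho> \<circ> \<pi>) ` {p..<p + q}) \<or> \<rho> ` (I \<union> K) \<subseteq> (\<rho> \<circ> \<pi>) ` {..<p}" for \<pi>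
  proof (rule pairdet_in_subspace [OF W])
    assume inj: "inj_on (\<rho> \<circ> \<pi>) {..<p}" "inj_on (\<rho> \<circ> \<pi>) {p..<p + q}"
    let ?F' = "(\<rho> \<circ> \<pi>) ` {..<p}" and ?C' = "(\<rho> \<circ> \<pi>) ` {p..<p + q}"
    have sub: "(\<rho> \<circ> \<pi>) ` A \<subseteq> C \<union> F" if "A \<subseteq> {..<p + q}" for A
      using image_mono [OF that, of "\<rho> \<circ> \<pi>"] \<rho>_all permutes_image [OF \<pi>]
      by (metis image_comp)
    have card: "card ?F' = card F" "card ?C' = card C"
      using card_image [OF inj(1)] card_image [OF inj(2)] by (simp_all add: p_def q_def)
    have "card (F \<inter> {s<..}) + card (C \<inter> {t<..s}) \<le> card (?F' \<inter> {t<..})"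
      if "\<rho> ` (I \<union> K) \<subseteq> ?F'"
    proof -
      have "card (F \<inter> {s<..}) + card (C \<inter> {t<..s}) = card (F \<inter> {s<..} \<union> C \<inter> {t<..s})"
        using fin by (intro card_Un_disjoint [symmetric]) auto
      also have "\<dots> = card (\<rho> ` (I \<union> K))"
        by (simp add: image_Un \<rho>I \<rho>K)
      also have "\<dots> \<le> card (?F' \<inter> {t<..})"
        using that le(2) by (intro card_mono) (auto simp: I_def K_def)
      finally show ?thesis .
    qed
    moreover have "{..<p} \<subseteq> {..<p + q}" "{p..<p + q} \<subseteq> {..<p + q}"
      by auto
    ultimately have "minor entry ?C' * minor entry ?F' \<in> W"
      using W1 [OF sub sub card(2,1)] alt [OF inj] by blast
    then show "minor entry ?F' * minor entry ?C' \<in> W"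
      by (simp add: mult.commute)
  qed
  have alt: "alternation entry p q \<rho> (I \<union> K) \<in> W"
    using le IK pd by (intro alternation_in_subspace [OF W]) (auto simp: p_def q_def)
  \<comment> \<open>Each permutation preserving \<open>K\<close> reproduces the product to be
    straightened; the terms of the others vanish or enlarge the column replacing \<open>C\<close>.
    Since \<open>?A\<close> contains \<open>id\<close>, the multiplicity of the product is not
    zero.\<close>
  let ?A = "{\<pi>. \<pi> permutes I \<union> K \<and> \<pi> ` K = K}"
  let ?B = "{\<pi>. \<pi> permutes I \<union> K \<and> \<pi> ` K \<noteq> K}"
  let ?f = "\<lambda>\<pi>. of_int (sign \<pi>) * pairdet entry p q (\<rho> \<circ> \<pi>)"
  have finP: "finite {\<pi>. \<pi> permutes I \<union> K}"
    using finIK by (intro finite_permutations) auto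
  have "sum ?f ?B \<in> W"
  proof (rule poly.subspace_sum [OF W])
    fix \<pi> assume "\<pi> \<in> ?B"
    then have \<pi>: "\<pi> permutes I \<union> K" "\<pi> ` K \<noteq> K" by auto
    have "\<Sum> C < \<Sum> ((\<rho> \<circ> \<pi>) ` {p..<p + q})" if "inj_on (\<rho> \<circ> \<pi>) {p..<p + q}"
      unfolding \<rho>_im(2) [symmetric]
      by (rule exchange_second_sum [OF finIK _ _ IK(2) _ \<pi> that])
        (use bC IK in \<open>auto simp: bij_betw_def I_def K_def\<close>)
    moreover have "\<pi> permutes {..<p + q}"
      by (rule permutes_subset [OF \<pi>(1)]) (use IK in auto)
    ultimately show "?f \<pi> \<in> W"
      by (intro poly_subspace_sign_mult [OF W] pd) auto
  qed
  moreover have "alternation entry p q \<rho> (I \<union> K) = sum ?f ?A + sum ?f ?B"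
    unfolding alternation_def using finP
    by (subst sum.union_disjoint [symmetric]) (auto intro!: sum.cong elim: rev_finite_subset)
  ultimately have "sum ?f ?A \<in> W"
    using poly.subspace_diff [OF W alt] by fastforce
  moreover have "sum ?f ?A = (\<Sum>\<pi> \<in> ?A. pairdet entry p q \<rho>)"
    using IK by (intro sum.cong) (auto intro: pairdet_block_permute)
  moreover have "card ?A \<noteq> 0"
  proof -
    have "id \<in> ?A" by (simp add: permutes_id)
    moreover have "finite ?A"
      using finP by (rule rev_finite_subset) auto
    ultimately show ?thesis by (metis card_0_eq empty_iff)
  qed
  ultimately show ?thesis
    using poly_subspace_of_nat_mult [OF W] by (simp add: pair)
qed


section \<open>Bounds on columns\<close>

text \<open>
  A column \<open>C\<close> is recorded by its upper counts \<open>card (C \<inter> {t<..})\<close>; for columns of equal length,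
  entrywise comparison is comparison of the upper counts. The function \<open>upd G C\<close> is the largest
  bound on a column \<open>F\<close> standing left of \<open>C\<close> for which straightening \<open>(F, C)\<close> is not needed.
\<close>

definition fits :: "(nat \<Rightarrow> int) \<Rightarrow> nat set \<Rightarrow> bool" where
  "fits G C \<longleftrightarrow> (\<forall>t. int (card (C \<inter> {t<..})) \<le> G t)"

definition upd :: "(nat \<Rightarrow> int) \<Rightarrow> nat set \<Rightarrow> nat \<Rightarrow> int" where
  "upd G C s = Min ((\<lambda>t. G t - int (card (C \<inter> {t<..s}))) ` {..s})"

text \<open>Columns are listed from right to left, so their lengths increase.\<close>

fun dem :: "(nat \<Rightarrow> nat \<Rightarrow> int) \<Rightarrow> nat set list \<Rightarrow> bool" where
  "dem g [] \<longleftrightarrow> True"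
| "dem g (C # Cs) \<longleftrightarrow> fits (g (card C)) C \<and> dem (\<lambda>q. upd (g q) C) Cs"

definition col_lists :: "nat \<Rightarrow> nat list \<Rightarrow> nat set list set" where
  "col_lists n qs = {Cs. list_all2 (\<lambda>C q. C \<subseteq> {1..n} \<and> card C = q) Cs qs}"

text \<open>Every column is compared with the original bounds, without any \<open>upd\<close>. For
  \<open>g = perm_bound w\<close> these lists are the tabloids that span
  \<open>Z_space\<close>.\<close>

definition bad :: "(nat \<Rightarrow> nat \<Rightarrow> int) \<Rightarrow> nat set list \<Rightarrow> bool" where
  "bad g Cs \<longleftrightarrow> (\<exists>C \<in> set Cs. \<not> fits (g (card C)) C)"

lemma le_upd_iff: "v \<le> upd G C s \<longleftrightarrow> (\<forall>t\<le>s. v + int (card (C \<inter> {t<..s})) \<le> G t)"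
  unfolding upd_def by (subst Min_ge_iff) (auto simp: algebra_simps)

text \<open>The thresholds \<open>t \<le> s\<close> of a violated inequality are the ones to which
  \<open>straighten\<close> is applied.\<close>

lemma fits_upd_iff:
  "fits (upd G C) F \<longleftrightarrow>
    (\<forall>s. \<forall>t\<le>s. int (card (F \<inter> {s<..}) + card (C \<inter> {t<..s})) \<le> G t)"
  by (simp add: fits_def le_upd_iff)

lemma col_lists_Nil [simp]: "col_lists n [] = {[]}"
  by (auto simp: col_lists_def)

lemma col_lists_Cons:
  "C # Cs \<in> col_lists n (q # qs) \<longleftrightarrow> C \<subseteq> {1..n} \<and> card C = q \<and> Cs \<in> col_lists n qs"
  by (auto simp: col_lists_def)

lemma col_listsD:
  assumes "Cs \<in> col_lists n qs" and "i < length Cs"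
  shows "Cs ! i \<subseteq> {1..n}" "card (Cs ! i) = qs ! i" "qs ! i \<in> set qs"
  using assms by (auto simp: col_lists_def list_all2_conv_all_nth)

lemma col_lists_update:
  assumes "Cs \<in> col_lists n qs" and "F \<subseteq> {1..n}" "card F = card (Cs ! i)"
  shows "Cs[i := F] \<in> col_lists n qs"
proof (cases "i < length Cs")
  case True
  have "list_all2 (\<lambda>C q. C \<subseteq> {1..n} \<and> card C = q) (Cs[i := F]) (qs[i := qs ! i])"
    using assms col_listsD(2) [OF assms(1) True]
    by (intro list_all2_update_cong) (auto simp: col_lists_def)
  then show ?thesis
    by (simp add: col_lists_def)
next
  case False
  then show ?thesis
    using assms(1) by (simp add: list_update_beyond)
qed

lemma col_monom_Cons: "col_monom x (C # Cs) = minor x C * col_monom x Cs"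
  by (simp add: col_monom_def)

lemma col_monom_remove:
  assumes "i < length Cs"
  obtains r where "\<And>F. col_monom x (Cs[i := F]) = minor x F * r"
proof -
  have "col_monom x (Cs[i := F]) = minor x F * (col_monom x (take i Cs) * col_monom x (drop (Suc i) Cs))" for F
    using assms by (simp add: col_monom_def upd_conv_take_nth_drop mult_ac)
  then show ?thesis by (rule that)
qed

section \<open>Spanning by standard and bad products\<close>

lemma poly_span_mult:
  assumes "v \<in> poly.span A" and "\<And>a. a \<in> A \<Longrightarrow> r * a \<in> W" and W: "poly.subspace W"
  shows "r * v \<in> W"
  using assms(1)
proof (induction rule: poly.span_induct_alt)
  case base
  then show ?case by (simp add: poly.subspace_0 [OF W])
next
  case (step c a v)
  have "r * (scale_poly c a + v) = scale_poly c (r * a) + r * v"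
    by (simp add: scale_poly_def algebra_simps)
  then show ?case
    using step assms(2) by (auto intro!: poly.subspace_add [OF W] poly.subspace_scale [OF W])
qed

text \<open>The tail is first straightened for the bounds that \<open>C\<close> leaves. If the
  result violates them at a column \<open>F\<close>, then \<open>straighten\<close> trades the
  product for products with a larger sum in place of \<open>C\<close>, handled by the inner
  induction, or with a column \<open>F'\<close> violating the original \<open>g\<close>, which makes
  the list \<open>bad\<close>. Sortedness of \<open>qs\<close> provides the length condition of
  \<open>straighten\<close>.\<close>

theorem col_monom_in_span:
  assumes "sorted qs" and "Cs \<in> col_lists n qs"
  shows "col_monom entry Cs \<in> poly.span (col_monom entry ` {Ds \<in> col_lists n qs. dem g Ds \<or> bad g Ds})"
  using assms
proof (induction qs arbitrary: g Cs)
  case Nil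
  then show ?case by (auto intro: poly.span_base)
next
  case (Cons q qs)
  let ?W = "poly.span (col_monom entry ` {Ds \<in> col_lists n (q # qs). dem g Ds \<or> bad g Ds})"
  have W: "poly.subspace ?W"
    by (rule poly.subspace_span)
  have main: "minor entry C * col_monom entry Ds \<in> ?W"
    if "C \<subseteq> {1..n}" "card C = q" "Ds \<in> col_lists n qs" for C Ds
    using that
  \<comment> \<open>The elements of \<open>C\<close> sum to at most \<open>n * n\<close>, so the
    measure drops whenever the sum grows.\<close>
  proof (induction "n * n - \<Sum> C" arbitrary: C Ds rule: less_induct)
    case (less C Ds)
    let ?g = "\<lambda>p. upd (g p) C"
    have "col_monom entry Ds \<in> poly.span (col_monom entry ` {Es \<in> col_lists n qs. dem ?g Es \<or> bad ?g Es})"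
      using Cons(2) less(4) by (intro Cons(1)) simp_all
    then show ?case
    proof (rule poly_span_mult [OF _ _ W])
      fix a assume "a \<in> col_monom entry ` {Es \<in> col_lists n qs. dem ?g Es \<or> bad ?g Es}"
      then obtain Es where Es: "Es \<in> col_lists n qs" "dem ?g Es \<or> bad ?g Es" "a = col_monom entry Es"
        by auto
      have CE: "C # Es \<in> col_lists n (q # qs)"
        using less Es by (simp add: col_lists_Cons)
      show "minor entry C * a \<in> ?W"
      proof (cases "dem ?g Es \<or> \<not> fits (g q) C")
        case True
        then have "dem g (C # Es) \<or> bad g (C # Es)"
          using less(3) by (auto simp: bad_def)
        then show ?thesis
          using CE by (auto simp: Es(3) intro!: poly.span_base simp flip: col_monom_Cons)
      next
        case False
        then have "bad ?g Es" using Es(2) by blast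
        then obtain i where i: "i < length Es" "\<not> fits (?g (card (Es ! i))) (Es ! i)"
          by (auto simp: bad_def in_set_conv_nth)
        let ?F = "Es ! i"
        note F = col_listsD [OF Es(1) i(1)]
        obtain s t where st: "t \<le> s"
          "g (card ?F) t < int (card (?F \<inter> {s<..}) + card (C \<inter> {t<..s}))"
          using i(2) unfolding fits_upd_iff by (meson not_le)
        obtain r where r: "\<And>F. col_monom entry (Es[i := F]) = minor entry F * r"
          using col_monom_remove [OF i(1)] by blast
        \<comment> \<open>Straightening concerns two factors only; the remaining factor
          \<open>r\<close> is absorbed into the subspace.\<close>
        have "minor entry C * minor entry ?F \<in> {v. r * v \<in> ?W}"
        proof (rule straighten [OF _ _ _ _ st(1)])
          show "poly.subspace {v. r * v \<in> ?W}"
          proof (rule poly.subspaceI)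
            have "r * scale_poly c v = scale_poly c (r * v)" for c v
              by (simp add: scale_poly_def mult_ac)
            then show "scale_poly c v \<in> {v. r * v \<in> ?W}" if "v \<in> {v. r * v \<in> ?W}" for c v
              using that poly.subspace_scale [OF W] by simp
          qed (auto simp: poly.subspace_0 [OF W] distrib_left intro: poly.subspace_add [OF W])
          show "finite C" "finite ?F"
            using less(2) F(1) finite_subset by blast+
          show "card C \<le> card ?F"
            using F(2,3) less(3) Cons(2) by simp
          fix C' F' assume sub: "C' \<subseteq> C \<union> ?F" "F' \<subseteq> C \<union> ?F"
            and card: "card C' = card C" "card F' = card ?F"
            and alt: "\<Sum> C < \<Sum> C' \<or>
              card (?F \<inter> {s<..}) + card (C \<inter> {t<..s}) \<le> card (F' \<inter> {t<..})"
          have sub': "C' \<subseteq> {1..n}" "F' \<subseteq> {1..n}"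
            using sub less(2) F(1) by blast+
          let ?Ds = "Es[i := F']"
          have Ds: "?Ds \<in> col_lists n qs"
            using Es(1) sub'(2) card(2) by (rule col_lists_update)
          have "minor entry C' * col_monom entry ?Ds \<in> ?W"
          proof (cases "\<Sum> C < \<Sum> C'")
            case True
            have "\<Sum> C' \<le> card C' * n"
              using sub' by (intro sum_bounded_above [where K = n, simplified]) auto
            also have "\<dots> \<le> n * n"
              using card_mono [OF _ sub'(1)] by simp
            finally have "n * n - \<Sum> C' < n * n - \<Sum> C"
              using True by simp
            then show ?thesis
              using sub'(1) card(1) less(3) Ds by (intro less(1)) simp_all
          next
            case False
            then have "g (card F') t < int (card (F' \<inter> {t<..}))"
              using alt st(2) card(2) by simp
            then have "\<not> fits (g (card F')) F'"
              by (auto simp: fits_def not_le)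
            moreover have "F' \<in> set ?Ds"
              using i(1) by (rule set_update_memI)
            ultimately have "bad g (C' # ?Ds)"
              by (auto simp: bad_def)
            moreover have "C' # ?Ds \<in> col_lists n (q # qs)"
              using Ds sub' card less(3) by (simp add: col_lists_Cons)
            ultimately show ?thesis
              by (auto intro!: poly.span_base simp flip: col_monom_Cons)
          qed
          then show "minor entry C' * minor entry F' \<in> {v. r * v \<in> ?W}"
            by (simp add: r mult_ac)
        qed
        moreover have "a = minor entry ?F * r"
          using r [of ?F] Es(3) by simp
        ultimately show ?thesis
          by (simp add: mult_ac)
      qed
    qed
  qed
  obtain C Ds where "Cs = C # Ds"
    using Cons(3) by (cases Cs) (auto simp: col_lists_def)
  then show ?case
    using main [of C Ds] Cons(3) by (simp add: col_monom_Cons col_lists_Cons)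
qed

section \<open>Cells\<close>

text \<open>
  The columns \<open>1, \<dots>, q\<close> of a matrix in the Bruhat cell of \<open>w\<close> have their lowest nonzero entries in
  the rows \<open>w ` {1..q}\<close>.
\<close>

definition cell :: "(nat \<Rightarrow> nat) \<Rightarrow> (nat \<Rightarrow> nat \<Rightarrow> complex) set" where
  "cell w = {f. \<exists>b. (\<forall>k. b k k \<noteq> 0) \<and> (\<forall>i k. k < i \<longrightarrow> b i k = 0) \<and> f = (\<lambda>i k. b i (w k))}"

text \<open>For injective \<open>w\<close> these are the upper counts of the image of
  \<open>{1..q}\<close>, which is the key column of length \<open>q\<close>.\<close>

definition perm_bound :: "(nat \<Rightarrow> nat) \<Rightarrow> nat \<Rightarrow> nat \<Rightarrow> int" where
  "perm_bound w q t = int (card {k \<in> {1..q}. t < w k})"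

text \<open>A nonzero Leibniz term pairs the elements of \<open>C\<close> with positions
  \<open>k\<close> in \<open>{1..card C}\<close>, each element being at most \<open>w k\<close>.
  Then \<open>C\<close> cannot have more elements above \<open>t\<close> than \<open>w\<close> has
  values above \<open>t\<close> in these positions.\<close>

lemma minor_cell_eq_0:
  assumes f: "f \<in> cell w" and C: "finite C" and not_fits: "\<not> fits (perm_bound w (card C)) C"
  shows "minor f C = 0"
proof -
  obtain b where b: "\<And>i k. k < i \<Longrightarrow> b i k = 0" and f_eq: "f = (\<lambda>i k. b i (w k))"
    using f by (auto simp: cell_def)
  obtain t where t: "card {k \<in> {1..card C}. t < w k} < card (C \<inter> {t<..})"
    using not_fits by (auto simp: fits_def perm_bound_def not_le)
  let ?L = "sorted_list_of_set C" and ?q = "card C"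
  have L: "bij_betw ((!) ?L) {0..<?q} C"
    using C by (intro bij_betw_nth) (auto simp: atLeast0LessThan)
  have "(\<Prod>i = 0..<?q. f (?L ! i) (Suc (\<pi> i))) = 0" if \<pi>: "\<pi> permutes {0..<?q}" for \<pi>
  proof (rule ccontr)
    assume "\<not> ?thesis"
    then have nz: "f (?L ! i) (Suc (\<pi> i)) \<noteq> 0" if "i < ?q" for i
      using that by auto
    have le: "?L ! i \<le> w (Suc (\<pi> i))" if "i < ?q" for i
      using nz [OF that] b by (metis f_eq not_le)
    let ?I = "{i \<in> {0..<?q}. t < ?L ! i}"
    have "C \<inter> {t<..} = (!) ?L ` ?I"
      by (subst (1) bij_betw_imp_surj_on [OF L, symmetric]) auto
    then have "card (C \<inter> {t<..}) = card ?I"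
      using bij_betw_imp_inj_on [OF L] by (metis (no_types, lifting) card_image inj_on_subset mem_Collect_eq subsetI)
    also have "\<dots> = card ((\<lambda>i. Suc (\<pi> i)) ` ?I)"
      using permutes_inj [OF \<pi>] by (intro card_image [symmetric]) (auto simp: inj_on_def)
    also have "\<dots> \<le> card {k \<in> {1..?q}. t < w k}"
    proof (rule card_mono)
      show "(\<lambda>i. Suc (\<pi> i)) ` ?I \<subseteq> {k \<in> {1..?q}. t < w k}"
      proof (rule image_subsetI)
        fix i assume i: "i \<in> ?I"
        then have "t < w (Suc (\<pi> i))"
          using le [of i] by simp
        moreover have "\<pi> i < ?q"
          using permutes_in_image [OF \<pi>, of i] i by simp
        ultimately show "Suc (\<pi> i) \<in> {k \<in> {1..?q}. t < w k}"
          by simp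
      qed
    qed simp
    finally show False using t by simp
  qed
  then show ?thesis
    unfolding minor_def rowdet_def by (subst det_def' [of _ ?q]) (auto intro!: sum.neutral)
qed

text \<open>Only the identity contributes to the Leibniz expansion: a nonzero term has
  \<open>w (Suc i) \<le> w (Suc (\<pi> i))\<close> for all \<open>i\<close>, and since both sides
  have the same sum, equality holds throughout.\<close>

lemma minor_cell_neq_0:
  assumes f: "f \<in> cell w" and w: "inj w"
  shows "minor f (w ` {1..q}) \<noteq> 0"
proof -
  obtain b where b: "\<And>i k. k < i \<Longrightarrow> b i k = 0" "\<And>k. b k k \<noteq> 0" and f_eq: "f = (\<lambda>i k. b i (w k))"
    using f by (auto simp: cell_def)
  let ?\<rho> = "\<lambda>i. w (Suc i)"
  have inj: "inj_on ?\<rho> {0..<q}"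
    using w by (auto simp: inj_on_def)
  have im: "?\<rho> ` {0..<q} = w ` {1..q}"
    by (simp add: image_image [of w Suc, symmetric] atLeastLessThanSuc_atLeastAtMost)
  have zero: "(\<Prod>i = 0..<q. f (?\<rho> i) (Suc (\<pi> i))) = 0"
    if \<pi>: "\<pi> permutes {0..<q}" and ne: "\<pi> \<noteq> id" for \<pi>
  proof (rule ccontr)
    assume "\<not> ?thesis"
    then have "f (?\<rho> i) (Suc (\<pi> i)) \<noteq> 0" if "i < q" for i
      using that by auto
    then have le: "?\<rho> i \<le> ?\<rho> (\<pi> i)" if "i < q" for i
      using b(1) that by (metis f_eq not_le)
    obtain i where i: "\<pi> i \<noteq> i"
      using ne by (auto simp: fun_eq_iff)
    then have "i < q"
      using permutes_not_in [OF \<pi>, of i] by auto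
    then have "?\<rho> i < ?\<rho> (\<pi> i)"
      using le i w by (metis injD le_neq_implies_less nat.inject)
    then have "sum ?\<rho> {0..<q} < sum (\<lambda>i. ?\<rho> (\<pi> i)) {0..<q}"
      using le \<open>i < q\<close> by (intro sum_strict_mono_ex1) auto
    then show False
      using sum.permute [OF \<pi>, of ?\<rho>] by (simp add: comp_def)
  qed
  have "rowdet f q ?\<rho> = (\<Sum>\<pi> | \<pi> permutes {0..<q}.
      signof \<pi> * (\<Prod>i = 0..<q. f (?\<rho> i) (Suc (\<pi> i))))"
    unfolding rowdet_def
    by (subst det_def' [of _ q]) (auto intro!: sum.cong prod.cong simp: permutes_in_image)
  also have "\<dots> = (\<Sum>\<pi> \<in> {id}. signof \<pi> * (\<Prod>i = 0..<q. f (?\<rho> i) (Suc (\<pi> i))))"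
    using zero by (intro sum.mono_neutral_right) (auto simp: finite_permutations permutes_id)
  also have "\<dots> = (\<Prod>i = 0..<q. b (?\<rho> i) (?\<rho> i))"
    by (simp add: f_eq)
  also have "\<dots> \<noteq> 0"
    using b(2) by simp
  finally show ?thesis
    using rowdet_sort [OF inj, of f] im by (metis mult_zero_right)
qed

text \<open>
  If \<open>w a = j > i = w b\<close> and \<open>a < b\<close>, the column \<open>m\<^sub>i\<close> of a matrix in the smaller cell is the limit of
  \<open>m\<^sub>i + t m\<^sub>j\<close>, and for \<open>t \<noteq> 0\<close> column operations to the right bring the perturbed matrix into the
  larger cell.
\<close>

lemma cell_closure:
  fixes P :: "(nat \<Rightarrow> nat \<Rightarrow> complex) \<Rightarrow> complex"
  assumes w: "inj w" and ab: "1 \<le> a" "a < b" "w b < w a"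
    and P: "P = (\<lambda>f. \<Sum>Cs \<in> S. \<alpha> Cs * col_monom f Cs)"
    and zero: "\<And>f. f \<in> cell w \<Longrightarrow> P f = 0" and f: "f \<in> cell (w \<circ> transpose a b)"
  shows "P f = 0"
proof -
  let ?v = "w \<circ> transpose a b"
  let ?i = "w b" and ?j = "w a"
  obtain m where m: "\<And>i k. k < i \<Longrightarrow> m i k = 0" "\<And>k. m k k \<noteq> 0" and f_eq: "f = (\<lambda>i k. m i (?v k))"
    using f by (auto simp: cell_def)
  define g where "g t = (\<lambda>r k. if k = a then m r ?i + t * m r ?j else f r k)" for t
  \<comment> \<open>Subtracting \<open>inverse t\<close> times column \<open>a\<close> of
    \<open>g t\<close> from its column \<open>b\<close> leaves \<open>- (inverse t * m r ?i)\<close>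
    there. Assigned to the values of \<open>w\<close>, the columns are triangular again because
    \<open>?i < ?j\<close>, with diagonal entries that are nonzero for
    \<open>t \<noteq> 0\<close>.\<close>
  define m' where "m' t = (\<lambda>r k. if k = ?j then m r ?i + t * m r ?j
    else if k = ?i then - (inverse t * m r ?i) else m r k)" for t
  define h where "h t = (\<lambda>r k. m' t r (w k))" for t
  have h: "h t \<in> cell w" if "t \<noteq> 0" for t
  proof -
    have "m' t k k \<noteq> 0" for k
      using that m ab(3) by (auto simp: m'_def)
    moreover have "m' t i k = 0" if "k < i" for i k
      using that m(1) ab(3) by (auto simp: m'_def)
    ultimately show ?thesis
      by (auto simp: cell_def h_def)
  qed
  have other: "f r k = m r (w k)" "w k \<noteq> ?i" "w k \<noteq> ?j" if "k \<noteq> a" "k \<noteq> b" for r k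
    using that w by (auto simp: f_eq inj_eq)
  have minor: "minor (g t) C = minor (h t) C" if t: "t \<noteq> 0" for t C
  proof (cases "b \<le> card C")
    case True
    let ?M = "\<lambda>f. mat (card C) (card C) (\<lambda>(i, j). f (sorted_list_of_set C ! i) (Suc j))"
    have "?M (g t) = addcol (inverse t) (b - 1) (a - 1) (?M (h t))"
    proof (rule eq_matI)
      fix r k assume "r < dim_row (addcol (inverse t) (b - 1) (a - 1) (?M (h t)))"
        "k < dim_col (addcol (inverse t) (b - 1) (a - 1) (?M (h t)))"
      then have rk: "r < card C" "k < card C" by simp_all
      have "a - 1 < card C"
        using ab True by simp
      consider "Suc k = a" | "Suc k = b" | "Suc k \<noteq> a" "Suc k \<noteq> b" by blast
      then show "?M (g t) $$ (r, k) = addcol (inverse t) (b - 1) (a - 1) (?M (h t)) $$ (r, k)"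
      proof cases
        case 1
        then show ?thesis
          using rk ab by (auto simp: g_def h_def m'_def f_eq)
      next
        case 2
        then have "a = Suc (a - 1)" "b - 1 = k" "a \<noteq> Suc k"
          using ab by auto
        then show ?thesis
          using rk ab 2 t \<open>a - 1 < card C\<close>
          by (auto simp: g_def h_def m'_def f_eq algebra_simps)
      next
        case 3
        then have "b - 1 \<noteq> k"
          using ab by auto
        then show ?thesis
          using rk 3 other [of "Suc k"] by (auto simp: g_def h_def m'_def)
      qed
    qed auto
    then show ?thesis
      unfolding minor_def rowdet_def
    proof -
      have "a - 1 < card C" "b - 1 \<noteq> a - 1"
        using ab True by auto
      from det_addcol [OF this, of "?M (h t)" "inverse t"]
      show "det (?M (g t)) = det (?M (h t))"
        unfolding \<open>?M (g t) = _\<close> by simp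
    qed
  next
    case False
    have "g t r k = h t r k" if "k \<noteq> b" for r k
      using that other [of k] by (auto simp: g_def h_def m'_def)
    then show ?thesis
      unfolding minor_def rowdet_def using False
      by (intro arg_cong [where f = det] eq_matI) auto
  qed
  have lim: "((\<lambda>t. g t r k) \<longlongrightarrow> f r k) (at 0)" for r k
  proof -
    have "((\<lambda>t. m r ?i + t * m r ?j) \<longlongrightarrow> m r ?i + 0 * m r ?j) (at 0)"
      by (intro tendsto_intros)
    then show ?thesis
      by (cases "k = a") (simp_all add: g_def f_eq)
  qed
  have "((\<lambda>t. minor (g t) C) \<longlongrightarrow> minor f C) (at 0)" for C
  proof -
    have eq: "minor x C = (\<Sum>\<pi> | \<pi> permutes {0..<card C}. signof \<pi> *
        (\<Prod>i = 0..<card C. x (sorted_list_of_set C ! i) (Suc (\<pi> i))))" for x :: "nat \<Rightarrow> nat \<Rightarrow> complex"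
      unfolding minor_def rowdet_def
      by (subst det_def' [of _ "card C"]) (auto intro!: sum.cong prod.cong simp: permutes_in_image)
    show ?thesis
      unfolding eq by (intro tendsto_intros lim)
  qed
  then have "((\<lambda>t. col_monom (g t) Cs) \<longlongrightarrow> col_monom f Cs) (at 0)" for Cs
    by (induction Cs) (auto simp: col_monom_def intro!: tendsto_mult)
  then have "((\<lambda>t. P (g t)) \<longlongrightarrow> P f) (at 0)"
    unfolding P by (intro tendsto_intros)
  moreover have "\<forall>\<^sub>F t in at 0. P (g t) = 0"
  proof -
    have "P (g t) = P (h t)" if "t \<noteq> 0" for t
    proof -
      have "minor (g t) = minor (h t)"
        using minor [OF that] by (rule ext)
      then show ?thesis
        by (simp add: P col_monom_def)
    qed
    then show ?thesis
      using zero [OF h] by (auto simp: eventually_at_filter)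
  qed
  ultimately have "((\<lambda>t. 0) \<longlongrightarrow> P f) (at (0 :: complex))"
    by (rule Lim_transform_eventually)
  then show ?thesis
    by (simp add: tendsto_const_iff)
qed


section \<open>Linear independence\<close>

lemma upd_le: "t \<le> s \<Longrightarrow> upd G C s + int (card (C \<inter> {t<..s})) \<le> G t"
  using le_upd_iff [of "upd G C s" G C s] by simp

lemma perm_bound_range: "t \<le> s \<Longrightarrow>
    perm_bound w q t = perm_bound w q s + int (card {k \<in> {1..q}. t < w k \<and> w k \<le> s})"
proof -
  assume "t \<le> s"
  then have "{k \<in> {1..q}. t < w k} = {k \<in> {1..q}. s < w k} \<union> {k \<in> {1..q}. t < w k \<and> w k \<le> s}"
    by auto
  moreover have "card \<dots> = card {k \<in> {1..q}. s < w k} + card {k \<in> {1..q}. t < w k \<and> w k \<le> s}"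
    by (rule card_Un_disjoint) auto
  ultimately show ?thesis
    by (simp add: perm_bound_def)
qed

text \<open>The values among the first \<open>q\<close> that lie in \<open>{t<..s}\<close> are
  already counted in the difference of the bounds at \<open>t\<close> and \<open>s\<close>. This is
  where the descent in \<open>perm_descend\<close> stops.\<close>

lemma upd_perm_bound_image:
  assumes w: "inj w" and "q \<le> p"
  shows "upd (perm_bound w p) (w ` {1..q}) = perm_bound w p"
proof
  fix s
  have "int (card (w ` {1..q} \<inter> {t<..s})) \<le> perm_bound w p t - perm_bound w p s" if "t \<le> s" for t
  proof -
    have "w ` {1..q} \<inter> {t<..s} \<subseteq> w ` {k \<in> {1..p}. t < w k \<and> w k \<le> s}"
      using assms(2) by auto
    then have "card (w ` {1..q} \<inter> {t<..s}) \<le> card (w ` {k \<in> {1..p}. t < w k \<and> w k \<le> s})"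
      by (intro card_mono) auto
    also have "\<dots> \<le> card {k \<in> {1..p}. t < w k \<and> w k \<le> s}"
      by (intro card_image_le) auto
    finally show ?thesis
      using perm_bound_range [OF that] by simp
  qed
  then have "perm_bound w p s \<le> upd (perm_bound w p) (w ` {1..q}) s"
    unfolding le_upd_iff by (simp add: algebra_simps)
  moreover have "upd (perm_bound w p) (w ` {1..q}) s \<le> perm_bound w p s"
    using upd_le [of s s] by simp
  ultimately show "upd (perm_bound w p) (w ` {1..q}) s = perm_bound w p s"
    by simp
qed

section \<open>Columns determined by their upper counts\<close>

lemma card_greaterThan_sum:
  fixes C :: "nat set"
  assumes "finite C" and "C \<subseteq> {..N}"
  shows "\<Sum> C = (\<Sum>t<N. card (C \<inter> {t<..}))"
proof -
  have "c = (\<Sum>t<N. if t < c then 1 else 0)" if "c \<in> C" for c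
  proof -
    have "{..<N} \<inter> {t. t < c} = {..<c}"
      using that assms(2) by auto
    then show ?thesis by (simp add: sum.If_cases)
  qed
  then have "\<Sum> C = (\<Sum>c \<in> C. \<Sum>t<N. if t < c then 1 else 0)"
    by (intro sum.cong) auto
  also have "\<dots> = (\<Sum>t<N. \<Sum>c \<in> C. if t < c then 1 else 0)"
    by (rule sum.swap)
  also have "\<dots> = (\<Sum>t<N. card (C \<inter> {t<..}))"
    using assms(1) by (intro sum.cong refl) (simp add: sum.If_cases greaterThan_def)
  finally show ?thesis .
qed

text \<open>The upper counts add up to the sum of the elements, so \<open>sum\<close> forces
  equality in every instance of \<open>le\<close>; differences of consecutive counts then decide
  membership. Membership of 0 involves the full cardinality, which is no upper count, hence
  \<open>card\<close>.\<close>

lemma upper_counts_eqI: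
  fixes C D :: "nat set"
  assumes fin: "finite C" "finite D" and card: "card C = card D"
    and le: "\<And>t. card (C \<inter> {t<..}) \<le> card (D \<inter> {t<..})" and sum: "\<Sum> D \<le> \<Sum> C"
  shows "C = D"
proof -
  define N where "N = Max (insert 0 (C \<union> D))"
  have N: "C \<subseteq> {..N}" "D \<subseteq> {..N}"
    using fin by (auto simp: N_def intro!: Max_ge)
  have "(\<Sum>t<N. card (C \<inter> {t<..})) = (\<Sum>t<N. card (D \<inter> {t<..}))"
    using sum sum_mono [of "{..<N}", OF le]
    unfolding card_greaterThan_sum [OF fin(1) N(1)] card_greaterThan_sum [OF fin(2) N(2)]
    by (intro antisym)
  then have "card (C \<inter> {t<..}) = card (D \<inter> {t<..})" if "t < N" for t
    using sum_mono_inv [of "\<lambda>t. card (C \<inter> {t<..})" "{..<N}" "\<lambda>t. card (D \<inter> {t<..})" t] le that by auto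
  moreover have "C \<inter> {t<..} = D \<inter> {t<..}" if "N \<le> t" for t
    using N that by fastforce
  ultimately have eq: "card (C \<inter> {t<..}) = card (D \<inter> {t<..})" for t
    by (metis not_le)
  have eq': "card (C \<inter> {x..}) = card (D \<inter> {x..})" for x
  proof (cases x)
    case 0
    then show ?thesis using card by simp
  next
    case (Suc t)
    then show ?thesis using eq [of t] by (simp add: atLeast_Suc_greaterThan)
  qed
  have mem: "x \<in> E \<longleftrightarrow> card (E \<inter> {x..}) \<noteq> card (E \<inter> {x<..})" if "finite E" for x and E :: "nat set"
  proof (cases "x \<in> E")
    case True
    then have "E \<inter> {x..} = insert x (E \<inter> {x<..})" by auto
    then show ?thesis using True that by simp
  next
    case False
    then have "E \<inter> {x..} = E \<inter> {x<..}"
      by (auto simp: le_less)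
    then show ?thesis using False by simp
  qed
  show ?thesis
    unfolding set_eq_iff by (simp add: mem [OF fin(1)] mem [OF fin(2)] eq eq')
qed

lemma card_image_greaterThan:
  assumes "inj w"
  shows "int (card (w ` {1..q} \<inter> {t<..})) = perm_bound w q t"
proof -
  have "w ` {1..q} \<inter> {t<..} = w ` {k \<in> {1..q}. t < w k}" by auto
  then show ?thesis
    using assms by (simp add: card_image inj_on_subset perm_bound_def)
qed

text \<open>In \<open>dem_independent\<close> this shows that on the cell of \<open>v\<close> the
  only surviving column of length \<open>q\<close> whose sum is not below that of \<open>C\<close>
  is \<open>C\<close> itself.\<close>

lemma fits_eq_image:
  assumes w: "inj w" and "finite C" "card C = q" and fits: "fits (perm_bound w q) C"
    and le: "\<Sum> (w ` {1..q}) \<le> \<Sum> C"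
  shows "C = w ` {1..q}"
proof (rule upper_counts_eqI)
  show "card C = card (w ` {1..q})"
    using assms by (simp add: card_image inj_on_subset)
  show "card (C \<inter> {t<..}) \<le> card (w ` {1..q} \<inter> {t<..})" for t
    using fits card_image_greaterThan [OF w, of q t] unfolding fits_def by (metis of_nat_le_iff)
qed (use assms in auto)

text \<open>
  Exchanging \<open>j\<close> with the value \<open>i\<close> of \<open>[c, j)\<close> that occurs first in \<open>w\<close>: before \<open>i\<close> occurs there is
  nothing in \<open>[c, j)\<close>, so the bounds imposed by a column containing \<open>c\<close> are not affected.
\<close>

lemma perm_step:
  assumes w: "w permutes {1..n}" and C: "C \<subseteq> {1..n}" "card C = q" and fits: "fits (perm_bound w q) C"
    and ne: "C \<noteq> w ` {1..q}"
  obtains a b where "1 \<le> a" "a \<le> q" "q < b" "b \<le> n" "w b < w a"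
    and "fits (perm_bound (w \<circ> transpose a b) q) C"
    and "\<And>p. upd (perm_bound (w \<circ> transpose a b) p) C = upd (perm_bound w p) C"
proof -
  let ?D = "w ` {1..q}"
  have inj: "inj w"
    using w by (rule permutes_inj)
  have fin: "finite C"
    using C(1) finite_subset by blast
  have "card ?D = q"
    using inj by (simp add: card_image inj_on_subset)
  then have "\<not> C \<subseteq> ?D"
    using ne C card_subset_eq [of ?D C] by auto
  then obtain c where c: "c \<in> C" "c \<notin> ?D" by blast
  have c1: "1 \<le> c"
    using c(1) C(1) by auto
  define A where "A = {k \<in> {1..q}. c < w k}"
  \<comment> \<open>The threshold \<open>c - 1\<close> counts \<open>c\<close> itself, so one of the
    first \<open>q\<close> values of \<open>w\<close> is at least \<open>c\<close>, and none of them
    equals \<open>c\<close>.\<close>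
  have "A \<noteq> {}"
  proof -
    have "C \<inter> {c - 1<..} \<noteq> {}"
      using c(1) c1 by fastforce
    then have "card (C \<inter> {c - 1<..}) \<noteq> 0"
      using fin by simp
    moreover have "int (card (C \<inter> {c - 1<..})) \<le> perm_bound w q (c - 1)"
      using fits by (auto simp: fits_def)
    ultimately have "0 < card {k \<in> {1..q}. c - 1 < w k}"
      unfolding perm_bound_def by linarith
    then have "{k \<in> {1..q}. c - 1 < w k} \<noteq> {}"
      by (metis card.empty less_irrefl)
    then obtain k where "k \<in> {1..q}" "c - 1 < w k" by blast
    moreover have "w k \<noteq> c"
      using c(2) \<open>k \<in> {1..q}\<close> by blast
    ultimately have "k \<in> A"
      by (auto simp: A_def)
    then show ?thesis by blast
  qed
  moreover have "finite A" by (simp add: A_def)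
  ultimately have "arg_min_on w A \<in> A" "\<And>k. k \<in> A \<Longrightarrow> w (arg_min_on w A) \<le> w k"
    by (auto intro: arg_min_if_finite arg_min_least)
  then obtain a where a: "a \<in> A" "\<And>k. k \<in> A \<Longrightarrow> w a \<le> w k" by blast
  have aq: "1 \<le> a" "a \<le> q" "c < w a"
    using a(1) by (auto simp: A_def)
  have early: "w k < c \<or> w a \<le> w k" if "k \<le> q" "1 \<le> k" for k
  proof -
    have "w k \<noteq> c"
      using c(2) that by auto
    then show ?thesis
      using a(2) [of k] that by (cases "c < w k") (auto simp: A_def)
  qed
  have "c \<in> w ` {1..n}"
    using c(1) C(1) permutes_image [OF w] by auto
  then obtain m where m: "m \<in> {1..n}" "w m = c"
    by auto
  define b where "b = (LEAST k. 1 \<le> k \<and> c \<le> w k \<and> w k < w a)"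
  have b: "1 \<le> b" "c \<le> w b" "w b < w a" and b_le: "b \<le> m"
    using LeastI [of "\<lambda>k. 1 \<le> k \<and> c \<le> w k \<and> w k < w a" m]
      Least_le [of "\<lambda>k. 1 \<le> k \<and> c \<le> w k \<and> w k < w a" m] m aq
    unfolding b_def by auto
  have first: "w k < c \<or> w a \<le> w k" if "1 \<le> k" "k < b" for k
    using not_less_Least [of k "\<lambda>k. 1 \<le> k \<and> c \<le> w k \<and> w k < w a"] that unfolding b_def by auto
  have qb: "q < b"
    using early [of b] b by fastforce
  let ?v = "w \<circ> transpose a b"
  have same: "perm_bound ?v p t = perm_bound w p t"
    if "b \<le> p \<or> p < a \<or> t < w b \<or> w a \<le> t" for p t
  proof (cases "b \<le> p")
    case True
    have "{k \<in> {1..p}. t < w k} = transpose a b ` {k \<in> {1..p}. t < ?v k}"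
      using True aq qb by (auto simp: transpose_def image_iff)
    then show ?thesis
      unfolding perm_bound_def by (simp add: card_image)
  next
    case False
    then have "{k \<in> {1..p}. t < w k} = {k \<in> {1..p}. t < ?v k}"
      using that aq qb b(3) by (auto simp: transpose_def)
    then show ?thesis
      unfolding perm_bound_def by simp
  qed
  \<comment> \<open>Only in this window do the bounds change, and they drop by one. There the old
    bound agrees with the one at \<open>c - 1\<close>, as no value in \<open>{c..<w a}\<close>
    occurs before position \<open>b\<close>. The element \<open>c\<close>, counted above
    \<open>c - 1\<close> but not above \<open>t\<close>, makes up for the loss in
    \<open>count\<close> and \<open>count'\<close>.\<close>
  have drop: "perm_bound w p t = perm_bound ?v p t + 1"
    "perm_bound w p t = perm_bound w p (c - 1)"
    if "a \<le> p" "p < b" "w b \<le> t" "t < w a" for p t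
  proof -
    have "{k \<in> {1..p}. t < w k} = insert a {k \<in> {1..p}. t < ?v k}"
      using that aq by (auto simp: transpose_def)
    moreover have "a \<notin> {k \<in> {1..p}. t < ?v k}"
      using that by simp
    ultimately show "perm_bound w p t = perm_bound ?v p t + 1"
      unfolding perm_bound_def by simp
    have "t < w k \<longleftrightarrow> c - 1 < w k" if "k \<in> {1..p}" for k
      using first [of k] that \<open>p < b\<close> \<open>w b \<le> t\<close> \<open>t < w a\<close> b(2) c1 by auto
    then show "perm_bound w p t = perm_bound w p (c - 1)"
      unfolding perm_bound_def by (intro arg_cong [where f = "\<lambda>A. int (card A)"]) blast
  qed
  have count: "card (C \<inter> {t<..s}) + 1 \<le> card (C \<inter> {c - 1<..s})" if "w b \<le> t" "t \<le> s" for t s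
  proof -
    have "card (insert c (C \<inter> {t<..s})) \<le> card (C \<inter> {c - 1<..s})"
      using c(1) c1 b(2) that by (intro card_mono) auto
    moreover have "c \<notin> C \<inter> {t<..s}"
      using that b(2) by auto
    ultimately show ?thesis by simp
  qed
  have count': "card (C \<inter> {t<..}) + 1 \<le> card (C \<inter> {c - 1<..})" if "w b \<le> t" for t
  proof -
    have "card (insert c (C \<inter> {t<..})) \<le> card (C \<inter> {c - 1<..})"
      using c(1) c1 b(2) that fin by (intro card_mono) auto
    moreover have "c \<notin> C \<inter> {t<..}"
      using that b(2) by auto
    ultimately show ?thesis using fin by simp
  qed
  have le: "perm_bound ?v p t \<le> perm_bound w p t" for p t
    using same [of p t] drop(1) [of p t] by linarith
  show ?thesis
  proof (rule that)
    show "fits (perm_bound ?v q) C"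
      unfolding fits_def
    proof
      fix t
      have F: "int (card (C \<inter> {u<..})) \<le> perm_bound w q u" for u
        using fits by (auto simp: fits_def)
      show "int (card (C \<inter> {t<..})) \<le> perm_bound ?v q t"
      proof (cases "b \<le> q \<or> q < a \<or> t < w b \<or> w a \<le> t")
        case True
        then show ?thesis
          using F [of t] same [of q t] by simp
      next
        case False
        then show ?thesis
          using F [of "c - 1"] drop [of q t] count' [of t] by simp
      qed
    qed
    show "upd (perm_bound ?v p) C = upd (perm_bound w p) C" for p
    proof (rule ext, rule antisym)
      fix s
      show "upd (perm_bound ?v p) C s \<le> upd (perm_bound w p) C s"
        unfolding le_upd_iff using upd_le [of _ s "perm_bound ?v p" C] le order_trans by blast
      show "upd (perm_bound w p) C s \<le> upd (perm_bound ?v p) C s"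
        unfolding le_upd_iff
      proof (intro allI impI)
        fix t assume t: "t \<le> s"
        show "upd (perm_bound w p) C s + int (card (C \<inter> {t<..s})) \<le> perm_bound ?v p t"
        proof (cases "b \<le> p \<or> p < a \<or> t < w b \<or> w a \<le> t")
          case True
          then show ?thesis
            using upd_le [OF t, of "perm_bound w p" C] same [of p t] by simp
        next
          case False
          then have "c - 1 \<le> s" "w b \<le> t"
            using t b(2) by auto
          moreover have "perm_bound w p t = perm_bound ?v p t + 1"
            "perm_bound w p t = perm_bound w p (c - 1)"
            using False drop [of p t] by auto
          ultimately show ?thesis
            using upd_le [of "c - 1" s "perm_bound w p" C] count [of t s] t by linarith
        qed
      qed
    qed
  qed (use aq qb b b_le m in auto)
qed


section \<open>Descent to a smaller cell and linear independence\<close>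

definition vanishing :: "(nat \<Rightarrow> nat) \<Rightarrow> nat set list set \<Rightarrow> (nat set list \<Rightarrow> complex) \<Rightarrow> bool" where
  "vanishing w S \<alpha> \<longleftrightarrow> (\<forall>f \<in> cell w. (\<Sum>Cs \<in> S. \<alpha> Cs * col_monom f Cs) = 0)"

text \<open>\<open>perm_step\<close> is iterated until the first \<open>q\<close> values of
  \<open>w\<close> form \<open>C\<close>; their sum decreases because a smaller value replaces a
  larger one. Each step keeps the updated bounds, though not the bounds themselves, and
  \<open>cell_closure\<close> carries relations along.\<close>

lemma perm_descend:
  assumes "w permutes {1..n}" and C: "C \<subseteq> {1..n}" "card C = q" and "fits (perm_bound w q) C"
  shows "\<exists>v. v permutes {1..n} \<and> v ` {1..q} = C \<and>
    (\<forall>p\<ge>q. perm_bound v p = upd (perm_bound w p) C) \<and>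
    (\<forall>S \<alpha>. vanishing w S \<alpha> \<longrightarrow> vanishing v S \<alpha>)"
  using assms(1,4)
proof (induction "\<Sum>k = 1..q. w k" arbitrary: w rule: less_induct)
  case (less w)
  show ?case
  proof (cases "C = w ` {1..q}")
    case True
    then show ?thesis
      using less(2) upd_perm_bound_image [OF permutes_inj [OF less(2)]] by auto
  next
    case False
    obtain a b where ab: "1 \<le> a" "a \<le> q" "q < b" "b \<le> n" "w b < w a"
      and fits: "fits (perm_bound (w \<circ> transpose a b) q) C"
      and upd: "\<And>p. upd (perm_bound (w \<circ> transpose a b) p) C = upd (perm_bound w p) C"
      using perm_step [OF less(2) C less(3) False] by metis
    let ?v = "w \<circ> transpose a b"
    have v: "?v permutes {1..n}"
      using ab less(2) by (intro permutes_compose permutes_swap_id) auto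
    have "sum ?v {1..q} < sum w {1..q}"
      using ab by (intro sum_strict_mono_ex1) (auto simp: transpose_def intro!: bexI [of _ a])
    then obtain u where u: "u permutes {1..n}" "u ` {1..q} = C"
      "\<forall>p\<ge>q. perm_bound u p = upd (perm_bound ?v p) C"
      "\<forall>S \<alpha>. vanishing ?v S \<alpha> \<longrightarrow> vanishing u S \<alpha>"
      using less(1) [OF _ v fits] by blast
    moreover have "vanishing ?v S \<alpha>" if "vanishing w S \<alpha>" for S \<alpha>
      unfolding vanishing_def
    proof
      fix f assume f: "f \<in> cell ?v"
      show "(\<Sum>Cs \<in> S. \<alpha> Cs * col_monom f Cs) = 0"
        by (rule cell_closure [OF permutes_inj [OF less(2)] ab(1) _ ab(5) refl _ f])
          (use that ab in \<open>auto simp: vanishing_def\<close>)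
    qed
    ultimately show ?thesis
      unfolding upd by blast
  qed
qed

lemma dem_cong:
  assumes "Cs \<in> col_lists n qs" and "\<And>q. q \<in> set qs \<Longrightarrow> g q = h q"
  shows "dem g Cs \<longleftrightarrow> dem h Cs"
  using assms
proof (induction Cs arbitrary: qs g h)
  case (Cons C Cs)
  then obtain q qs' where "qs = q # qs'"
    by (cases qs) (auto simp: col_lists_def)
  then show ?case
    using Cons(2,3) Cons(1) [of qs' "\<lambda>p. upd (g p) C" "\<lambda>p. upd (h p) C"]
    by (simp add: col_lists_Cons)
qed simp

lemma finite_col_lists: "finite (col_lists n qs)"
proof (induction qs)
  case (Cons q qs)
  have "col_lists n (q # qs) \<subseteq> (\<lambda>(C, Cs). C # Cs) ` (Pow {1..n} \<times> col_lists n qs)"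
  proof
    fix Cs assume "Cs \<in> col_lists n (q # qs)"
    moreover from this obtain C Ds where "Cs = C # Ds"
      by (cases Cs) (auto simp: col_lists_def)
    ultimately show "Cs \<in> (\<lambda>(C, Cs). C # Cs) ` (Pow {1..n} \<times> col_lists n qs)"
      by (auto simp: col_lists_Cons)
  qed
  then show ?case
    by (rule finite_subset) (use Cons in auto)
qed simp

theorem dem_independent:
  assumes "sorted qs" and "w permutes {1..n}"
    and "vanishing w {Cs \<in> col_lists n qs. dem (perm_bound w) Cs} \<alpha>"
    and "Cs \<in> col_lists n qs" and "dem (perm_bound w) Cs"
  shows "\<alpha> Cs = 0"
  using assms
proof (induction qs arbitrary: w \<alpha> Cs)
  case Nil
  \<comment> \<open>The permutation matrix witnesses that the cell is not empty; the empty product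
    is 1 there.\<close>
  have "(\<lambda>i k. if i = w k then 1 else 0) \<in> cell w"
    by (auto simp: cell_def intro!: exI [of _ "\<lambda>i k. if i = k then 1 else 0"])
  moreover have "{Cs \<in> col_lists n []. dem (perm_bound w) Cs} = {[]}"
    by auto
  ultimately show ?case
    using Nil(3,4) by (auto simp: vanishing_def col_monom_def)
next
  case (Cons q qs)
  let ?S = "{Cs \<in> col_lists n (q # qs). dem (perm_bound w) Cs}"
  have fin: "finite ?S"
    using finite_col_lists by simp
  show ?case
  proof (rule ccontr)
    assume "\<alpha> Cs \<noteq> 0"
    define B where "B = {Cs \<in> ?S. \<alpha> Cs \<noteq> 0}"
    have B: "finite B" "B \<noteq> {}"
      using finite_subset [OF _ fin, of B] Cons(5,6) \<open>\<alpha> Cs \<noteq> 0\<close> by (auto simp: B_def)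
    \<comment> \<open>Minimality is measured by the sum of the first column in the list, as
      \<open>fits_eq_image\<close> requires.\<close>
    obtain Ms where Ms: "Ms \<in> B" "\<And>Ds. Ds \<in> B \<Longrightarrow> \<Sum> (hd Ms) \<le> \<Sum> (hd Ds)"
      using arg_min_if_finite(1) [OF B, of "\<lambda>Ds. \<Sum> (hd Ds)"] arg_min_least [OF B, of _ "\<lambda>Ds. \<Sum> (hd Ds)"]
      by blast
    obtain C Es where Ms_eq: "Ms = C # Es"
      using Ms(1) by (cases Ms) (auto simp: B_def col_lists_def)
    have C: "C \<subseteq> {1..n}" "card C = q" "fits (perm_bound w q) C"
      and Es: "Es \<in> col_lists n qs" "dem (\<lambda>p. upd (perm_bound w p) C) Es"
      using Ms(1) by (auto simp: B_def Ms_eq col_lists_Cons)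
    obtain v where v: "v permutes {1..n}" "v ` {1..q} = C"
      "\<And>p. q \<le> p \<Longrightarrow> perm_bound v p = upd (perm_bound w p) C"
      "vanishing v ?S \<alpha>"
      using perm_descend [OF Cons(3) C] Cons(4) by blast
    have dem_v: "dem (perm_bound v) Ds \<longleftrightarrow> dem (\<lambda>p. upd (perm_bound w p) C) Ds"
      if "Ds \<in> col_lists n qs" for Ds
      using Cons(2) v(3) by (intro dem_cong [OF that]) simp
    let ?S' = "{Ds \<in> col_lists n qs. dem (perm_bound v) Ds}"
    have inj_v: "inj v"
      using v(1) by (rule permutes_inj)
    have "vanishing v ?S' (\<lambda>Ds. \<alpha> (C # Ds))"
      unfolding vanishing_def
    proof
      fix f assume f: "f \<in> cell v"
      have img: "(#) C ` ?S' \<subseteq> ?S"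
        using C by (auto simp: col_lists_Cons dem_v)
      have zero: "\<alpha> Ds * col_monom f Ds = 0" if Ds: "Ds \<in> ?S - (#) C ` ?S'" for Ds
      proof (cases "\<alpha> Ds = 0")
        case False
        then have "Ds \<in> B"
          using Ds by (auto simp: B_def)
        obtain D Fs where Ds_eq: "Ds = D # Fs"
          using Ds by (cases Ds) (auto simp: col_lists_def)
        have D: "D \<subseteq> {1..n}" "card D = q" "Fs \<in> col_lists n qs"
          "dem (\<lambda>p. upd (perm_bound w p) D) Fs"
          using Ds by (auto simp: Ds_eq col_lists_Cons)
        have "D \<noteq> C"
          using Ds D by (auto simp: Ds_eq dem_v)
        moreover have "\<Sum> C \<le> \<Sum> D"
          using Ms(2) [OF \<open>Ds \<in> B\<close>] by (simp add: Ms_eq Ds_eq)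
        moreover have "finite D"
          using D(1) finite_subset by blast
        ultimately have "\<not> fits (perm_bound v q) D"
          using fits_eq_image [OF inj_v, of D q] D(2) v(2) by blast
        then have "minor f D = 0"
          using minor_cell_eq_0 [OF f \<open>finite D\<close>] D(2) by simp
        then show ?thesis
          by (simp add: Ds_eq col_monom_Cons)
      qed simp
      have "0 = (\<Sum>Ds \<in> ?S. \<alpha> Ds * col_monom f Ds)"
        using v(4) f by (simp add: vanishing_def)
      also have "\<dots> = (\<Sum>Ds \<in> (#) C ` ?S'. \<alpha> Ds * col_monom f Ds)"
        by (rule sum.mono_neutral_right [OF fin img]) (use zero in blast)
      also have "\<dots> = (\<Sum>Ds \<in> ?S'. \<alpha> (C # Ds) * (minor f C * col_monom f Ds))"
        by (subst sum.reindex) (auto simp: col_monom_Cons)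
      also have "\<dots> = minor f C * (\<Sum>Ds \<in> ?S'. \<alpha> (C # Ds) * col_monom f Ds)"
        by (simp add: sum_distrib_left mult_ac)
      finally show "(\<Sum>Ds \<in> ?S'. \<alpha> (C # Ds) * col_monom f Ds) = 0"
        using minor_cell_neq_0 [OF f inj_v, of q] v(2) by simp
    qed
    then have "\<alpha> (C # Es) = 0"
      using Cons(1) [OF _ v(1), of "\<lambda>Ds. \<alpha> (C # Ds)" Es] Cons(2) Es dem_v by simp
    then show False
      using Ms(1) by (simp add: B_def Ms_eq)
  qed
qed

section \<open>Passing a scanning sequence through a column\<close>

text \<open>
  In round \<open>k\<close> of the scan the running end of the subsequence has the value \<open>V k\<close> when it reaches a
  column with values \<open>e 0 > e 1 > \<dots> > e (z - 1)\<close> from the bottom up, of which \<open>used V e z k\<close> have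
  been marked before; it leaves the column with the value \<open>pass V e z k\<close>.
\<close>

primrec used :: "(nat \<Rightarrow> nat) \<Rightarrow> (nat \<Rightarrow> nat) \<Rightarrow> nat \<Rightarrow> nat \<Rightarrow> nat" where
  "used V e z 0 = 0"
| "used V e z (Suc k) = (if used V e z k < z \<and> V k \<le> e (used V e z k)
     then Suc (used V e z k) else used V e z k)"

definition pass :: "(nat \<Rightarrow> nat) \<Rightarrow> (nat \<Rightarrow> nat) \<Rightarrow> nat \<Rightarrow> nat \<Rightarrow> nat" where
  "pass V e z k = (if used V e z k < z \<and> V k \<le> e (used V e z k) then e (used V e z k) else V k)"

definition count_above :: "nat \<Rightarrow> (nat \<Rightarrow> nat) \<Rightarrow> nat \<Rightarrow> nat" where
  "count_above L V t = card {k. k < L \<and> t < V k}"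

lemma used_le: "used V e z k \<le> z"
  by (induction k) auto

lemma used_round:
  assumes "i < used V e z h"
  shows "\<exists>j<h. used V e z j = i \<and> i < z \<and> V j \<le> e i \<and> pass V e z j = e i"
  using assms
proof (induction h)
  case (Suc h)
  then show ?case
    by (cases "i < used V e z h") (auto simp: pass_def less_Suc_eq split: if_splits)
qed simp

text \<open>\<open>k\<close> is the last idle round, one that marks nothing in the column; every
  later round before \<open>h\<close> marks one location. Its value supplies the threshold in the
  counting arguments below.\<close>

lemma used_cases:
  obtains "used V e z h = h"
  | k where "k < h" "used V e z (Suc k) = used V e z k" "used V e z h = used V e z k + (h - Suc k)"
proof -
  have "used V e z h = h \<or> (\<exists>k<h. used V e z (Suc k) = used V e z k \<and>
      used V e z h = used V e z k + (h - Suc k))"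
  proof (induction h)
    case (Suc h)
    show ?case
    proof (cases "used V e z (Suc h) = used V e z h")
      case True
      then show ?thesis
        by (intro disjI2 exI [of _ h]) (simp del: used.simps)
    next
      case False
      then have step: "used V e z (Suc h) = Suc (used V e z h)"
        by (auto split: if_splits)
      show ?thesis
        using Suc
      proof
        assume "used V e z h = h"
        then show ?thesis using step by simp
      next
        assume "\<exists>k<h. used V e z (Suc k) = used V e z k \<and> used V e z h = used V e z k + (h - Suc k)"
        then obtain k where "k < h" "used V e z (Suc k) = used V e z k"
          "used V e z h = used V e z k + (h - Suc k)" by blast
        then have "k < Suc h" "used V e z (Suc h) = used V e z k + (Suc h - Suc k)"
          using step by simp_all
        then show ?thesis
          using \<open>used V e z (Suc k) = used V e z k\<close> by blast
      qed
    qed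
  qed simp
  then show ?thesis
    using that by blast
qed

lemma down_closed_eq_lessThan:
  fixes A :: "nat set"
  assumes "finite A" and "\<And>i j. i \<le> j \<Longrightarrow> j \<in> A \<Longrightarrow> i \<in> A"
  shows "A = {..<card A}"
proof -
  define m where "m = (LEAST k. k \<notin> A)"
  have "m \<notin> A"
    using LeastI_ex [OF ex_new_if_finite [OF infinite_UNIV_nat assms(1)]] by (simp add: m_def)
  moreover have "k \<in> A" if "k < m" for k
    using not_less_Least [OF that [unfolded m_def]] by simp
  moreover have "k < m" if "k \<in> A" for k
    using assms(2) [of m k] \<open>m \<notin> A\<close> that by (meson not_le)
  ultimately have "A = {..<m}"
    by auto
  then show ?thesis by simp
qed

lemma less_count_above_iff:
  assumes V: "antimono_on {..<L} V" and "k < L"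
  shows "k < count_above L V t \<longleftrightarrow> t < V k"
proof -
  have "{k. k < L \<and> t < V k} = {..<count_above L V t}"
    unfolding count_above_def
    by (rule down_closed_eq_lessThan)
      (use monotone_onD [OF V] in \<open>auto intro: less_le_trans le_less_trans\<close>)
  then show ?thesis
    using assms(2) by auto
qed

lemma count_above_le: "count_above L V t \<le> L"
proof -
  have "card {k. k < L \<and> t < V k} \<le> card {..<L}"
    by (intro card_mono) auto
  then show ?thesis by (simp add: count_above_def)
qed

lemma pointwise_le_iff_count_above:
  assumes V: "antimono_on {..<L} V" and W: "antimono_on {..<L} W"
  shows "(\<forall>k<L. V k \<le> W k) \<longleftrightarrow> (\<forall>t. count_above L V t \<le> count_above L W t)"
proof
  assume "\<forall>k<L. V k \<le> W k"
  then have "{k. k < L \<and> t < V k} \<subseteq> {k. k < L \<and> t < W k}" for t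
    by (auto intro: less_le_trans)
  then show "\<forall>t. count_above L V t \<le> count_above L W t"
    unfolding count_above_def by (auto intro!: card_mono)
next
  assume le: "\<forall>t. count_above L V t \<le> count_above L W t"
  show "\<forall>k<L. V k \<le> W k"
  proof (intro allI impI)
    fix k assume k: "k < L"
    have "t < V k \<Longrightarrow> t < W k" for t
      using less_count_above_iff [OF V k, of t] less_count_above_iff [OF W k, of t] le
      by (meson less_le_trans)
    then show "V k \<le> W k"
      by (meson not_le less_irrefl)
  qed
qed

lemma strict_antimono_inj:
  fixes e :: "nat \<Rightarrow> nat"
  assumes "strict_antimono_on {..<z} e"
  shows "inj_on e {..<z}"
proof (rule inj_onI)
  fix i j assume "i \<in> {..<z}" "j \<in> {..<z}" "e i = e j"
  then show "i = j"
    using monotone_onD [OF assms, of i j] monotone_onD [OF assms, of j i]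
    by (cases i j rule: linorder_cases) auto
qed

context
  fixes V e :: "nat \<Rightarrow> nat" and z L :: nat
  assumes V: "antimono_on {..<L} V" and e: "strict_antimono_on {..<z} e"
begin

lemma e_less: "i < j \<Longrightarrow> j < z \<Longrightarrow> e j < e i"
  using monotone_onD [OF e, of i j] by simp

lemma e_mono: "i \<le> j \<Longrightarrow> j < z \<Longrightarrow> e j \<le> e i"
  using e_less [of i j] by (cases "i = j") auto

lemma card_e_image:
  assumes "j \<le> z"
  shows "card (e ` {i..<j}) = j - i"
proof -
  have "inj_on e {i..<j}"
    by (rule inj_on_subset [OF strict_antimono_inj [OF e]]) (use assms in auto)
  then show ?thesis by (simp add: card_image)
qed

lemma pass_ge: "V k \<le> pass V e z k"
  by (simp add: pass_def)

lemma pass_antimono: "antimono_on {..<L} (pass V e z)"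
proof (rule monotone_onI)
  fix i j assume "i \<in> {..<L}" "j \<in> {..<L}" "i \<le> j"
  from this(3,2) show "pass V e z j \<le> pass V e z i"
  proof (induction j rule: dec_induct)
    case (step k)
    have "pass V e z (Suc k) \<le> pass V e z k"
      using monotone_onD [OF V, of k "Suc k"] step e_less [of "used V e z k" "Suc (used V e z k)"]
      by (auto simp: pass_def not_le)
    then show ?case
      using step by simp
  qed simp
qed

lemma less_count_iff: "k < L \<Longrightarrow> k < count_above L V t \<longleftrightarrow> t < V k"
  by (rule less_count_above_iff [OF V])

lemma less_count_pass_iff: "k < L \<Longrightarrow> k < count_above L (pass V e z) t \<longleftrightarrow> t < pass V e z k"
  by (rule less_count_above_iff [OF pass_antimono])

text \<open>\<open>sat\<close> is a Hall condition: at least as many rounds arrive with a value at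
  most \<open>s\<close> as the column has entries at most \<open>s\<close>. If an entry stayed
  unmarked, the condition would fail just below the value of the last idle round, or at
  \<open>e 0\<close> if no round is idle.\<close>

lemma used_all:
  assumes sat: "\<And>s. count_above L V s + card (e ` {..<z} \<inter> {..s}) \<le> L"
  shows "used V e z L = z"
proof (rule ccontr)
  assume "used V e z L \<noteq> z"
  then have less: "used V e z L < z"
    using used_le [of V e z L] by simp
  show False
  proof (cases V e z L rule: used_cases)
    case 1
    have "e ` {..<z} \<inter> {..e 0} = e ` {..<z}"
      using e_mono [of 0] by auto
    then have "card (e ` {..<z} \<inter> {..e 0}) = z"
      using card_e_image [of z 0] by (simp add: atLeast0LessThan)
    then show False
      using sat [of "e 0"] 1 less by simp
  next
    case (2 k)
    have uz: "used V e z k < z"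
      using 2 less by simp
    then have lt: "e (used V e z k) < V k"
      using 2(2) by (auto split: if_splits)
    have "k < count_above L V (V k - 1)"
      using less_count_iff [OF \<open>k < L\<close>] lt by simp
    moreover have "z - used V e z k \<le> card (e ` {..<z} \<inter> {..V k - 1})"
    proof -
      have "e ` {used V e z k..<z} \<subseteq> e ` {..<z} \<inter> {..V k - 1}"
        using e_mono [of "used V e z k"] lt by (force simp: le_diff_conv2)
      from card_mono [OF _ this] show ?thesis
        by (simp add: card_e_image)
    qed
    ultimately show False
      using sat [of "V k - 1"] 2 less by simp
  qed
qed

text \<open>Among the rounds that leave with a value above \<open>t\<close>, let \<open>k\<close> be
  the last idle one and \<open>s = V k - 1\<close>. The rounds up to \<open>k\<close> arrive above
  \<open>s\<close>; the later ones leave with distinct entries in \<open>{t<..s}\<close>. Without an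
  idle round all of them leave with entries, and \<open>s = max t (e 0)\<close> serves.\<close>

lemma count_above_pass_le:
  "\<exists>s\<ge>t. count_above L (pass V e z) t \<le> count_above L V s + card (e ` {..<z} \<inter> {t<..s})"
proof -
  let ?h = "count_above L (pass V e z) t"
  have hL: "?h \<le> L" by (rule count_above_le)
  have above: "t < pass V e z k" if "k < ?h" for k
    using less_count_pass_iff [of k t] that hL by simp
  have e_above: "t < e i" if i: "i < used V e z ?h" for i
    using used_round [OF i] above by metis
  show ?thesis
  proof (cases V e z ?h rule: used_cases)
    case 1
    have "e ` {0..<?h} \<subseteq> e ` {..<z} \<inter> {t<..max t (e 0)}"
      using e_above 1 used_le [of V e z ?h] e_mono [of 0] by (force simp: le_max_iff_disj)
    from card_mono [OF _ this] have "?h \<le> card (e ` {..<z} \<inter> {t<..max t (e 0)})"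
      using card_e_image [of ?h 0] 1 used_le [of V e z ?h] by simp
    then show ?thesis
      by (intro exI [of _ "max t (e 0)"]) simp
  next
    case (2 k)
    have Vk: "t < V k"
      using above [OF 2(1)] 2(2) by (auto simp: pass_def split: if_splits)
    have "k < L" using 2 hL by simp
    then have "k < count_above L V (V k - 1)"
      using less_count_iff [OF \<open>k < L\<close>] Vk by simp
    moreover have "?h - Suc k \<le> card (e ` {..<z} \<inter> {t<..V k - 1})"
    proof -
      have lt: "e (used V e z k) < V k" if "used V e z k < z"
        using 2(2) that by (auto split: if_splits)
      have "e ` {used V e z k..<used V e z ?h} \<subseteq> e ` {..<z} \<inter> {t<..V k - 1}"
      proof
        fix x assume "x \<in> e ` {used V e z k..<used V e z ?h}"
        then obtain i where i: "x = e i" "used V e z k \<le> i" "i < used V e z ?h" by auto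
        then have "i < z" using used_le [of V e z ?h] by simp
        moreover from this have "e i < V k"
          using e_mono [of "used V e z k" i] i lt by simp
        ultimately show "x \<in> e ` {..<z} \<inter> {t<..V k - 1}"
          using i e_above [of i] by auto
      qed
      from card_mono [OF _ this] show ?thesis
        unfolding card_e_image [OF used_le] using 2(3) by simp
    qed
    ultimately have "?h \<le> count_above L V (V k - 1) + card (e ` {..<z} \<inter> {t<..V k - 1})"
      using 2(1) by simp
    then show ?thesis
      using Vk by (intro exI [of _ "V k - 1"]) simp
  qed
qed

text \<open>Every entry in \<open>{t<..s}\<close> is the leaving value of some round that arrived at
  most at \<open>s\<close>. These rounds are distinct from those arriving above \<open>s\<close>,
  which also leave above \<open>t\<close>.\<close>

lemma count_above_pass_ge:
  assumes all: "used V e z L = z" and ts: "t \<le> s"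
  shows "count_above L V s + card (e ` {..<z} \<inter> {t<..s}) \<le> count_above L (pass V e z) t"
proof -
  let ?r = "count_above L V s"
  have "\<forall>i<z. \<exists>j<L. used V e z j = i \<and> V j \<le> e i \<and> pass V e z j = e i"
    using used_round [of _ V e z L] all by metis
  then obtain j where j: "\<And>i. i < z \<Longrightarrow> j i < L \<and> used V e z (j i) = i \<and> V (j i) \<le> e i \<and> pass V e z (j i) = e i"
    by metis
  let ?I = "{i. i < z \<and> t < e i \<and> e i \<le> s}"
  have "e ` {..<z} \<inter> {t<..s} = e ` ?I"
    by auto
  then have "card (e ` {..<z} \<inter> {t<..s}) = card ?I"
    by (simp add: card_image inj_on_subset [OF strict_antimono_inj [OF e]] subset_eq)
  moreover have "card ?I = card (j ` ?I)"
    using j by (intro card_image [symmetric] inj_onI) (metis mem_Collect_eq)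
  moreover have "?r + card (j ` ?I) = card ({..<?r} \<union> j ` ?I)"
  proof -
    have "?r \<le> j i" if "i \<in> ?I" for i
    proof (rule ccontr)
      assume "\<not> ?thesis"
      then have "s < V (j i)"
        using less_count_iff [of "j i" s] j [of i] that by simp
      then show False
        using j [of i] that by simp
    qed
    then have "{..<?r} \<inter> j ` ?I = {}"
      by (force simp: not_less [symmetric])
    then show ?thesis
      by (simp add: card_Un_disjoint)
  qed
  moreover have "card ({..<?r} \<union> j ` ?I) \<le> count_above L (pass V e z) t"
    unfolding count_above_def [of L "pass V e z"]
  proof (rule card_mono)
    have "k < L \<and> t < pass V e z k" if "k < ?r" for k
    proof -
      have "k < L"
        using that count_above_le by (rule less_le_trans)
      then have "s < V k"
        using less_count_iff [of k s] that by simp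
      then show ?thesis
        using \<open>k < L\<close> pass_ge [of k] ts by simp
    qed
    moreover have "j i < L \<and> t < pass V e z (j i)" if "i \<in> ?I" for i
      using j [of i] that by simp
    ultimately show "{..<?r} \<union> j ` ?I \<subseteq> {k. k < L \<and> t < pass V e z k}"
      by blast
  qed simp
  ultimately show ?thesis by simp
qed

text \<open>The two estimates together say that the count after the column at \<open>t\<close> is
  the maximum over \<open>s \<ge> t\<close> of the count before it at \<open>s\<close> plus the
  number of entries in \<open>{t<..s}\<close>. Hence bounding the former by \<open>G\<close> amounts
  to bounding the latter by \<open>upd\<close>.\<close>

lemma count_above_pass_fits:
  assumes sat: "\<And>s. count_above L V s + card (e ` {..<z} \<inter> {..s}) \<le> L"
  shows "(\<forall>t. int (count_above L (pass V e z) t) \<le> G t) \<longleftrightarrow>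
    (\<forall>s. int (count_above L V s) \<le> upd G (e ` {..<z}) s)"
proof
  assume le: "\<forall>t. int (count_above L (pass V e z) t) \<le> G t"
  show "\<forall>s. int (count_above L V s) \<le> upd G (e ` {..<z}) s"
    unfolding le_upd_iff
  proof (intro allI impI)
    fix s t :: nat assume "t \<le> s"
    then show "int (count_above L V s) + int (card (e ` {..<z} \<inter> {t<..s})) \<le> G t"
      using count_above_pass_ge [OF used_all [OF sat]] le order_trans
      by (metis (no_types, opaque_lifting) of_nat_add of_nat_mono)
  qed
next
  assume le: "\<forall>s. int (count_above L V s) \<le> upd G (e ` {..<z}) s"
  show "\<forall>t. int (count_above L (pass V e z) t) \<le> G t"
  proof
    fix t
    obtain s where s: "t \<le> s"
      "count_above L (pass V e z) t \<le> count_above L V s + card (e ` {..<z} \<inter> {t<..s})"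
      using count_above_pass_le by blast
    have "int (count_above L V s) + int (card (e ` {..<z} \<inter> {t<..s})) \<le> G t"
      using le s(1) unfolding le_upd_iff by blast
    then show "int (count_above L (pass V e z) t) \<le> G t"
      using s(2) by linarith
  qed
qed

text \<open>The Hall condition survives the passage with respect to the same column; the row
  condition then weakens it to the next column.\<close>

lemma count_above_pass_bound:
  assumes sat: "\<And>s. count_above L V s + card (e ` {..<z} \<inter> {..s}) \<le> L"
  shows "count_above L (pass V e z) t + card (e ` {..<z} \<inter> {..t}) \<le> L"
proof -
  obtain s where s: "t \<le> s"
    "count_above L (pass V e z) t \<le> count_above L V s + card (e ` {..<z} \<inter> {t<..s})"
    using count_above_pass_le by blast
  have "e ` {..<z} \<inter> {..s} = e ` {..<z} \<inter> {t<..s} \<union> e ` {..<z} \<inter> {..t}"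
    using s(1) by auto
  then have "card (e ` {..<z} \<inter> {..s}) = card (e ` {..<z} \<inter> {t<..s}) + card (e ` {..<z} \<inter> {..t})"
    by (simp only:) (rule card_Un_disjoint, auto)
  then show ?thesis
    using sat [of s] s(2) by simp
qed

end

section \<open>Scanning a tableau\<close>

text \<open>The running ends of all rounds after \<open>j\<close> columns starting with column
  \<open>c\<close>. The initial value 0 lets every round take its entry of column \<open>c\<close>
  first.\<close>

primrec scan_val :: "(nat \<Rightarrow> nat \<Rightarrow> nat) \<Rightarrow> (nat \<Rightarrow> nat) \<Rightarrow> nat \<Rightarrow> nat \<Rightarrow> nat \<Rightarrow> nat" where
  "scan_val e z c 0 = (\<lambda>k. 0)"
| "scan_val e z c (Suc j) = pass (scan_val e z c j) (e (c + j)) (z (c + j))"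

lemma scan_val_first:
  assumes "k < z c"
  shows "scan_val e z c (Suc 0) k = e c k"
proof -
  have "used (\<lambda>k. 0) (e c) (z c) k = k" if "k \<le> z c" for k
    using that by (induction k) auto
  then show ?thesis
    using assms by (simp add: pass_def)
qed

context
  fixes e :: "nat \<Rightarrow> nat \<Rightarrow> nat" and z :: "nat \<Rightarrow> nat" and c m :: nat
  assumes decr: "\<And>d. \<lbrakk>c \<le> d; d \<le> m\<rbrakk> \<Longrightarrow> strict_antimono_on {..<z d} (e d)"
    and rows: "\<And>d s. \<lbrakk>c \<le> d; d < m\<rbrakk> \<Longrightarrow>
      card (e (Suc d) ` {..<z (Suc d)} \<inter> {..s}) \<le> card (e d ` {..<z d} \<inter> {..s})"
begin

text \<open>These are the two hypotheses for passing the next column. After column \<open>c\<close>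
  the values are its entries, for which the Hall condition is a count; \<open>rows\<close>, the
  trace of weakly increasing rows, moves the condition from one column to the next.\<close>

lemma scan_val_invariant:
  assumes "c + j \<le> m"
  shows "antimono_on {..<z c} (scan_val e z c (Suc j)) \<and>
    (\<forall>t. count_above (z c) (scan_val e z c (Suc j)) t + card (e (c + j) ` {..<z (c + j)} \<inter> {..t}) \<le> z c)"
  using assms
proof (induction j)
  case 0
  have V: "scan_val e z c (Suc 0) k = e c k" if "k < z c" for k
    using that by (rule scan_val_first)
  have mono: "antimono_on {..<z c} (scan_val e z c (Suc 0))"
  proof (rule monotone_onI)
    fix k l assume "k \<in> {..<z c}" "l \<in> {..<z c}" "k \<le> l"
    then show "scan_val e z c (Suc 0) l \<le> scan_val e z c (Suc 0) k"
      using V [of k] V [of l] monotone_onD [OF decr [of c], of k l] 0 by (cases "k = l") auto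
  qed
  have "count_above (z c) (scan_val e z c (Suc 0)) t + card (e c ` {..<z c} \<inter> {..t}) \<le> z c" for t
  proof -
    have "card (e c ` {..<z c} \<inter> {..t}) \<le> card {k. k < z c \<and> e c k \<le> t}"
    proof -
      have "e c ` {..<z c} \<inter> {..t} = e c ` {k. k < z c \<and> e c k \<le> t}"
        by auto
      then show ?thesis
        using card_image_le [of "{k. k < z c \<and> e c k \<le> t}" "e c"] by simp
    qed
    moreover have "count_above (z c) (scan_val e z c (Suc 0)) t = card {k. k < z c \<and> t < e c k}"
      unfolding count_above_def using V by (intro arg_cong [where f = card]) auto
    moreover have "card {k. k < z c \<and> t < e c k} + card {k. k < z c \<and> e c k \<le> t} = card {..<z c}"
    proof -
      have "{..<z c} = {k. k < z c \<and> t < e c k} \<union> {k. k < z c \<and> e c k \<le> t}"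
        by auto
      then show ?thesis
        using card_Un_disjoint [of "{k. k < z c \<and> t < e c k}" "{k. k < z c \<and> e c k \<le> t}"] by fastforce
    qed
    ultimately show ?thesis by simp
  qed
  then show ?case
    using mono by simp
next
  case (Suc j)
  let ?V = "scan_val e z c (Suc j)" and ?d = "c + Suc j"
  have IH: "antimono_on {..<z c} ?V"
    "\<And>t. count_above (z c) ?V t + card (e (c + j) ` {..<z (c + j)} \<inter> {..t}) \<le> z c"
    using Suc by auto
  have sat: "count_above (z c) ?V s + card (e ?d ` {..<z ?d} \<inter> {..s}) \<le> z c" for s
    using IH(2) [of s] rows [of "c + j" s] Suc(2) by simp
  have dec: "strict_antimono_on {..<z ?d} (e ?d)"
    using decr [of ?d] Suc(2) by simp
  have "scan_val e z c (Suc (Suc j)) = pass ?V (e ?d) (z ?d)"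
    by (simp only: scan_val.simps(2) [of e z c "Suc j"])
  then show ?case
    using pass_antimono [OF IH(1) dec] count_above_pass_bound [OF IH(1) dec sat] by simp
qed

text \<open>The columns are peeled off from the right, each replacing the bound \<open>G\<close> by
  its update, until a bound on column \<open>c\<close> itself remains.\<close>

lemma scan_val_fits:
  assumes "c + j \<le> m"
  shows "(\<forall>t. int (count_above (z c) (scan_val e z c (Suc j)) t) \<le> G t) \<longleftrightarrow>
    fits (foldl upd G (map (\<lambda>d. e d ` {..<z d}) (rev [Suc c..<Suc (c + j)]))) (e c ` {..<z c})"
  using assms
proof (induction j arbitrary: G)
  case 0
  have "count_above (z c) (scan_val e z c (Suc 0)) t = card (e c ` {..<z c} \<inter> {t<..})" for t
  proof -
    have inj: "inj_on (e c) {..<z c}"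
      using decr [of c] 0 by (intro strict_antimono_inj) simp
    have "e c ` {..<z c} \<inter> {t<..} = e c ` {k. k < z c \<and> t < e c k}"
      by auto
    then have "card (e c ` {..<z c} \<inter> {t<..}) = card {k. k < z c \<and> t < e c k}"
      using card_image [OF inj_on_subset [OF inj], of "{k. k < z c \<and> t < e c k}"] by auto
    also have "\<dots> = count_above (z c) (scan_val e z c (Suc 0)) t"
      unfolding count_above_def using scan_val_first [of _ z c e]
      by (intro arg_cong [where f = card]) auto
    finally show ?thesis by simp
  qed
  then show ?case
    by (simp add: fits_def)
next
  case (Suc j)
  let ?V = "scan_val e z c (Suc j)" and ?d = "c + Suc j"
  have inv: "antimono_on {..<z c} ?V"
    "\<And>t. count_above (z c) ?V t + card (e (c + j) ` {..<z (c + j)} \<inter> {..t}) \<le> z c"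
    using scan_val_invariant [of j] Suc(2) by auto
  have sat: "count_above (z c) ?V s + card (e ?d ` {..<z ?d} \<inter> {..s}) \<le> z c" for s
    using inv(2) [of s] rows [of "c + j" s] Suc(2) by simp
  have dec: "strict_antimono_on {..<z ?d} (e ?d)"
    using decr [of ?d] Suc(2) by simp
  have "scan_val e z c (Suc (Suc j)) = pass ?V (e ?d) (z ?d)"
    by (simp only: scan_val.simps(2) [of e z c "Suc j"])
  then have "(\<forall>t. int (count_above (z c) (scan_val e z c (Suc (Suc j))) t) \<le> G t) \<longleftrightarrow>
      (\<forall>s. int (count_above (z c) ?V s) \<le> upd G (e ?d ` {..<z ?d}) s)"
    using count_above_pass_fits [OF inv(1) dec sat] by simp
  moreover have "rev [Suc c..<Suc (c + Suc j)] = ?d # rev [Suc c..<Suc (c + j)]"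
    by simp
  ultimately show ?case
    using Suc(1) [of "upd G (e ?d ` {..<z ?d})"] Suc(2) by simp
qed

end

text \<open>Unrolls the recursion into one condition for each column, in the form that
  \<open>scan_val_fits\<close> produces.\<close>

lemma dem_map_iff:
  "dem g (map C (rev [1..<Suc m])) \<longleftrightarrow>
    (\<forall>c \<in> {1..m}. fits (foldl upd (g (card (C c))) (map C (rev [Suc c..<Suc m]))) (C c))"
proof (induction m arbitrary: g)
  case (Suc m)
  have "rev [1..<Suc (Suc m)] = Suc m # rev [1..<Suc m]"
    by simp
  moreover have "rev [Suc c..<Suc (Suc m)] = Suc m # rev [Suc c..<Suc m]" if "c \<in> {1..m}" for c
    using that by simp
  moreover have "{1..Suc m} = insert (Suc m) {1..m}"
    by auto
  ultimately show ?case
    using Suc.IH [of "\<lambda>q. upd (g q) (C (Suc m))"] by simp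
qed simp

section \<open>Column lengths of a partition\<close>

lemma shape_iff:
  assumes lam: "n_partition n lam"
  shows "(r, c) \<in> shape n lam \<longleftrightarrow> 1 \<le> c \<and> 1 \<le> r \<and> r \<le> col_len n lam c"
proof (cases "1 \<le> c")
  case True
  have mono: "lam k \<le> lam j" if "1 \<le> j" "j \<le> k" for j k
    using that(2,1)
  proof (induction k rule: dec_induct)
    case (step k)
    have "lam (Suc k) \<le> lam k"
      using lam step by (simp add: n_partition_def)
    then show ?case using step by simp
  qed simp
  let ?A = "{k. (Suc k, c) \<in> shape n lam}"
  have fin: "finite ?A"
    by (rule finite_subset [of _ "{..n}"]) (auto simp: shape_def)
  have "?A = {..<card ?A}"
  proof (rule down_closed_eq_lessThan [OF fin])
    fix i j assume "i \<le> j" "j \<in> ?A"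
    then show "i \<in> ?A"
      using mono [of "Suc i" "Suc j"] by (auto simp: shape_def)
  qed
  moreover have "{r. (r, c) \<in> shape n lam} = Suc ` ?A"
  proof (intro equalityI subsetI)
    fix r assume "r \<in> {r. (r, c) \<in> shape n lam}"
    then show "r \<in> Suc ` ?A"
      by (intro image_eqI [of _ _ "r - 1"]) (auto simp: shape_def)
  qed auto
  ultimately have "{r. (r, c) \<in> shape n lam} = Suc ` {..<card ?A}" "col_len n lam c = card ?A"
    by (simp_all add: col_len_def card_image)
  then have "{r. (r, c) \<in> shape n lam} = {1..col_len n lam c}"
    by (simp add: image_Suc_lessThan)
  then have "r \<in> {r. (r, c) \<in> shape n lam} \<longleftrightarrow> r \<in> {1..col_len n lam c}"
    by (simp only:)
  then show ?thesis
    using True by simp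
next
  case False
  then show ?thesis by (simp add: shape_def)
qed

lemma finite_shape_col: "finite {r. (r, c) \<in> shape n lam}"
  by (rule finite_subset [of _ "{..n}"]) (auto simp: shape_def)

lemma col_len_le: "col_len n lam c \<le> n"
proof -
  have "card {r. (r, c) \<in> shape n lam} \<le> card {1..n}"
    by (rule card_mono) (auto simp: shape_def)
  then show ?thesis by (simp add: col_len_def)
qed

lemma col_len_antimono: "1 \<le> c \<Longrightarrow> c \<le> d \<Longrightarrow> col_len n lam d \<le> col_len n lam c"
  unfolding col_len_def by (rule card_mono [OF finite_shape_col]) (auto simp: shape_def)

lemma col_len_pos_iff:
  assumes "n_partition n lam" and "1 \<le> n" and "1 \<le> c"
  shows "0 < col_len n lam c \<longleftrightarrow> c \<le> lam 1"
proof -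
  have "0 < col_len n lam c \<longleftrightarrow> (1, c) \<in> shape n lam"
    using assms by (auto simp: shape_iff)
  then show ?thesis
    using assms by (simp add: shape_def)
qed

section \<open>Shapes and scans\<close>

lemma ewis_eq_ewis_from: "ewis f xs = ewis_from f 0 xs"
  by (cases xs) auto

context
  fixes n :: nat and lam :: "nat \<Rightarrow> nat" and T :: "nat \<times> nat \<Rightarrow> nat" and c :: nat
    and z :: "nat \<Rightarrow> nat" and e :: "nat \<Rightarrow> nat \<Rightarrow> nat" and m :: nat
  assumes lam: "n_partition n lam" and c: "1 \<le> c" "c \<le> lam 1"
    and z: "z = col_len n lam" and e: "\<And>d i. e d i = T (z d - i, d)" and m: "m = lam 1"
  notes [simp del] = upt_Suc
begin

text \<open>Defined by the recursion for \<open>used\<close>, not by the marks;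
  \<open>scan_marks_col\<close> identifies it with the number of locations of column
  \<open>d\<close> marked in the first \<open>k\<close> rounds.\<close>

definition marked :: "nat \<Rightarrow> nat \<Rightarrow> nat" where
  "marked k d = used (scan_val e z c (d - c)) (e d) (z d) k"

definition bottom :: "nat \<Rightarrow> nat \<Rightarrow> nat \<times> nat" where
  "bottom k d = (z d - marked k d, d)"

lemma T_bottom: "T (bottom k d) = e d (marked k d)"
  by (simp add: bottom_def e)

text \<open>When the scan reaches column \<open>d\<close>, its running end is
  \<open>scan_val e z c (d - c) k\<close>, so membership in the subsequence can be decided column by
  column. The second part reads off the last member, or the starting value if nothing is
  taken.\<close>

lemma ewis_from_bottom:
  assumes "c \<le> d" and "d \<le> Suc m"
  shows "ewis_from T (scan_val e z c (d - c) k) (map (bottom k) (filter (\<lambda>d. marked k d < z d) [d..<Suc m])) =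
      map (bottom k) (filter (\<lambda>d. marked k d < z d \<and> scan_val e z c (d - c) k \<le> T (bottom k d)) [d..<Suc m]) \<and>
    (let xs = ewis_from T (scan_val e z c (d - c) k) (map (bottom k) (filter (\<lambda>d. marked k d < z d) [d..<Suc m]))
     in scan_val e z c (Suc m - c) k = (if xs = [] then scan_val e z c (d - c) k else T (last xs)))"
  using assms(2,1)
proof (induction d rule: inc_induct)
  case base
  then show ?case by simp
next
  case (step d)
  have upt: "[d..<Suc m] = d # [Suc d..<Suc m]"
    using step by (simp add: upt_conv_Cons)
  have "Suc d - c = Suc (d - c)" "c + (d - c) = d"
    using step by auto
  then have "scan_val e z c (Suc d - c) = pass (scan_val e z c (d - c)) (e d) (z d)"
    by simp
  then have next_val: "scan_val e z c (Suc d - c) k =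
      (if marked k d < z d \<and> scan_val e z c (d - c) k \<le> T (bottom k d) then T (bottom k d)
       else scan_val e z c (d - c) k)"
    by (simp add: pass_def T_bottom flip: marked_def)
  show ?case
    using step.IH step.prems next_val unfolding upt
    by (cases "marked k d < z d"; cases "scan_val e z c (d - c) k \<le> T (bottom k d)") (simp_all add: Let_def)
qed

lemma bottom_locs_eq:
  assumes "\<And>d. \<lbrakk>c \<le> d; d \<le> m\<rbrakk> \<Longrightarrow> {r. (r, d) \<in> shape n lam - M} = {1..z d - marked k d}"
  shows "bottom_locs n lam c M = map (bottom k) (filter (\<lambda>d. marked k d < z d) [c..<Suc m])"
proof -
  have nonempty: "(\<exists>r. (r, d) \<in> shape n lam - M) \<longleftrightarrow> marked k d < z d" if "d \<in> set [c..<Suc m]" for d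
  proof -
    have eq: "{r. (r, d) \<in> shape n lam - M} = {1..z d - marked k d}"
      by (rule assms) (use that in auto)
    have "(\<exists>r. (r, d) \<in> shape n lam - M) \<longleftrightarrow> {r. (r, d) \<in> shape n lam - M} \<noteq> {}"
      by blast
    then show ?thesis
      unfolding eq by auto
  qed
  have filter_eq: "filter (\<lambda>d. \<exists>r. (r, d) \<in> shape n lam - M) [c..<Suc m] = filter (\<lambda>d. marked k d < z d) [c..<Suc m]"
    by (rule filter_cong [OF refl nonempty])
  have map_eq: "(Max {r. (r, d) \<in> shape n lam - M}, d) = bottom k d"
    if "d \<in> set (filter (\<lambda>d. marked k d < z d) [c..<Suc m])" for d
  proof -
    have eq: "{r. (r, d) \<in> shape n lam - M} = {1..z d - marked k d}"
      by (rule assms) (use that in auto)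
    then show ?thesis
      unfolding eq using that by (auto simp: bottom_def intro!: Max_eqI)
  qed
  show ?thesis
    unfolding bottom_locs_def m [symmetric] filter_eq by (rule map_cong [OF refl map_eq])
qed

lemma ewis_bottom:
  "ewis T (map (bottom k) (filter (\<lambda>d. marked k d < z d) [c..<Suc m])) =
    map (bottom k) (filter (\<lambda>d. marked k d < z d \<and> scan_val e z c (d - c) k \<le> T (bottom k d)) [c..<Suc m])"
  using ewis_from_bottom [of c k] c m by (simp add: ewis_eq_ewis_from)

text \<open>A round marks at most the bottom-most unmarked location of a column, so the unmarked
  locations always form a top segment.\<close>

lemma scan_marks_col:
  assumes "c \<le> d" "d \<le> m"
  shows "{r. (r, d) \<in> shape n lam - scan_marks n lam T c k} = {1..z d - marked k d}"
  using assms
proof (induction k arbitrary: d)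
  case 0
  have "marked 0 d = 0"
    by (simp add: marked_def)
  then show ?case
    using c(1) 0 by (auto simp: shape_iff [OF lam] z [symmetric])
next
  case (Suc k)
  let ?M = "scan_marks n lam T c k"
  let ?hit = "\<lambda>d. marked k d < z d \<and> scan_val e z c (d - c) k \<le> T (bottom k d)"
  have "bottom_locs n lam c ?M = map (bottom k) (filter (\<lambda>d. marked k d < z d) [c..<Suc m])"
    using Suc.IH by (rule bottom_locs_eq)
  then have "scan_marks n lam T c (Suc k) = ?M \<union> bottom k ` {x \<in> {c..m}. ?hit x}"
    by (auto simp add: ewis_bottom)
  then have "{r. (r, d) \<in> shape n lam - scan_marks n lam T c (Suc k)} =
      {r. (r, d) \<in> shape n lam - ?M} - {r. (r, d) \<in> bottom k ` {x \<in> {c..m}. ?hit x}}"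
    by auto
  also have "{r. (r, d) \<in> bottom k ` {x \<in> {c..m}. ?hit x}} = (if ?hit d then {z d - marked k d} else {})"
    using Suc.prems by (auto simp: bottom_def)
  also have "{r. (r, d) \<in> shape n lam - ?M} = {1..z d - marked k d}"
    using Suc by blast
  also have "marked (Suc k) d = (if ?hit d then Suc (marked k d) else marked k d)"
    by (simp add: marked_def T_bottom)
  then have "{1..z d - marked k d} - (if ?hit d then {z d - marked k d} else {}) = {1..z d - marked (Suc k) d}"
    by auto
  finally show ?case .
qed

lemma scanning_eq:
  assumes "(r, c) \<in> shape n lam"
  shows "scanning n lam T (r, c) = scan_val e z c (Suc (m - c)) (z c - r)"
proof -
  let ?k = "z c - r"
  let ?xs = "map (bottom ?k) (filter (\<lambda>d. marked ?k d < z d \<and> scan_val e z c (d - c) ?k \<le> T (bottom ?k d)) [c..<Suc m])"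
  have cm: "c \<le> m"
    using c m by simp
  have r: "1 \<le> r" "r \<le> z c"
    using assms by (auto simp: shape_iff [OF lam] z)
  have "used V e' z' k \<le> k" for V e' z' k
    by (induction k) auto
  \<comment> \<open>Fewer than \<open>z c\<close> rounds have been made, so column \<open>c\<close>
    still offers a location. The subsequence is nonempty, and \<open>last\<close> is applied to a
    genuine member.\<close>
  then have "marked ?k c \<le> ?k"
    by (simp add: marked_def)
  then have "marked ?k c < z c"
    using r by linarith
  then have "?xs \<noteq> []"
    using cm by (auto simp: filter_empty_conv simp del: upt_Suc intro!: bexI [of _ c])
  moreover have "bottom_locs n lam c (scan_marks n lam T c ?k) =
      map (bottom ?k) (filter (\<lambda>d. marked ?k d < z d) [c..<Suc m])"
    by (rule bottom_locs_eq [OF scan_marks_col])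
  then have "scanning n lam T (r, c) = T (last ?xs)"
    using assms by (simp add: scanning_def ewis_bottom flip: z)
  moreover have "scan_val e z c (Suc m - c) ?k = (if ?xs = [] then 0 else T (last ?xs))"
    using ewis_from_bottom [of c ?k] cm ewis_bottom [of ?k] by (simp add: Let_def ewis_eq_ewis_from)
  ultimately show ?thesis
    using cm by (simp add: Suc_diff_le del: scan_val.simps(2))
qed

end

section \<open>Tableaux as lists of columns\<close>

definition colset :: "nat \<Rightarrow> (nat \<Rightarrow> nat) \<Rightarrow> (nat \<times> nat \<Rightarrow> nat) \<Rightarrow> nat \<Rightarrow> nat set" where
  "colset n lam T c = (\<lambda>r. T (r, c)) ` {1..col_len n lam c}"

definition col_lens :: "nat \<Rightarrow> (nat \<Rightarrow> nat) \<Rightarrow> nat list" where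
  "col_lens n lam = map (col_len n lam) (rev [1..<Suc (lam 1)])"

definition columns :: "nat \<Rightarrow> (nat \<Rightarrow> nat) \<Rightarrow> (nat \<times> nat \<Rightarrow> nat) \<Rightarrow> nat set list" where
  "columns n lam T = map (colset n lam T) (rev [1..<Suc (lam 1)])"

lemma sorted_col_lens: "sorted (col_lens n lam)"
  unfolding col_lens_def sorted_map sorted_wrt_rev
  by (auto simp: sorted_wrt_iff_nth_less simp del: upt_Suc intro!: col_len_antimono)

lemma count_above_strict_antimono:
  assumes "strict_antimono_on {..<z} e"
  shows "count_above z e t = card (e ` {..<z} \<inter> {t<..})"
proof -
  have "e ` {..<z} \<inter> {t<..} = e ` {k. k < z \<and> t < e k}"
    by auto
  moreover have "inj_on e {k. k < z \<and> t < e k}"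
    by (rule inj_on_subset [OF strict_antimono_inj [OF assms]]) auto
  ultimately show ?thesis
    by (simp add: count_above_def card_image)
qed

lemma rev_col_image:
  "(\<lambda>i. f (z - i)) ` {..<z} = f ` {1..z::nat}"
proof -
  have "{1..z} = (\<lambda>i. z - i) ` {..<z}"
  proof (intro equalityI subsetI)
    fix x assume "x \<in> {1..z}"
    then show "x \<in> (\<lambda>i. z - i) ` {..<z}"
      by (intro image_eqI [of _ _ "z - x"]) auto
  qed auto
  then show ?thesis by (simp add: image_image)
qed

lemma tabloid_col_strict:
  assumes lam: "n_partition n lam" and T: "T \<in> tabloids n lam" and "1 \<le> c"
  shows "strict_antimono_on {..<col_len n lam c} (\<lambda>i. T (col_len n lam c - i, c))"
proof (rule monotone_onI)
  fix i j assume "i \<in> {..<col_len n lam c}" "j \<in> {..<col_len n lam c}" "i < j"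
  moreover from this have "(col_len n lam c - i, c) \<in> shape n lam" "(col_len n lam c - j, c) \<in> shape n lam"
    using assms(3) by (auto simp: shape_iff [OF lam])
  ultimately show "T (col_len n lam c - j, c) < T (col_len n lam c - i, c)"
    using T by (auto simp: tabloids_def)
qed

lemma strictly_increasing_sorted_list:
  assumes "\<And>i j. i < j \<Longrightarrow> j < q \<Longrightarrow> f i < (f j :: nat)"
  shows "sorted_list_of_set (f ` {..<q}) = map f [0..<q]"
proof -
  have "sorted_wrt (<) (map f [0..<q])"
    using assms by (auto simp: sorted_wrt_iff_nth_less)
  then have "sorted_list_of_set (set (map f [0..<q])) = map f [0..<q]"
    by (simp only: strict_sorted_iff sorted_list_of_set.idem_if_sorted_distinct)
  then show ?thesis
    by (simp add: atLeast0LessThan)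
qed

lemma colset_facts:
  assumes lam: "n_partition n lam" and T: "T \<in> tabloids n lam" and c: "1 \<le> c"
  shows colset_rev: "(\<lambda>i. T (col_len n lam c - i, c)) ` {..<col_len n lam c} = colset n lam T c"
    and colset_subset: "colset n lam T c \<subseteq> {1..n}"
    and card_colset: "card (colset n lam T c) = col_len n lam c"
    and colset_nth: "\<And>r. (r, c) \<in> shape n lam \<Longrightarrow> sorted_list_of_set (colset n lam T c) ! (r - 1) = T (r, c)"
proof -
  show rev: "(\<lambda>i. T (col_len n lam c - i, c)) ` {..<col_len n lam c} = colset n lam T c"
    unfolding colset_def by (rule rev_col_image [of "\<lambda>r. T (r, c)"])
  have sh: "(r, c) \<in> shape n lam \<longleftrightarrow> 1 \<le> r \<and> r \<le> col_len n lam c" for r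
    using c by (simp add: shape_iff [OF lam])
  show "colset n lam T c \<subseteq> {1..n}"
  proof -
    have "T (r, c) \<in> {1..n}" if "(r, c) \<in> shape n lam" for r
      using T that by (auto simp: tabloids_def PiE_iff)
    then show ?thesis
      by (auto simp: colset_def sh)
  qed
  show "card (colset n lam T c) = col_len n lam c"
    unfolding rev [symmetric]
    using card_image [OF strict_antimono_inj [OF tabloid_col_strict [OF lam T c]]] by simp
  have "{1..col_len n lam c} = Suc ` {..<col_len n lam c}"
    by (simp add: image_Suc_lessThan)
  then have im: "colset n lam T c = (\<lambda>i. T (Suc i, c)) ` {..<col_len n lam c}"
    by (simp add: colset_def image_image)
  have "T (Suc i, c) < T (Suc j, c)" if "i < j" "j < col_len n lam c" for i j
    using T sh [of "Suc i"] sh [of "Suc j"] that by (auto simp: tabloids_def)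
  then have "sorted_list_of_set (colset n lam T c) = map (\<lambda>i. T (Suc i, c)) [0..<col_len n lam c]"
    unfolding im by (rule strictly_increasing_sorted_list)
  then show "sorted_list_of_set (colset n lam T c) ! (r - 1) = T (r, c)" if "(r, c) \<in> shape n lam" for r
    using that by (auto simp: sh)
qed

lemma nth_rev_upt: "i < m \<Longrightarrow> rev [1..<Suc m] ! i = m - i"
  by (simp add: rev_nth del: upt_Suc)

lemma columns_bij:
  assumes lam: "n_partition n lam"
  shows "bij_betw (columns n lam) (tabloids n lam) (col_lists n (col_lens n lam))"
proof (rule bij_betw_imageI)
  let ?m = "lam 1"
  have in_range: "1 \<le> c \<and> c \<le> ?m" if "(r, c) \<in> shape n lam" for r c
    using that lam
  proof -
    have "col_len n lam c \<noteq> 0" "1 \<le> c"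
      using that by (auto simp: shape_iff [OF lam])
    moreover have "1 \<le> n"
      using that by (auto simp: shape_def)
    ultimately show ?thesis
      using col_len_pos_iff [OF lam] by simp
  qed
  show "inj_on (columns n lam) (tabloids n lam)"
  proof (rule inj_onI)
    fix T U assume T: "T \<in> tabloids n lam" and U: "U \<in> tabloids n lam" and eq: "columns n lam T = columns n lam U"
    show "T = U"
    proof (rule PiE_ext)
      show "T \<in> shape n lam \<rightarrow>\<^sub>E {1..n}" "U \<in> shape n lam \<rightarrow>\<^sub>E {1..n}"
        using T U by (auto simp: tabloids_def)
      fix x assume x: "x \<in> shape n lam"
      obtain r c where rc: "x = (r, c)" by (cases x)
      have "c \<in> set (rev [1..<Suc ?m])"
        using in_range [of r c] x rc by auto
      then have "colset n lam T c = colset n lam U c"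
        using eq unfolding columns_def by (metis map_eq_conv)
      moreover have "1 \<le> c"
        using in_range x rc by blast
      ultimately show "T x = U x"
        using colset_nth [OF lam T, of c r] colset_nth [OF lam U, of c r] x rc by simp
    qed
  qed
  show "columns n lam ` tabloids n lam = col_lists n (col_lens n lam)"
  proof (intro equalityI subsetI)
    fix Cs assume "Cs \<in> columns n lam ` tabloids n lam"
    then obtain T where T: "T \<in> tabloids n lam" "Cs = columns n lam T" by blast
    have "colset n lam T c \<subseteq> {1..n} \<and> card (colset n lam T c) = col_len n lam c" if "c \<in> set (rev [1..<Suc ?m])" for c
    proof -
      have "1 \<le> c"
        using that by auto
      then show ?thesis
        using colset_subset [OF lam T(1)] card_colset [OF lam T(1)] by simp
    qed
    then show "Cs \<in> col_lists n (col_lens n lam)"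
      unfolding col_lists_def col_lens_def T(2) columns_def mem_Collect_eq list_all2_map1 list_all2_map2 list_all2_same
      by blast
  next
    fix Cs assume Cs: "Cs \<in> col_lists n (col_lens n lam)"
    have len: "length Cs = ?m"
      using Cs by (auto simp: col_lists_def col_lens_def dest!: list_all2_lengthD)
    have col: "Cs ! (?m - c) \<subseteq> {1..n}" "card (Cs ! (?m - c)) = col_len n lam c" if "1 \<le> c" "c \<le> ?m" for c
    proof -
      have i: "?m - c < length Cs"
        using that len by simp
      have "col_lens n lam ! (?m - c) = col_len n lam c"
        using i len that nth_rev_upt [of "?m - c" ?m] by (simp add: col_lens_def del: upt_Suc)
      then show "Cs ! (?m - c) \<subseteq> {1..n}" "card (Cs ! (?m - c)) = col_len n lam c"
        using col_listsD [OF Cs i] by simp_all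
    qed
    define T where "T = restrict (\<lambda>(r, c). sorted_list_of_set (Cs ! (?m - c)) ! (r - 1)) (shape n lam)"
    have Tval: "T (r, c) = sorted_list_of_set (Cs ! (?m - c)) ! (r - 1)" if "(r, c) \<in> shape n lam" for r c
      using that by (simp add: T_def)
    have fin: "finite (Cs ! (?m - c))" if "1 \<le> c" "c \<le> ?m" for c
      using col(1) [OF that] finite_subset by blast
    have "T \<in> tabloids n lam"
      unfolding tabloids_def mem_Collect_eq
    proof (intro conjI allI impI)
      show "T \<in> shape n lam \<rightarrow>\<^sub>E {1..n}"
      proof (rule PiE_I)
        fix x assume x: "x \<in> shape n lam"
        obtain r c where rc: "x = (r, c)" by (cases x)
        have c: "1 \<le> c" "c \<le> ?m" and r: "1 \<le> r" "r \<le> col_len n lam c"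
          using in_range [of r c] x rc shape_iff [OF lam, of r c] by auto
        have "sorted_list_of_set (Cs ! (?m - c)) ! (r - 1) \<in> set (sorted_list_of_set (Cs ! (?m - c)))"
          using r col(2) [OF c] fin [OF c] by (intro nth_mem) simp
        then show "T x \<in> {1..n}"
          using Tval [of r c] x rc col(1) [OF c] fin [OF c] by auto
      qed (simp add: T_def)
      fix r r' c assume A: "(r, c) \<in> shape n lam \<and> (r', c) \<in> shape n lam \<and> r < r'"
      have c: "1 \<le> c" "c \<le> ?m" and r: "1 \<le> r" "r' \<le> col_len n lam c"
        using in_range [of r c] A shape_iff [OF lam, of r c] shape_iff [OF lam, of r' c] by auto
      have "r - 1 < r' - 1" "r' - 1 < col_len n lam c"
        using A r by auto
      then show "T (r, c) < T (r', c)"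
        using sorted_wrt_nth_less [OF strict_sorted_list_of_set, of "r - 1" "r' - 1" "Cs ! (?m - c)"]
          A col(2) [OF c] fin [OF c] by (simp add: Tval)
    qed
    moreover have "columns n lam T = Cs"
    proof (rule nth_equalityI)
      show "length (columns n lam T) = length Cs"
        by (simp add: columns_def len)
      fix i assume "i < length (columns n lam T)"
      then have i: "i < ?m" by (simp add: columns_def del: upt_Suc)
      let ?c = "?m - i"
      have c: "1 \<le> ?c" "?c \<le> ?m" "?m - ?c = i"
        using i by auto
      have "colset n lam T ?c = (\<lambda>k. T (Suc k, ?c)) ` {..<col_len n lam ?c}"
      proof -
        have "{1..col_len n lam ?c} = Suc ` {..<col_len n lam ?c}"
          by (simp add: image_Suc_lessThan)
        then show ?thesis by (simp add: colset_def image_image)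
      qed
      also have "\<dots> = (\<lambda>k. sorted_list_of_set (Cs ! i) ! k) ` {..<col_len n lam ?c}"
        using c by (intro image_cong refl) (simp add: Tval shape_iff [OF lam])
      also have "\<dots> = set (sorted_list_of_set (Cs ! i))"
        using col(2) [OF c(1,2)] fin [OF c(1,2)] c(3)
        by (auto simp: set_conv_nth)
      also have "\<dots> = Cs ! i"
        using fin [OF c(1,2)] c(3) by simp
      finally show "columns n lam T ! i = Cs ! i"
        using i nth_rev_upt [OF i] by (simp add: columns_def del: upt_Suc)
    qed
    ultimately show "Cs \<in> columns n lam ` tabloids n lam"
      by blast
  qed
qed

section \<open>Keys\<close>

text \<open>List the smallest set first and then, for each further set, the elements that it
  adds.\<close>

lemma chain_enumeration:
  assumes "sorted_wrt (\<subseteq>) Ps" and "\<And>P. P \<in> set Ps \<Longrightarrow> finite (P :: nat set)"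
  shows "\<exists>xs. distinct xs \<and> (\<forall>P \<in> set Ps. set (take (card P) xs) = P) \<and> set xs = \<Union> (set Ps)"
  using assms
proof (induction Ps rule: rev_induct)
  case Nil
  show ?case by (intro exI [of _ "[]"]) simp
next
  case (snoc P Ps)
  then obtain xs where xs: "distinct xs" "\<forall>P \<in> set Ps. set (take (card P) xs) = P" "set xs = \<Union> (set Ps)"
    by (auto simp: sorted_wrt_append)
  have sub: "set xs \<subseteq> P"
    using snoc.prems(1) xs(3) by (auto simp: sorted_wrt_append)
  have fin: "finite P"
    using snoc.prems(2) by simp
  let ?ys = "xs @ sorted_list_of_set (P - set xs)"
  have "distinct ?ys" "set ?ys = P"
    using xs(1) sub fin by auto
  moreover from this have "length ?ys = card P"
    using distinct_card by metis
  moreover have "set (take (card R) ?ys) = R" if R: "R \<in> set Ps" for R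
  proof -
    have "card R \<le> length xs"
      using card_length [of "take (card R) xs"] xs(2) R by auto
    then show ?thesis
      using xs(2) R by simp
  qed
  moreover have "\<Union> (set (Ps @ [P])) = P"
    using sub xs(3) by auto
  ultimately have "distinct ?ys \<and> (\<forall>R \<in> set (Ps @ [P]). set (take (card R) ?ys) = R) \<and>
      set ?ys = \<Union> (set (Ps @ [P]))"
    by (simp del: set_append take_append add: set_append [of Ps "[P]"])
  then show ?case
    by blast
qed

lemma Q_chain_perm:
  assumes "Q_chain n Q \<pi>"
  obtains w where "w permutes {1..n}" and "\<And>P. P \<in> set \<pi> \<Longrightarrow> w ` {1..card P} = P"
proof -
  have sub: "P \<subseteq> {1..n}" if "P \<in> set \<pi>" for P
    using assms that by (auto simp: Q_chain_def)
  have "sorted_wrt (\<subset>) \<pi>"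
    using assms by (simp add: Q_chain_def)
  then have "sorted_wrt (\<subseteq>) \<pi>"
    by (rule sorted_wrt_mono_rel [rotated]) auto
  \<comment> \<open>The full set is appended so that the enumeration exhausts \<open>{1..n}\<close>.
    Weak inclusion is used because a member of \<open>\<pi>\<close> is only known to be a subset of
    it.\<close>
  then have "sorted_wrt (\<subseteq>) (\<pi> @ [{1..n}])"
    using sub by (auto simp: sorted_wrt_append)
  moreover have "finite P" if "P \<in> set (\<pi> @ [{1..n}])" for P
    using that sub [of P] finite_subset [of P "{1..n}"] by auto
  ultimately obtain xs where xs: "distinct xs" "\<forall>P \<in> set (\<pi> @ [{1..n}]). set (take (card P) xs) = P"
    "set xs = \<Union> (set (\<pi> @ [{1..n}]))"
    using chain_enumeration by blast
  have set_xs: "set xs = {1..n}"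
    using xs(3) sub by auto
  then have len: "length xs = n"
    using distinct_card [OF xs(1)] by simp
  define w where "w k = (if k \<in> {1..n} then xs ! (k - 1) else k)" for k
  have im: "w ` {1..q} = set (take q xs)" if "q \<le> n" for q
  proof -
    have "w ` {1..q} = (\<lambda>k. xs ! k) ` {..<q}"
      using that unfolding image_Suc_lessThan [symmetric] image_image
      by (intro image_cong) (auto simp: w_def)
    then show ?thesis
      using nth_image [of q xs] that len by (simp add: atLeast0LessThan)
  qed
  have "bij_betw w {1..n} {1..n}"
  proof -
    have "w ` {1..n} = {1..n}"
      using im [of n] len set_xs by simp
    then show ?thesis
      by (simp add: bij_betw_def eq_card_imp_inj_on)
  qed
  then have "w permutes {1..n}"
    by (rule bij_imp_permutes) (auto simp: w_def)
  moreover have "w ` {1..card P} = P" if P: "P \<in> set \<pi>" for P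
    using im [of "card P"] card_mono [OF _ sub [OF P]] xs(2) P by simp
  ultimately show ?thesis
    by (rule that)
qed

text \<open>The cardinality determines a member of the chain through \<open>w\<close>, and columns
  of length \<open>n\<close> follow the same rule because \<open>w\<close> permutes
  \<open>{1..n}\<close>.\<close>

lemma key_tableau_eq:
  assumes lam: "n_partition n lam" and Q: "short_col_lens n lam \<subseteq> Q" "Q_chain n Q \<pi>" "finite Q"
    and w: "w permutes {1..n}" "\<And>P. P \<in> set \<pi> \<Longrightarrow> w ` {1..card P} = P"
    and rc: "(r, c) \<in> shape n lam"
  shows "key_tableau n lam \<pi> (r, c) = sorted_list_of_set (w ` {1..col_len n lam c}) ! (r - 1)"
proof -
  have "(if col_len n lam c = n then {1..n} else THE P. P \<in> set \<pi> \<and> card P = col_len n lam c) =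
      w ` {1..col_len n lam c}"
  proof (cases "col_len n lam c = n")
    case True
    then show ?thesis
      using permutes_image [OF w(1)] by simp
  next
    case False
    have "1 \<le> n"
      using rc by (auto simp: shape_def)
    moreover have "1 \<le> c" "col_len n lam c \<noteq> 0"
      using rc by (auto simp: shape_iff [OF lam])
    ultimately have "c \<in> {1..lam 1}"
      using col_len_pos_iff [OF lam] by simp
    then have "col_len n lam c \<in> short_col_lens n lam"
      using False col_len_le [of n lam c] by (simp add: short_col_lens_def)
    then have "col_len n lam c \<in> set (map card \<pi>)"
      using Q by (auto simp: Q_chain_def)
    then obtain P where "P \<in> set \<pi>" "card P = col_len n lam c"
      by auto
    moreover from this have "(THE P. P \<in> set \<pi> \<and> card P = col_len n lam c) = P"
      by (intro the_equality) (simp, metis w(2))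
    ultimately show ?thesis
      using False w(2) [of P] by simp
  qed
  then show ?thesis
    using rc by (simp add: key_tableau_def Y_col_def)
qed


section \<open>Comparison with the key through upper counts\<close>

lemma strict_antimono_imp_antimono:
  fixes e :: "nat \<Rightarrow> nat"
  assumes "strict_antimono_on A e"
  shows "antimono_on A e"
proof (rule monotone_onI)
  fix i j assume "i \<in> A" "j \<in> A" "i \<le> j"
  then show "e j \<le> e i"
    using monotone_onD [OF assms, of i j] by (cases "i = j") auto
qed

text \<open>\<open>V\<close> lists a column from the bottom up and the sorted list runs from the top
  down, hence the index \<open>q - k - 1\<close>.\<close>

lemma pointwise_le_sorted_list_iff:
  assumes w: "inj w" and V: "antimono_on {..<q} V"
  shows "(\<forall>k<q. V k \<le> sorted_list_of_set (w ` {1..q}) ! (q - k - 1)) \<longleftrightarrow>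
    (\<forall>t. int (count_above q V t) \<le> perm_bound w q t)"
proof -
  let ?L = "sorted_list_of_set (w ` {1..q})"
  let ?W = "\<lambda>k. ?L ! (q - k - 1)"
  have len: "length ?L = q"
    using w by (simp add: card_image inj_on_subset)
  have W: "strict_antimono_on {..<q} ?W"
  proof (rule monotone_onI)
    fix i j assume "i \<in> {..<q}" "j \<in> {..<q}" "i < j"
    then show "?W j < ?W i"
      using len by (intro sorted_wrt_nth_less [OF strict_sorted_list_of_set]) auto
  qed
  then have W': "antimono_on {..<q} ?W"
    by (rule strict_antimono_imp_antimono)
  have "?W ` {..<q} = w ` {1..q}"
  proof -
    have "{..<q} = (\<lambda>k. q - k - 1) ` {..<q}"
    proof (intro equalityI subsetI)
      fix x assume "x \<in> {..<q}"
      then show "x \<in> (\<lambda>k. q - k - 1) ` {..<q}"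
        by (intro image_eqI [of _ _ "q - x - 1"]) auto
    qed auto
    then have rev: "(\<lambda>k. q - k - 1) ` {..<q} = {..<q}"
      by (rule sym)
    have "?W ` {..<q} = (!) ?L ` (\<lambda>k. q - k - 1) ` {..<q}"
      by (simp only: image_image)
    also have "\<dots> = (!) ?L ` {..<q}"
      by (simp only: rev)
    also have "\<dots> = set ?L"
      using nth_image [of q ?L] len by (simp add: atLeast0LessThan)
    finally show ?thesis by simp
  qed
  then have "int (count_above q ?W t) = perm_bound w q t" for t
    using count_above_strict_antimono [OF W, of t] card_image_greaterThan [OF w, of q t] by simp
  then show ?thesis
    using pointwise_le_iff_count_above [OF V W'] by (metis of_nat_le_iff)
qed

context
  fixes n :: nat and lam :: "nat \<Rightarrow> nat" and Q :: "nat set" and \<pi> :: "nat set list" and w :: "nat \<Rightarrow> nat"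
  assumes lam: "n_partition n lam" and n: "1 \<le> n" and Q: "short_col_lens n lam \<subseteq> Q" "Q_chain n Q \<pi>" "finite Q"
    and w: "w permutes {1..n}" "\<And>P. P \<in> set \<pi> \<Longrightarrow> w ` {1..card P} = P"
begin

text \<open>Stated for any filling \<open>U\<close> with decreasing columns \<open>V c\<close>,
  since it is applied both to a tabloid, for \<open>Z_space\<close>, and to a scanning
  tableau.\<close>

lemma filling_le_key_iff:
  assumes "\<And>c. \<lbrakk>1 \<le> c; c \<le> lam 1\<rbrakk> \<Longrightarrow> antimono_on {..<col_len n lam c} (V c)"
    and "\<And>r c. (r, c) \<in> shape n lam \<Longrightarrow> U (r, c) = V c (col_len n lam c - r)"
  shows "filling_le n lam U (key_tableau n lam \<pi>) \<longleftrightarrow>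
    (\<forall>c \<in> {1..lam 1}. \<forall>t. int (count_above (col_len n lam c) (V c) t) \<le> perm_bound w (col_len n lam c) t)"
proof -
  let ?z = "col_len n lam"
  let ?key = "\<lambda>c k. sorted_list_of_set (w ` {1..?z c}) ! (?z c - k - 1)"
  have "filling_le n lam U (key_tableau n lam \<pi>) \<longleftrightarrow> (\<forall>c \<in> {1..lam 1}. \<forall>k<?z c. V c k \<le> ?key c k)"
  proof
    assume le: "filling_le n lam U (key_tableau n lam \<pi>)"
    show "\<forall>c \<in> {1..lam 1}. \<forall>k<?z c. V c k \<le> ?key c k"
    proof (intro ballI allI impI)
      fix c k assume c: "c \<in> {1..lam 1}" and k: "k < ?z c"
      then have sh: "(?z c - k, c) \<in> shape n lam"
        by (auto simp: shape_iff [OF lam])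
      then have "U (?z c - k, c) \<le> key_tableau n lam \<pi> (?z c - k, c)"
        using le by (auto simp: filling_le_def)
      then show "V c k \<le> ?key c k"
        using assms(2) [OF sh] key_tableau_eq [OF lam Q w sh] k by simp
    qed
  next
    assume le: "\<forall>c \<in> {1..lam 1}. \<forall>k<?z c. V c k \<le> ?key c k"
    show "filling_le n lam U (key_tableau n lam \<pi>)"
      unfolding filling_le_def
    proof
      fix x assume x: "x \<in> shape n lam"
      obtain r c where rc: "x = (r, c)" by (cases x)
      have sh: "(r, c) \<in> shape n lam" using x rc by simp
      then have r: "1 \<le> c" "1 \<le> r" "r \<le> ?z c"
        by (auto simp: shape_iff [OF lam])
      then have "c \<in> {1..lam 1}"
        using col_len_pos_iff [OF lam n, of c] by auto
      moreover have "?z c - r < ?z c" "?z c - (?z c - r) - 1 = r - 1"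
        using r by auto
      ultimately have "V c (?z c - r) \<le> sorted_list_of_set (w ` {1..?z c}) ! (r - 1)"
        using le by metis
      then show "U x \<le> key_tableau n lam \<pi> x"
        using assms(2) [OF sh] key_tableau_eq [OF lam Q w sh] rc r by simp
    qed
  qed
  also have "\<dots> \<longleftrightarrow> (\<forall>c \<in> {1..lam 1}. \<forall>t. int (count_above (?z c) (V c) t) \<le> perm_bound w (?z c) t)"
    using pointwise_le_sorted_list_iff [OF permutes_inj [OF w(1)] assms(1)] by (intro ball_cong refl) auto
  finally show ?thesis .
qed

lemma tabloid_le_key_iff:
  assumes T: "T \<in> tabloids n lam"
  shows "filling_le n lam T (key_tableau n lam \<pi>) \<longleftrightarrow> \<not> bad (perm_bound w) (columns n lam T)"
proof -
  let ?V = "\<lambda>c i. T (col_len n lam c - i, c)"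
  have anti: "antimono_on {..<col_len n lam c} (?V c)" if "1 \<le> c" for c
    using tabloid_col_strict [OF lam T that] by (rule strict_antimono_imp_antimono)
  have "filling_le n lam T (key_tableau n lam \<pi>) \<longleftrightarrow>
      (\<forall>c \<in> {1..lam 1}. \<forall>t. int (count_above (col_len n lam c) (?V c) t) \<le> perm_bound w (col_len n lam c) t)"
    by (rule filling_le_key_iff) (auto simp: anti shape_iff [OF lam])
  also have "\<dots> \<longleftrightarrow> (\<forall>c \<in> {1..lam 1}. fits (perm_bound w (col_len n lam c)) (colset n lam T c))"
    using count_above_strict_antimono [OF tabloid_col_strict [OF lam T]] colset_rev [OF lam T]
    by (intro ball_cong refl) (simp add: fits_def)
  also have "\<dots> \<longleftrightarrow> \<not> bad (perm_bound w) (columns n lam T)"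
    using card_colset [OF lam T] by (auto simp: bad_def columns_def simp del: upt_Suc)
  finally show ?thesis .
qed

text \<open>A row whose entry in column \<open>Suc c\<close> is at most \<open>s\<close> has such an
  entry in column \<open>c\<close> too. This supplies the hypothesis \<open>rows\<close> of the
  scan.\<close>

lemma tableau_rows_count:
  assumes T: "T \<in> tableaux n lam" and c: "1 \<le> c"
  shows "card (colset n lam T (Suc c) \<inter> {..s}) \<le> card (colset n lam T c \<inter> {..s})"
proof -
  have T': "T \<in> tabloids n lam"
    using T by (simp add: tableaux_def)
  let ?R = "\<lambda>c. {r. (r, c) \<in> shape n lam \<and> T (r, c) \<le> s}"
  have card: "card (colset n lam T d \<inter> {..s}) = card (?R d)" if "1 \<le> d" for d
  proof -
    have "colset n lam T d \<inter> {..s} = (\<lambda>r. T (r, d)) ` ?R d"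
      using that by (auto simp: colset_def shape_iff [OF lam])
    moreover have "inj_on (\<lambda>r. T (r, d)) (?R d)"
    proof (rule inj_onI)
      fix r r' assume "r \<in> ?R d" "r' \<in> ?R d" "T (r, d) = T (r', d)"
      then show "r = r'"
        using T' by (cases r r' rule: linorder_cases) (force simp: tabloids_def)+
    qed
    ultimately show ?thesis
      by (simp add: card_image)
  qed
  have "?R (Suc c) \<subseteq> ?R c"
  proof
    fix r assume r: "r \<in> ?R (Suc c)"
    then have sh: "(r, c) \<in> shape n lam"
      using c by (auto simp: shape_def)
    then have "T (r, c) \<le> T (r, Suc c)"
      using T r by (auto simp: tableaux_def)
    then show "r \<in> ?R c"
      using r sh by simp
  qed
  moreover have "finite (?R c)"
    by (rule finite_subset [OF _ finite_shape_col [of c n lam]]) auto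
  ultimately have "card (?R (Suc c)) \<le> card (?R c)"
    by (rule card_mono [rotated])
  then show ?thesis
    using card c by simp
qed

text \<open>The tableau condition on \<open>T\<close> keeps the Hall condition alive during the
  scan; \<open>dem_imp_tableau\<close> deals with tabloids in general.\<close>

lemma demazure_iff_dem:
  assumes T: "T \<in> tableaux n lam"
  shows "T \<in> demazure_tableaux n lam \<pi> \<longleftrightarrow> dem (perm_bound w) (columns n lam T)"
proof -
  let ?z = "col_len n lam" and ?m = "lam 1"
  define e where "e d i = T (?z d - i, d)" for d i
  have T': "T \<in> tabloids n lam"
    using T by (simp add: tableaux_def)
  have decr: "strict_antimono_on {..<?z d} (e d)" if "1 \<le> d" for d
    unfolding e_def by (rule tabloid_col_strict [OF lam T' that])
  have im: "e d ` {..<?z d} = colset n lam T d" if "1 \<le> d" for d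
    unfolding e_def by (rule colset_rev [OF lam T' that])
  have rows: "card (e (Suc d) ` {..<?z (Suc d)} \<inter> {..s}) \<le> card (e d ` {..<?z d} \<inter> {..s})" if "1 \<le> d" for d s
    using tableau_rows_count [OF T that] im [of d] im [of "Suc d"] that by simp
  let ?V = "\<lambda>c. scan_val e ?z c (Suc (?m - c))"
  have "filling_le n lam (scanning n lam T) (key_tableau n lam \<pi>) \<longleftrightarrow>
      (\<forall>c \<in> {1..?m}. \<forall>t. int (count_above (?z c) (?V c) t) \<le> perm_bound w (?z c) t)"
  proof (rule filling_le_key_iff)
    fix c assume c: "1 \<le> c" "c \<le> ?m"
    show "antimono_on {..<?z c} (?V c)"
      by (rule scan_val_invariant [of c ?m ?z e "?m - c", THEN conjunct1]) (use c decr rows in auto)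
  next
    fix r c assume rc: "(r, c) \<in> shape n lam"
    have c: "1 \<le> c" "c \<le> ?m"
      using rc col_len_pos_iff [OF lam n, of c] by (auto simp: shape_iff [OF lam])
    show "scanning n lam T (r, c) = ?V c (?z c - r)"
      by (rule scanning_eq [OF lam c refl _ refl rc]) (simp add: e_def)
  qed
  also have "\<dots> \<longleftrightarrow> (\<forall>c \<in> {1..?m}.
      fits (foldl upd (perm_bound w (?z c)) (map (colset n lam T) (rev [Suc c..<Suc ?m]))) (colset n lam T c))"
  proof (rule ball_cong [OF refl])
    fix c assume c: "c \<in> {1..?m}"
    have "map (\<lambda>d. e d ` {..<?z d}) (rev [Suc c..<Suc ?m]) = map (colset n lam T) (rev [Suc c..<Suc ?m])"
      using c im by (intro map_cong refl) (auto simp del: upt_Suc)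
    moreover have "(\<forall>t. int (count_above (?z c) (?V c) t) \<le> perm_bound w (?z c) t) \<longleftrightarrow>
        fits (foldl upd (perm_bound w (?z c)) (map (\<lambda>d. e d ` {..<?z d}) (rev [Suc c..<Suc (c + (?m - c))])))
          (e c ` {..<?z c})"
      by (rule scan_val_fits [where m = ?m]) (use c decr rows in auto)
    moreover have "c + (?m - c) = ?m"
      using c by simp
    ultimately show "(\<forall>t. int (count_above (?z c) (?V c) t) \<le> perm_bound w (?z c) t) \<longleftrightarrow>
        fits (foldl upd (perm_bound w (?z c)) (map (colset n lam T) (rev [Suc c..<Suc ?m]))) (colset n lam T c)"
      using im [of c] c by (simp only: atLeastAtMost_iff)
  qed
  also have "\<dots> \<longleftrightarrow> dem (perm_bound w) (columns n lam T)"
    unfolding columns_def dem_map_iff using card_colset [OF lam T'] by (intro ball_cong refl) simp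
  finally show ?thesis
    using T by (simp add: demazure_tableaux_def)
qed

lemma foldl_upd_0_le: "foldl upd G Cs 0 \<le> G 0"
proof (induction Cs arbitrary: G)
  case (Cons C Cs)
  have "upd G C 0 \<le> G 0"
    using upd_le [of 0 0 G C] by simp
  then show ?case
    using Cons [of "upd G C"] by simp
qed simp

text \<open>Suppose row \<open>r\<close> decreases from column \<open>c\<close> to
  \<open>Suc c\<close>, and let \<open>s\<close> be the smaller value. Then column \<open>c\<close>
  has at least \<open>?z c - r + 1\<close> entries above \<open>s\<close> and column
  \<open>Suc c\<close> at least \<open>r\<close> entries up to \<open>s\<close>. With the thresholds
  0 and \<open>s\<close>, \<open>dem\<close> bounds the total by the length \<open>?z c\<close>,
  which is one too small.\<close>

lemma dem_imp_tableau:
  assumes T: "T \<in> tabloids n lam" and dem: "dem (perm_bound w) (columns n lam T)"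
  shows "T \<in> tableaux n lam"
proof -
  let ?z = "col_len n lam" and ?m = "lam 1" and ?C = "colset n lam T"
  have adjacent: "T (r, c) \<le> T (r, Suc c)" if sh: "(r, Suc c) \<in> shape n lam" and c: "1 \<le> c" for r c
  proof (rule ccontr)
    assume "\<not> ?thesis"
    then have gt: "T (r, Suc c) < T (r, c)" by simp
    define s where "s = T (r, Suc c)"
    have sh': "(r, c) \<in> shape n lam"
      using sh c by (auto simp: shape_def)
    have r: "1 \<le> r" "r \<le> ?z (Suc c)" "r \<le> ?z c"
      using sh sh' by (auto simp: shape_iff [OF lam])
    have cm: "Suc c \<le> ?m"
      using col_len_pos_iff [OF lam n, of "Suc c"] r by auto
    let ?G = "foldl upd (perm_bound w (?z c)) (map ?C (rev [Suc (Suc c)..<Suc ?m]))"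
    have "rev [Suc c..<Suc ?m] = rev [Suc (Suc c)..<Suc ?m] @ [Suc c]"
      using cm by (simp add: upt_conv_Cons)
    moreover have "fits (foldl upd (perm_bound w (?z c)) (map ?C (rev [Suc c..<Suc ?m]))) (?C c)"
    proof -
      have "c \<in> {1..?m}"
        using c cm by simp
      then show ?thesis
        using dem card_colset [OF lam T c] unfolding columns_def dem_map_iff by metis
    qed
    ultimately have "fits (upd ?G (?C (Suc c))) (?C c)"
      by simp
    then have "int (card (?C c \<inter> {s<..}) + card (?C (Suc c) \<inter> {0<..s})) \<le> ?G 0"
      unfolding fits_upd_iff by blast
    also have "?G 0 \<le> perm_bound w (?z c) 0"
      by (rule foldl_upd_0_le)
    also have "\<dots> \<le> int (?z c)"
    proof -
      have "card {k \<in> {1..?z c}. 0 < w k} \<le> card {1..?z c}"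
        by (rule card_mono) auto
      then show ?thesis
        by (simp add: perm_bound_def)
    qed
    finally have total: "card (?C c \<inter> {s<..}) + card (?C (Suc c) \<inter> {0<..s}) \<le> ?z c"
      by simp
    have strict: "T (i, d) < T (j, d)" if "1 \<le> d" "1 \<le> i" "i < j" "j \<le> ?z d" for i j d
      using T that by (auto simp: tabloids_def shape_iff [OF lam])
    have "r \<le> card (?C (Suc c) \<inter> {0<..s})"
    proof -
      have "inj_on (\<lambda>i. T (i, Suc c)) {1..r}"
        using strict [of "Suc c"] r
        by (intro linorder_inj_onI) (auto, metis le_trans less_irrefl)
      then have "r = card ((\<lambda>i. T (i, Suc c)) ` {1..r})"
        by (simp add: card_image)
      also have "\<dots> \<le> card (?C (Suc c) \<inter> {0<..s})"
      proof (rule card_mono)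
        show "(\<lambda>i. T (i, Suc c)) ` {1..r} \<subseteq> ?C (Suc c) \<inter> {0<..s}"
        proof (rule image_subsetI)
          fix i assume i: "i \<in> {1..r}"
          have "T (i, Suc c) \<in> ?C (Suc c)"
            using i r by (auto simp: colset_def)
          moreover have "T (i, Suc c) \<le> s"
            using strict [of "Suc c" i r] i r by (cases "i = r") (auto simp: s_def)
          ultimately show "T (i, Suc c) \<in> ?C (Suc c) \<inter> {0<..s}"
            using colset_subset [OF lam T, of "Suc c"] by force
        qed
      qed simp
      finally show ?thesis .
    qed
    moreover have "?z c - r + 1 \<le> card (?C c \<inter> {s<..})"
    proof -
      have "inj_on (\<lambda>i. T (i, c)) {r..?z c}"
        using strict [of c] r c
        by (intro linorder_inj_onI) (auto, metis le_trans less_irrefl)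
      then have "?z c - r + 1 = card ((\<lambda>i. T (i, c)) ` {r..?z c})"
        using r by (simp add: card_image)
      also have "\<dots> \<le> card (?C c \<inter> {s<..})"
      proof (rule card_mono)
        show "(\<lambda>i. T (i, c)) ` {r..?z c} \<subseteq> ?C c \<inter> {s<..}"
        proof (rule image_subsetI)
          fix i assume i: "i \<in> {r..?z c}"
          have "T (i, c) \<in> ?C c"
            using i r by (auto simp: colset_def)
          moreover have "s < T (i, c)"
            using strict [of c r i] i r c gt by (cases "i = r") (auto simp: s_def)
          ultimately show "T (i, c) \<in> ?C c \<inter> {s<..}"
            by simp
        qed
      qed (simp add: colset_def)
      finally show ?thesis .
    qed
    ultimately show False
      using total r by simp
  qed
  have "T (r, c) \<le> T (r, c')" if "(r, c) \<in> shape n lam" "(r, c') \<in> shape n lam" "c < c'" for r c c'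
  proof -
    have "(r, d) \<in> shape n lam \<longrightarrow> T (r, c) \<le> T (r, d)" if "c \<le> d" for d
      using that
    proof (induction d rule: dec_induct)
      case (step d)
      have "1 \<le> c"
        using \<open>(r, c) \<in> shape n lam\<close> by (simp add: shape_def)
      then have "(r, Suc d) \<in> shape n lam \<longrightarrow> (r, d) \<in> shape n lam \<and> T (r, d) \<le> T (r, Suc d)"
        using step(1) adjacent [of r d] by (auto simp: shape_def)
      then show ?case
        using step.IH by auto
    qed simp
    then show ?thesis
      using that by simp
  qed
  then show ?thesis
    using T by (auto simp: tableaux_def)
qed

end

section \<open>Traces on quotients\<close>

definition congruent_mod :: "'b::ab_group_add set \<Rightarrow> 'b \<Rightarrow> 'b \<Rightarrow> bool" where
  "congruent_mod W u v \<longleftrightarrow> u - v \<in> W"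

context vector_space
begin

lemma coset_eq_iff:
  assumes W: "subspace W"
  shows "coset W u = coset W v \<longleftrightarrow> u - v \<in> W"
proof
  assume "coset W u = coset W v"
  moreover have "u \<in> coset W u"
    using subspace_0 [OF W] by (force simp: coset_def)
  ultimately obtain w where "w \<in> W" "u = v + w"
    by (auto simp: coset_def)
  then show "u - v \<in> W" by simp
next
  assume uv: "u - v \<in> W"
  have "coset W a \<subseteq> coset W b" if "a - b \<in> W" for a b
  proof
    fix x assume "x \<in> coset W a"
    then obtain w where w: "w \<in> W" "x = a + w"
      by (auto simp: coset_def)
    then have "x = b + ((a - b) + w)" "(a - b) + w \<in> W"
      using subspace_add [OF W that] by simp_all
    then show "x \<in> coset W b"
      unfolding coset_def by blast
  qed
  from this [OF uv] this [of v u] show "coset W u = coset W v"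
    using subspace_neg [OF W uv] by simp
qed

lemma coset_0: "coset W 0 = W"
  by (simp add: coset_def)

lemma quot_add_coset:
  assumes W: "subspace W"
  shows "quot_add (coset W u) (coset W v) = coset W (u + v)"
proof (intro equalityI subsetI)
  fix x assume "x \<in> quot_add (coset W u) (coset W v)"
  then obtain w w' where "w \<in> W" "w' \<in> W" "x = u + w + (v + w')"
    by (auto simp: quot_add_def coset_def)
  then show "x \<in> coset W (u + v)"
    using subspace_add [OF W, of w w'] by (auto simp: coset_def algebra_simps intro!: image_eqI [of _ _ "w + w'"])
next
  fix x assume "x \<in> coset W (u + v)"
  then obtain w where "w \<in> W" "x = (u + 0) + (v + w)"
    by (auto simp: coset_def add.assoc)
  then show "x \<in> quot_add (coset W u) (coset W v)"
    using subspace_0 [OF W] unfolding quot_add_def coset_def by blast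
qed

lemma quot_scale_coset:
  assumes W: "subspace W"
  shows "quot_scale scale W k (coset W v) = coset W (scale k v)"
proof (intro equalityI subsetI)
  fix x assume "x \<in> quot_scale scale W k (coset W v)"
  then obtain w w' where w: "w \<in> W" "w' \<in> W" "x = scale k (v + w) + w'"
    by (auto simp: quot_scale_def coset_def)
  then have "x = scale k v + (scale k w + w')" "scale k w + w' \<in> W"
    using subspace_add [OF W subspace_scale [OF W]] by (simp_all add: scale_right_distrib add.assoc)
  then show "x \<in> coset W (scale k v)"
    unfolding coset_def by blast
next
  fix x assume "x \<in> coset W (scale k v)"
  then obtain w where "w \<in> W" "x = scale k (v + 0) + w"
    by (auto simp: coset_def)
  then show "x \<in> quot_scale scale W k (coset W v)"
    using subspace_0 [OF W] unfolding quot_scale_def coset_def by blast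
qed

lemma quot_lincomb_coset:
  assumes W: "subspace W" and "length ks = length vs"
  shows "quot_lincomb scale W ks (map (coset W) vs) = coset W (\<Sum>i<length vs. scale (ks ! i) (vs ! i))"
  using assms(2)
proof (induction ks vs rule: list_induct2)
  case Nil
  show ?case by (simp add: quot_lincomb_def coset_0)
next
  case (Cons k ks v vs)
  have "quot_lincomb scale W (k # ks) (map (coset W) (v # vs)) =
      quot_add (quot_scale scale W k (coset W v)) (quot_lincomb scale W ks (map (coset W) vs))"
    by (simp add: quot_lincomb_def)
  also have "\<dots> = coset W (scale k v + (\<Sum>i<length vs. scale (ks ! i) (vs ! i)))"
    unfolding Cons.IH quot_scale_coset [OF W] quot_add_coset [OF W] ..
  also have "scale k v + (\<Sum>i<length vs. scale (ks ! i) (vs ! i)) =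
      (\<Sum>i<length (v # vs). scale ((k # ks) ! i) ((v # vs) ! i))"
    by (simp add: sum.lessThan_Suc_shift del: sum.lessThan_Suc)
  finally show ?case .
qed

lemma induced_map_coset:
  assumes W: "subspace W" and f: "\<And>u v. f (u + v) = f u + f v" "\<And>w. w \<in> W \<Longrightarrow> f w \<in> W"
  shows "induced_map W f (coset W v) = coset W (f v)"
proof -
  have "coset W (f (v + w)) = coset W (f v)" if "w \<in> W" for w
    using f that by (simp add: coset_eq_iff [OF W])
  moreover have "W \<noteq> {}"
    using subspace_0 [OF W] by blast
  ultimately show ?thesis
    by (auto simp: induced_map_def coset_def [of W v])
qed

lemma congruent_mod_trans:
  assumes "subspace W" and "congruent_mod W u v" "congruent_mod W v x"
  shows "congruent_mod W u x"
  using subspace_add [OF assms(1), of "u - v" "v - x"] assms by (simp add: congruent_mod_def)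

lemma congruent_mod_sum:
  assumes "subspace W" and "\<And>i. i \<in> I \<Longrightarrow> congruent_mod W (u i) (v i)"
  shows "congruent_mod W (\<Sum>i \<in> I. scale (c i) (u i)) (\<Sum>i \<in> I. scale (c i) (v i))"
proof -
  have "(\<Sum>i \<in> I. scale (c i) (u i)) - (\<Sum>i \<in> I. scale (c i) (v i)) = (\<Sum>i \<in> I. scale (c i) (u i - v i))"
    by (simp add: sum_subtractf scale_right_diff_distrib)
  then show ?thesis
    using assms by (auto simp: congruent_mod_def intro!: subspace_sum subspace_scale)
qed

lemma quot_basis_iff:
  assumes W: "subspace W"
  shows "quot_basis scale V W (map (coset W) vs) \<longleftrightarrow>
    coset W ` set vs \<subseteq> quot_space V W \<and>
    (\<forall>v \<in> V. \<exists>!ks. length ks = length vs \<and> congruent_mod W (\<Sum>i<length vs. scale (ks ! i) (vs ! i)) v)"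
  unfolding quot_basis_def quot_space_def
  by (auto simp: quot_lincomb_coset [OF W] coset_eq_iff [OF W] congruent_mod_def cong: conj_cong)

lemma quot_basis_unique:
  assumes W: "subspace W" and V: "subspace V" "W \<subseteq> V" and vs: "set vs \<subseteq> V"
    and basis: "quot_basis scale V W (map (coset W) vs)"
    and eq: "congruent_mod W (\<Sum>i<length vs. scale (a i) (vs ! i)) (\<Sum>i<length vs. scale (b i) (vs ! i))"
    and i: "i < length vs"
  shows "a i = b i"
proof -
  let ?N = "length vs"
  have in_V: "(\<Sum>i<?N. scale (b i) (vs ! i)) \<in> V"
    using vs by (intro subspace_sum [OF V(1)] subspace_scale [OF V(1)]) auto
  define coeffs where "coeffs ks \<longleftrightarrow> length ks = ?N \<and>
    congruent_mod W (\<Sum>i<?N. scale (ks ! i) (vs ! i)) (\<Sum>i<?N. scale (b i) (vs ! i))" for ks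
  have "\<exists>!ks. coeffs ks"
    using basis [unfolded quot_basis_iff [OF W]] in_V unfolding coeffs_def by blast
  moreover have "coeffs (map b [0..<?N])"
    using subspace_0 [OF W] by (simp add: coeffs_def congruent_mod_def)
  moreover have "coeffs (map a [0..<?N])"
    using eq by (simp add: coeffs_def)
  ultimately have "map a [0..<?N] = map b [0..<?N]"
    by blast
  then have "map a [0..<?N] ! i = map b [0..<?N] ! i"
    by (simp only:)
  then show ?thesis
    using i by simp
qed

text \<open>
  With \<open>P\<close> and \<open>R\<close> the change of basis from and to an eigenbasis, the matrix in another basis is
  \<open>R diag(\<mu>) P\<close>, whose trace is that of \<open>diag(\<mu>) P R\<close>.
\<close>

lemma quot_trace_eigenbasis:
  assumes W: "subspace W" and V: "subspace V" "W \<subseteq> V" and vs: "set vs \<subseteq> V"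
    and basis: "quot_basis scale V W (map (coset W) vs)"
    and f: "\<And>u v. f (u + v) = f u + f v" "\<And>k v. f (scale k v) = scale k (f v)" "\<And>w. w \<in> W \<Longrightarrow> f w \<in> W"
    and eigen: "\<And>i. i < length vs \<Longrightarrow> f (vs ! i) = scale (\<mu> i) (vs ! i)"
  shows "quot_trace scale V W (induced_map W f) = (\<Sum>i<length vs. \<mu> i)"
proof -
  let ?N = "length vs"
  note coset_f = induced_map_coset [OF W f(1,3)]
  have f_sum: "f (\<Sum>i \<in> I. scale (c i) (u i)) = (\<Sum>i \<in> I. scale (c i) (f (u i)))" if "finite I" for I c u
    using that
  proof (induction I)
    case empty
    show ?case using f(2) [of 0 0] by simp
  qed (simp add: f)
  show ?thesis
    unfolding quot_trace_def
  proof (rule the_equality)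
    let ?M = "mat ?N ?N (\<lambda>(i, j). if i = j then \<mu> i else 0)"
    have "quot_matrix scale W (map (coset W) vs) (induced_map W f) ?M"
      unfolding quot_matrix_def
    proof (intro conjI allI impI)
      show "?M \<in> carrier_mat (length (map (coset W) vs)) (length (map (coset W) vs))" by simp
      fix j assume "j < length (map (coset W) vs)"
      then have j: "j < ?N" by simp
      have "(\<Sum>i<?N. scale (list_of_vec (col ?M j) ! i) (vs ! i)) = (\<Sum>i<?N. if i = j then scale (\<mu> j) (vs ! j) else 0)"
        using j by (intro sum.cong) (auto simp: list_of_vec_index)
      also have "\<dots> = scale (\<mu> j) (vs ! j)"
        using j by simp
      finally have "quot_lincomb scale W (list_of_vec (col ?M j)) (map (coset W) vs) = coset W (scale (\<mu> j) (vs ! j))"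
        by (subst quot_lincomb_coset [OF W]) simp_all
      then show "induced_map W f (map (coset W) vs ! j) = quot_lincomb scale W (list_of_vec (col ?M j)) (map (coset W) vs)"
        using j by (simp add: coset_f eigen)
    qed
    moreover have "(\<Sum>i<?N. \<mu> i) = (\<Sum>i<length (map (coset W) vs). ?M $$ (i, i))"
      by simp
    ultimately show "\<exists>Bs M. quot_basis scale V W Bs \<and> quot_matrix scale W Bs (induced_map W f) M \<and>
        (\<Sum>i<?N. \<mu> i) = (\<Sum>i<length Bs. M $$ (i, i))"
      using basis by blast
  next
    fix t assume "\<exists>Bs M. quot_basis scale V W Bs \<and> quot_matrix scale W Bs (induced_map W f) M \<and>
        t = (\<Sum>i<length Bs. M $$ (i, i))"
    then obtain Bs M where Bs: "quot_basis scale V W Bs" and M: "quot_matrix scale W Bs (induced_map W f) M"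
      and t: "t = (\<Sum>i<length Bs. M $$ (i, i))" by blast
    have "\<forall>B \<in> set Bs. \<exists>u. u \<in> V \<and> B = coset W u"
      using Bs by (auto simp: quot_basis_def quot_space_def)
    then obtain rep where rep: "\<And>B. B \<in> set Bs \<Longrightarrow> rep B \<in> V \<and> B = coset W (rep B)"
      by metis
    define us where "us = map rep Bs"
    have Bs_eq: "Bs = map (coset W) us"
      unfolding us_def map_map using rep by (intro map_idI [symmetric]) simp
    have us: "set us \<subseteq> V"
      using rep by (auto simp: us_def)
    let ?K = "length us"
    have len: "length Bs = ?K" by (simp add: us_def)
    have basis': "quot_basis scale V W (map (coset W) us)"
      using Bs Bs_eq by simp
    have "\<exists>c. congruent_mod W (\<Sum>i<?N. scale (c i) (vs ! i)) u" if "u \<in> V" for u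
      using basis that unfolding quot_basis_iff [OF W] by blast
    then have "\<exists>c. congruent_mod W (\<Sum>i<?N. scale (c i) (vs ! i)) (us ! j)" if "j < ?K" for j
      using us that nth_mem by blast
    then obtain P where P: "\<And>j. j < ?K \<Longrightarrow> congruent_mod W (\<Sum>i<?N. scale (P j i) (vs ! i)) (us ! j)"
      by metis
    have "\<exists>c. congruent_mod W (\<Sum>i<?K. scale (c i) (us ! i)) u" if "u \<in> V" for u
      using basis' that unfolding quot_basis_iff [OF W] by blast
    then have "\<exists>c. congruent_mod W (\<Sum>i<?K. scale (c i) (us ! i)) (vs ! j)" if "j < ?N" for j
      using vs that nth_mem by blast
    then obtain R where R: "\<And>j. j < ?N \<Longrightarrow> congruent_mod W (\<Sum>i<?K. scale (R j i) (us ! i)) (vs ! j)"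
      by metis
    have sym: "congruent_mod W v u" if "congruent_mod W u v" for u v
      using that subspace_neg [OF W, of "u - v"] by (simp add: congruent_mod_def)
    have swap: "(\<Sum>k \<in> A. scale (c k) (\<Sum>i \<in> B. scale (d k i) (u i))) = (\<Sum>i \<in> B. scale (\<Sum>k \<in> A. c k * d k i) (u i))"
      for A B :: "nat set" and c d u
      by (simp add: scale_sum_right scale_sum_left sum.swap [of _ A B])
    \<comment> \<open>Expressing an eigenvector in the other basis and expanding back returns it
      modulo \<open>W\<close>; uniqueness of the coefficients makes this the identity
      matrix.\<close>
    have PR: "(\<Sum>k<?K. R j k * P k i) = (if i = j then 1 else 0)" if i: "i < ?N" and j: "j < ?N" for i j
    proof (rule quot_basis_unique [OF W V vs basis _ i])
      have "congruent_mod W (\<Sum>k<?K. scale (R j k) (\<Sum>i<?N. scale (P k i) (vs ! i))) (\<Sum>k<?K. scale (R j k) (us ! k))"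
        using P by (intro congruent_mod_sum [OF W]) auto
      then have "congruent_mod W (\<Sum>i<?N. scale (\<Sum>k<?K. R j k * P k i) (vs ! i)) (vs ! j)"
        using R [OF j] congruent_mod_trans [OF W] unfolding swap by blast
      moreover have "(\<Sum>i<?N. scale (if i = j then 1 else 0) (vs ! i)) = (\<Sum>i<?N. if i = j then vs ! j else 0)"
        by (intro sum.cong) auto
      ultimately show "congruent_mod W (\<Sum>i<?N. scale (\<Sum>k<?K. R j k * P k i) (vs ! i))
          (\<Sum>i<?N. scale (if i = j then 1 else 0) (vs ! i))"
        using j by simp
    qed
    have M_eq: "M $$ (k, j) = (\<Sum>i<?N. P j i * \<mu> i * R i k)" if k: "k < ?K" and j: "j < ?K" for k j
    proof (rule quot_basis_unique [OF W V us basis' _ k])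
      have M_dim: "M \<in> carrier_mat ?K ?K"
        using M len by (simp add: quot_matrix_def)
      have "induced_map W f (Bs ! j) = quot_lincomb scale W (list_of_vec (col M j)) Bs"
        using M j len by (simp add: quot_matrix_def)
      then have "coset W (f (us ! j)) = coset W (\<Sum>k<?K. scale (list_of_vec (col M j) ! k) (us ! k))"
        using j M_dim unfolding Bs_eq by (subst (asm) quot_lincomb_coset [OF W]) (auto simp: coset_f)
      also have "(\<Sum>k<?K. scale (list_of_vec (col M j) ! k) (us ! k)) = (\<Sum>k<?K. scale (M $$ (k, j)) (us ! k))"
        using M_dim j by (intro sum.cong) (auto simp: list_of_vec_index)
      finally have 1: "congruent_mod W (\<Sum>k<?K. scale (M $$ (k, j)) (us ! k)) (f (us ! j))"
        using sym by (simp add: coset_eq_iff [OF W] congruent_mod_def)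
      have "f (us ! j) - f (\<Sum>i<?N. scale (P j i) (vs ! i)) = f (us ! j - (\<Sum>i<?N. scale (P j i) (vs ! i)))"
        using f(1) [of "us ! j - (\<Sum>i<?N. scale (P j i) (vs ! i))" "\<Sum>i<?N. scale (P j i) (vs ! i)"] by simp
      then have "congruent_mod W (f (us ! j)) (f (\<Sum>i<?N. scale (P j i) (vs ! i)))"
        using f(3) sym [OF P [OF j]] by (simp add: congruent_mod_def)
      also have "f (\<Sum>i<?N. scale (P j i) (vs ! i)) = (\<Sum>i<?N. scale (P j i * \<mu> i) (vs ! i))"
        by (subst f_sum) (auto simp: eigen intro!: sum.cong)
      finally have 2: "congruent_mod W (f (us ! j)) (\<Sum>i<?N. scale (P j i * \<mu> i) (vs ! i))" .
      have "congruent_mod W (\<Sum>i<?N. scale (P j i * \<mu> i) (vs ! i)) (\<Sum>i<?N. scale (P j i * \<mu> i) (\<Sum>k<?K. scale (R i k) (us ! k)))"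
        using sym [OF R] by (intro congruent_mod_sum [OF W]) auto
      then have 3: "congruent_mod W (\<Sum>i<?N. scale (P j i * \<mu> i) (vs ! i)) (\<Sum>k<?K. scale (\<Sum>i<?N. P j i * \<mu> i * R i k) (us ! k))"
        unfolding swap .
      show "congruent_mod W (\<Sum>k<?K. scale (M $$ (k, j)) (us ! k)) (\<Sum>k<?K. scale (\<Sum>i<?N. P j i * \<mu> i * R i k) (us ! k))"
        using congruent_mod_trans [OF W congruent_mod_trans [OF W 1 2] 3] .
    qed
    have "t = (\<Sum>j<?K. \<Sum>i<?N. P j i * \<mu> i * R i j)"
      unfolding t len by (intro sum.cong) (auto simp: M_eq)
    also have "\<dots> = (\<Sum>i<?N. \<mu> i * (\<Sum>j<?K. R i j * P j i))"
      by (subst sum.swap) (simp add: sum_distrib_left mult_ac)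
    also have "\<dots> = (\<Sum>i<?N. \<mu> i)"
      by (intro sum.cong) (simp_all add: PR)
    finally show "t = (\<Sum>i<?N. \<mu> i)" .
  qed
qed

end


section \<open>Substitution homomorphisms\<close>

text \<open>Covers evaluation at a matrix and the substitution defining \<open>act\<close> together;
  as ring homomorphisms both commute with determinants and hence with minors.\<close>

lemma comm_ring_hom_poly_at:
  assumes "comm_ring_hom \<phi>"
  shows "comm_ring_hom (poly_at \<phi> \<sigma>)"
proof -
  interpret \<phi>: comm_ring_hom \<phi> by (rule assms)
  let ?h = "poly_at \<phi> \<sigma>"
  let ?m = "\<lambda>m. \<Prod>v \<in> Poly_Mapping.keys m. \<sigma> v ^ Poly_Mapping.lookup m v"
  have single: "?h (Poly_Mapping.single m k) = \<phi> k * ?m m" for m k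
    by (simp add: poly_at_def)
  have add: "?h (p + q) = ?h p + ?h q" for p q
    unfolding poly_at_def
    by (rule setsum_keys_plus_distrib) (simp_all add: \<phi>.hom_add distrib_right)
  have zero: "?h 0 = 0"
    by (simp add: poly_at_def)
  have sum: "?h (sum g A) = (\<Sum>x \<in> A. ?h (g x))" for g :: "(nat \<times> nat \<Rightarrow>\<^sub>0 nat) \<Rightarrow> entry_poly" and A
    by (induction A rule: infinite_finite_induct) (simp_all add: add zero)
  have mult: "?h (p * q) = ?h p * ?h q" for p q
  proof -
    let ?s = "\<lambda>p m. Poly_Mapping.single m (Poly_Mapping.lookup p m)"
    have "p * q = (\<Sum>m \<in> Poly_Mapping.keys p. \<Sum>m' \<in> Poly_Mapping.keys q. ?s p m * ?s q m')"
      using sum_product [of "?s p" "Poly_Mapping.keys p" "?s q" "Poly_Mapping.keys q"]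
      by (simp add: sum_single_keys)
    then have "?h (p * q) = (\<Sum>m \<in> Poly_Mapping.keys p. \<Sum>m' \<in> Poly_Mapping.keys q. ?h (?s p m) * ?h (?s q m'))"
      by (simp add: sum mult_single single poly_at_mono_add \<phi>.hom_mult mult_ac)
    also have "\<dots> = ?h (\<Sum>m \<in> Poly_Mapping.keys p. ?s p m) * ?h (\<Sum>m' \<in> Poly_Mapping.keys q. ?s q m')"
      by (simp only: sum_product sum)
    finally show ?thesis by (simp add: sum_single_keys)
  qed
  have one: "?h 1 = 1"
    using single [of 0 1] by simp
  show ?thesis
    by unfold_locales (simp_all add: add mult zero one)
qed

lemma comm_ring_hom_const_poly: "comm_ring_hom const_poly"
  by unfold_locales (simp_all add: const_poly_def single_add mult_single)

lemma comm_ring_hom_id: "comm_ring_hom (\<lambda>k :: complex. k)"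
  by unfold_locales simp_all

lemma poly_at_const:
  assumes "comm_ring_hom \<phi>"
  shows "poly_at \<phi> \<sigma> (const_poly k) = \<phi> k"
proof -
  interpret \<phi>: comm_ring_hom \<phi> by (rule assms)
  show ?thesis by (simp add: poly_at_def const_poly_def)
qed

lemma poly_at_entry:
  assumes "comm_ring_hom \<phi>"
  shows "poly_at \<phi> \<sigma> (entry i j) = \<sigma> (i, j)"
proof -
  interpret \<phi>: comm_ring_hom \<phi> by (rule assms)
  show ?thesis by (simp add: poly_at_def entry_def)
qed

lemma (in comm_ring_hom) hom_rowdet: "hom (rowdet x q \<rho>) = rowdet (\<lambda>i j. hom (x i j)) q \<rho>"
  unfolding rowdet_def hom_det [symmetric] by (intro arg_cong [where f = det] eq_matI) auto

lemma (in comm_ring_hom) hom_minor: "hom (minor x C) = minor (\<lambda>i j. hom (x i j)) C"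
  by (simp add: minor_def hom_rowdet)

lemma (in comm_ring_hom) hom_col_monom: "hom (col_monom x Cs) = col_monom (\<lambda>i j. hom (x i j)) Cs"
  by (induction Cs) (simp_all add: col_monom_def hom_mult hom_minor)

lemma eval_col_monom: "eval_poly (\<lambda>(i, j). f i j) (col_monom entry Cs) = col_monom f Cs"
proof -
  interpret comm_ring_hom "eval_poly (\<lambda>(i, j). f i j)"
    by (rule comm_ring_hom_poly_at [OF comm_ring_hom_id])
  show ?thesis
    by (simp add: hom_col_monom poly_at_entry [OF comm_ring_hom_id])
qed

section \<open>The torus action on products of minors\<close>

lemma minor_scale_rows:
  assumes "finite C" and "\<And>i j. i \<in> C \<Longrightarrow> x i j = c i * x' i j"
  shows "minor x C = (\<Prod>i \<in> C. c i) * minor x' C"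
proof -
  let ?L = "sorted_list_of_set C" and ?q = "card C"
  have mem: "?L ! i \<in> C" if "i < ?q" for i
    using nth_mem [of i ?L] that assms(1) by simp
  have bij: "bij_betw ((!) ?L) {0..<?q} C"
    using assms(1) by (intro bij_betw_nth) (auto simp: atLeast0LessThan)
  have "minor x C = (\<Sum>\<pi> | \<pi> permutes {0..<?q}. signof \<pi> * (\<Prod>i = 0..<?q. x (?L ! i) (Suc (\<pi> i))))" for x :: "nat \<Rightarrow> nat \<Rightarrow> 'a"
    unfolding minor_def rowdet_def
    by (subst det_def' [of _ ?q]) (auto intro!: sum.cong prod.cong simp: permutes_in_image)
  note expand = this
  have "(\<Prod>i = 0..<?q. x (?L ! i) (Suc (\<pi> i))) = (\<Prod>i \<in> C. c i) * (\<Prod>i = 0..<?q. x' (?L ! i) (Suc (\<pi> i)))" for \<pi>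
    by (simp add: assms(2) mem prod.distrib prod.reindex_bij_betw [OF bij, symmetric])
  then show ?thesis
    unfolding expand by (simp add: sum_distrib_left mult_ac)
qed

text \<open>\<open>mat_inverse\<close> is given by an algorithm, so its value is identified through
  the uniqueness of inverses.\<close>

lemma mat_inverse_torus:
  assumes "\<forall>i \<in> {1..n}. y i \<noteq> 0"
  shows "mat_inverse (torus_element n y) = Some (mat_diag n (\<lambda>i. y (i + 1)))"
proof -
  let ?h = "torus_element n y" and ?g = "mat_diag n (\<lambda>i. y (i + 1))"
  have h: "?h \<in> carrier_mat n n" and g: "?g \<in> carrier_mat n n"
    by (simp_all add: torus_element_def mat_diag_def)
  have gh: "?g * ?h = 1\<^sub>m n" and hg: "?h * ?g = 1\<^sub>m n"
    unfolding torus_element_def mat_diag_diag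
    using assms by (auto simp: mat_diag_def intro!: eq_matI)
  have "?h \<in> Units (ring_mat TYPE(complex) n ())"
    using h g gh hg by (auto simp: Units_def ring_mat_def)
  then obtain B where B: "mat_inverse ?h = Some B"
    using mat_inverse(1) [OF h, where b = "()"] by (cases "mat_inverse ?h") auto
  have carrier: "B \<in> carrier_mat n n"
    using mat_inverse(2) [OF h B] by blast
  then have "B = (?g * ?h) * B"
    unfolding gh by simp
  also have "\<dots> = ?g * (?h * B)"
    by (rule assoc_mult_mat [OF g h carrier])
  also have "?h * B = 1\<^sub>m n"
    using mat_inverse(2) [OF h B] by blast
  also have "?g * 1\<^sub>m n = ?g"
    by (rule right_mult_one_mat [OF g])
  finally show ?thesis
    using B by simp
qed

definition columns_weight :: "(nat \<Rightarrow> complex) \<Rightarrow> nat set list \<Rightarrow> complex" where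
  "columns_weight y Cs = (\<Prod>C\<leftarrow>Cs. \<Prod>c \<in> C. y c)"

lemma act_hom: "comm_ring_hom (act n h)"
  unfolding act_def by (rule comm_ring_hom_poly_at [OF comm_ring_hom_const_poly])

lemma act_scale: "act n h (scale_poly k p) = scale_poly k (act n h p)"
proof -
  interpret comm_ring_hom "act n h" by (rule act_hom)
  show ?thesis
    by (simp add: scale_poly_def hom_mult) (simp add: act_def poly_at_const [OF comm_ring_hom_const_poly])
qed

context
  fixes n :: nat and y :: "nat \<Rightarrow> complex"
  assumes y: "\<forall>i \<in> {1..n}. y i \<noteq> 0"
begin

text \<open>The action substitutes the inverse of the torus element, so row \<open>i\<close> is
  scaled by \<open>y i\<close> itself and the weights have nonnegative exponents.\<close>

lemma act_entry:
  assumes "i \<in> {1..n}"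
  shows "act n (torus_element n y) (entry i j) = const_poly (y i) * entry i j"
proof -
  interpret comm_ring_hom const_poly by (rule comm_ring_hom_const_poly)
  have "act n (torus_element n y) (entry i j) =
      (\<Sum>k = 1..n. const_poly (mat_diag n (\<lambda>i. y (i + 1)) $$ (i - 1, k - 1)) * entry k j)"
    by (simp add: act_def poly_at_entry [OF comm_ring_hom_const_poly] mat_inverse_torus [OF y])
  also have "\<dots> = (\<Sum>k = 1..n. if k = i then const_poly (y i) * entry i j else 0)"
    using assms by (intro sum.cong) (auto simp: mat_diag_def)
  finally show ?thesis
    using assms by simp
qed

lemma act_col_monom:
  assumes "\<And>C. C \<in> set Cs \<Longrightarrow> C \<subseteq> {1..n}"
  shows "act n (torus_element n y) (col_monom entry Cs) = scale_poly (columns_weight y Cs) (col_monom entry Cs)"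
proof -
  interpret act: comm_ring_hom "act n (torus_element n y)" by (rule act_hom)
  interpret const: comm_ring_hom const_poly by (rule comm_ring_hom_const_poly)
  have minor: "act n (torus_element n y) (minor entry C) = const_poly (\<Prod>c \<in> C. y c) * minor entry C"
    if "C \<subseteq> {1..n}" for C
  proof -
    have "finite C" using that finite_subset by blast
    then show ?thesis
      unfolding act.hom_minor const.hom_prod
      by (rule minor_scale_rows) (use that act_entry in auto)
  qed
  show ?thesis
    using assms
  proof (induction Cs)
    case Nil
    show ?case by (simp add: col_monom_def columns_weight_def scale_poly_def)
  next
    case (Cons C Cs)
    then show ?case
      by (simp add: col_monom_Cons act.hom_mult minor columns_weight_def scale_poly_def const.hom_mult mult_ac)
  qed
qed

end


section \<open>The standard monomial basis\<close>

text \<open>The coefficients are indexed by \<open>A\<close> and not by the image, since different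
  column lists are not yet known to give different products.\<close>

lemma poly_span_image_finite:
  assumes "finite A" and "v \<in> poly.span (f ` A)"
  shows "\<exists>c. v = (\<Sum>a \<in> A. scale_poly (c a) (f a))"
  using assms(2)
proof (induction rule: poly.span_induct_alt)
  case base
  show ?case by (intro exI [of _ "\<lambda>_. 0"]) simp
next
  case (step k x v)
  then obtain a c where a: "a \<in> A" "x = f a" and c: "v = (\<Sum>a \<in> A. scale_poly (c a) (f a))"
    by auto
  have "(\<Sum>b \<in> A. scale_poly ((c(a := k + c a)) b) (f b)) =
      scale_poly (k + c a) (f a) + (\<Sum>b \<in> A - {a}. scale_poly (c b) (f b))"
    using assms(1) a(1) by (subst sum.remove [of A a]) (auto intro!: sum.cong)
  also have "\<dots> = scale_poly k x + v"
    using assms(1) a by (simp add: c sum.remove [of A a] poly.scale_left_distrib)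
  finally show ?case
    by (intro exI [of _ "c(a := k + c a)"]) simp
qed

definition standard :: "nat \<Rightarrow> (nat \<Rightarrow> nat) \<Rightarrow> nat list \<Rightarrow> nat set list set" where
  "standard n w qs = {Cs \<in> col_lists n qs. dem (perm_bound w) Cs}"

definition monoms :: "nat \<Rightarrow> nat list \<Rightarrow> entry_poly set" where
  "monoms n qs = poly.span (col_monom entry ` col_lists n qs)"

definition bad_monoms :: "nat \<Rightarrow> (nat \<Rightarrow> nat) \<Rightarrow> nat list \<Rightarrow> entry_poly set" where
  "bad_monoms n w qs = poly.span (col_monom entry ` {Cs \<in> col_lists n qs. bad (perm_bound w) Cs})"

context
  fixes n :: nat and w :: "nat \<Rightarrow> nat" and qs :: "nat list"
  assumes w: "w permutes {1..n}" and qs: "sorted qs"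
begin

text \<open>A column violating its bound contributes a minor that vanishes on the cell. Evaluation
  at a point of the cell therefore descends to the quotient.\<close>

lemma bad_monoms_eval:
  assumes f: "f \<in> cell w" and v: "v \<in> bad_monoms n w qs"
  shows "eval_poly (\<lambda>(i, j). f i j) v = 0"
  using v unfolding bad_monoms_def
proof (induction rule: poly.span_induct_alt)
  case base
  show ?case by (simp add: poly_at_def)
next
  case (step k x v)
  then obtain Cs where Cs: "Cs \<in> col_lists n qs" "bad (perm_bound w) Cs" "x = col_monom entry Cs"
    by auto
  then obtain C where C: "C \<in> set Cs" "\<not> fits (perm_bound w (card C)) C"
    by (auto simp: bad_def)
  then have "C \<subseteq> {1..n}"
    using col_listsD(1) [OF Cs(1)] by (auto simp: in_set_conv_nth)
  then have "minor f C = 0"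
    using minor_cell_eq_0 [OF f _ C(2)] finite_subset by blast
  then have "col_monom f Cs = 0"
    using C(1) by (auto simp: col_monom_def prod_list_zero_iff)
  then show ?case
    using step by (simp add: Cs(3) eval_poly_add scale_poly_def eval_poly_mult eval_col_monom)
qed

text \<open>Existence of coefficients is \<open>col_monom_in_span\<close> with the bad products
  moved into the subspace. For uniqueness, the difference of two expansions lies in
  \<open>bad_monoms\<close>, hence vanishes on the cell of \<open>w\<close>, and
  \<open>dem_independent\<close> applies.\<close>

lemma standard_basis:
  assumes cs: "distinct cs" "set cs = standard n w qs"
  shows "quot_basis scale_poly (monoms n qs) (bad_monoms n w qs) (map (coset (bad_monoms n w qs)) (map (col_monom entry) cs))"
proof -
  let ?vs = "map (col_monom entry) cs"
  have W: "poly.subspace (bad_monoms n w qs)"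
    unfolding bad_monoms_def by (rule poly.subspace_span)
  have fin: "finite (standard n w qs)"
    unfolding standard_def using finite_col_lists by simp
  have bij: "bij_betw ((!) cs) {..<length cs} (standard n w qs)"
    using cs by (intro bij_betw_nth) auto
  have sum_cs: "(\<Sum>i<length ?vs. scale_poly (ks ! i) (?vs ! i)) =
      (\<Sum>Cs \<in> standard n w qs. scale_poly (ks ! the_inv_into {..<length cs} ((!) cs) Cs) (col_monom entry Cs))" for ks
    unfolding sum.reindex_bij_betw [OF bij, symmetric]
    using bij by (intro sum.cong) (auto simp: the_inv_into_f_f bij_betw_def)
  have "\<exists>!ks. length ks = length ?vs \<and>
      congruent_mod (bad_monoms n w qs) (\<Sum>i<length ?vs. scale_poly (ks ! i) (?vs ! i)) v" if v: "v \<in> monoms n qs" for v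
  proof (rule ex_ex1I)
    have "col_monom entry ` col_lists n qs \<subseteq> poly.span (col_monom entry ` {Cs \<in> col_lists n qs. dem (perm_bound w) Cs \<or> bad (perm_bound w) Cs})"
      using col_monom_in_span [OF qs] by blast
    then have "v \<in> poly.span (col_monom entry ` {Cs \<in> col_lists n qs. dem (perm_bound w) Cs \<or> bad (perm_bound w) Cs})"
      using v poly.span_minimal [OF _ poly.subspace_span] unfolding monoms_def by blast
    also have "col_monom entry ` {Cs \<in> col_lists n qs. dem (perm_bound w) Cs \<or> bad (perm_bound w) Cs} =
        col_monom entry ` standard n w qs \<union> col_monom entry ` {Cs \<in> col_lists n qs. bad (perm_bound w) Cs}"
      by (auto simp: standard_def)
    finally obtain x z where x: "x \<in> poly.span (col_monom entry ` standard n w qs)" and z: "z \<in> bad_monoms n w qs" "v = x + z"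
      unfolding poly.span_Un bad_monoms_def by blast
    obtain c where c: "x = (\<Sum>Cs \<in> standard n w qs. scale_poly (c Cs) (col_monom entry Cs))"
      using poly_span_image_finite [OF fin x] by blast
    have "(\<Sum>i<length ?vs. scale_poly (map c cs ! i) (?vs ! i)) = x"
      unfolding c sum.reindex_bij_betw [OF bij, symmetric] by simp
    then show "\<exists>ks. length ks = length ?vs \<and>
        congruent_mod (bad_monoms n w qs) (\<Sum>i<length ?vs. scale_poly (ks ! i) (?vs ! i)) v"
      using z poly.subspace_neg [OF W] by (intro exI [of _ "map c cs"]) (simp add: congruent_mod_def)
  next
    fix ks ls assume ks: "length ks = length ?vs \<and> congruent_mod (bad_monoms n w qs) (\<Sum>i<length ?vs. scale_poly (ks ! i) (?vs ! i)) v"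
      and ls: "length ls = length ?vs \<and> congruent_mod (bad_monoms n w qs) (\<Sum>i<length ?vs. scale_poly (ls ! i) (?vs ! i)) v"
    \<comment> \<open>Coefficient lists are turned into coefficients indexed by column lists, as
      \<open>vanishing\<close> expects; \<open>cs\<close> is distinct, so every standard list has
      one position.\<close>
    let ?idx = "the_inv_into {..<length cs} ((!) cs)"
    define \<alpha> where "\<alpha> Cs = ks ! ?idx Cs - ls ! ?idx Cs" for Cs
    let ?ks = "\<Sum>i<length ?vs. scale_poly (ks ! i) (?vs ! i)" and ?ls = "\<Sum>i<length ?vs. scale_poly (ls ! i) (?vs ! i)"
    have "?ks - ?ls \<in> bad_monoms n w qs"
      using poly.subspace_diff [OF W, of "?ks - v" "?ls - v"] ks ls by (simp add: congruent_mod_def)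
    moreover have "?ks - ?ls = (\<Sum>Cs \<in> standard n w qs. scale_poly (\<alpha> Cs) (col_monom entry Cs))"
      unfolding sum_cs by (simp add: \<alpha>_def poly.scale_left_diff_distrib sum_subtractf)
    ultimately have rel: "(\<Sum>Cs \<in> standard n w qs. scale_poly (\<alpha> Cs) (col_monom entry Cs)) \<in> bad_monoms n w qs"
      by (simp only:)
    have "(\<Sum>Cs \<in> standard n w qs. \<alpha> Cs * col_monom f Cs) = 0" if "f \<in> cell w" for f
      using bad_monoms_eval [OF that rel]
      by (simp add: eval_poly_sum scale_poly_def eval_poly_mult eval_poly_const eval_col_monom)
    then have "vanishing w {Cs \<in> col_lists n qs. dem (perm_bound w) Cs} \<alpha>"
      by (simp add: vanishing_def standard_def)
    then have zero: "\<alpha> Cs = 0" if "Cs \<in> standard n w qs" for Cs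
      using dem_independent [OF qs w] that by (simp add: standard_def)
    show "ks = ls"
    proof (rule nth_equalityI)
      fix i assume "i < length ks"
      then have i: "i < length cs" using ks by simp
      then have "cs ! i \<in> standard n w qs" "?idx (cs ! i) = i"
        using bij cs by (auto simp: bij_betw_def the_inv_into_f_f)
      then show "ks ! i = ls ! i"
        using zero [of "cs ! i"] by (simp add: \<alpha>_def)
    qed (use ks ls in simp)
  qed
  moreover have "coset (bad_monoms n w qs) ` set ?vs \<subseteq> quot_space (monoms n qs) (bad_monoms n w qs)"
    using cs by (auto simp: quot_space_def monoms_def standard_def intro!: imageI poly.span_base)
  ultimately show ?thesis
    unfolding poly.quot_basis_iff [OF W] by blast
qed

lemma quot_trace_monoms:
  assumes y: "\<forall>i \<in> {1..n}. y i \<noteq> 0"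
  shows "quot_trace scale_poly (monoms n qs) (bad_monoms n w qs) (induced_map (bad_monoms n w qs) (act n (torus_element n y))) =
    (\<Sum>Cs \<in> standard n w qs. columns_weight y Cs)"
proof -
  let ?f = "act n (torus_element n y)"
  interpret act: comm_ring_hom ?f by (rule act_hom)
  have W: "poly.subspace (bad_monoms n w qs)" and V: "poly.subspace (monoms n qs)"
    unfolding bad_monoms_def monoms_def by (rule poly.subspace_span)+
  have sub: "bad_monoms n w qs \<subseteq> monoms n qs"
    unfolding bad_monoms_def monoms_def by (rule poly.span_mono) auto
  have fin: "finite (standard n w qs)"
    unfolding standard_def using finite_col_lists by simp
  obtain cs where cs: "set cs = standard n w qs" "distinct cs"
    using finite_distinct_list [OF fin] by blast
  have act_monom: "?f (col_monom entry Cs) = scale_poly (columns_weight y Cs) (col_monom entry Cs)"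
    if "Cs \<in> col_lists n qs" for Cs
    by (rule act_col_monom [OF y]) (use col_listsD(1) [OF that] in \<open>auto simp: in_set_conv_nth\<close>)
  have act_W: "?f v \<in> bad_monoms n w qs" if "v \<in> bad_monoms n w qs" for v
    using that unfolding bad_monoms_def
  proof (induction rule: poly.span_induct_alt)
    case base
    show ?case by (simp add: poly.span_zero)
  next
    case (step k x v)
    then obtain Cs where "Cs \<in> col_lists n qs" "x = col_monom entry Cs"
      by auto
    then have "?f x = scale_poly (columns_weight y Cs) x"
      using act_monom by simp
    then have "?f x \<in> poly.span (col_monom entry ` {Cs \<in> col_lists n qs. bad (perm_bound w) Cs})"
      using poly.span_scale [OF poly.span_base [OF step(1)]] by simp
    then show ?case
      using step by (auto simp: act.hom_add act_scale intro!: poly.span_add poly.span_scale)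
  qed
  have "quot_trace scale_poly (monoms n qs) (bad_monoms n w qs) (induced_map (bad_monoms n w qs) ?f) =
      (\<Sum>i<length (map (col_monom entry) cs). columns_weight y (cs ! i))"
  proof (rule poly.quot_trace_eigenbasis [OF W V sub])
    show "set (map (col_monom entry) cs) \<subseteq> monoms n qs"
      using cs by (auto simp: monoms_def standard_def intro!: poly.span_base)
    show "quot_basis scale_poly (monoms n qs) (bad_monoms n w qs) (map (coset (bad_monoms n w qs)) (map (col_monom entry) cs))"
      using cs by (intro standard_basis)
    fix i assume "i < length (map (col_monom entry) cs)"
    then have "i < length cs" by simp
    moreover from this have "cs ! i \<in> col_lists n qs"
      using cs nth_mem by (force simp: standard_def)
    ultimately show "?f (map (col_monom entry) cs ! i) = scale_poly (columns_weight y (cs ! i)) (map (col_monom entry) cs ! i)"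
      by (simp add: act_monom)
  qed (simp_all add: act.hom_add act_scale act_W)
  also have "\<dots> = (\<Sum>Cs \<in> standard n w qs. columns_weight y Cs)"
    using cs by (subst sum.reindex_bij_betw [OF bij_betw_nth, symmetric, of cs "{..<length cs}" "standard n w qs"]) auto
  finally show ?thesis .
qed

end

lemma prod_rev_upt:
  fixes f :: "nat \<Rightarrow> 'a::comm_monoid_mult"
  shows "(\<Prod>c\<leftarrow>rev [1..<Suc m]. f c) = (\<Prod>c = 1..m. f c)"
  by (induction m) (simp_all add: mult.commute)

lemma tabloid_monomial_columns:
  assumes lam: "n_partition n lam" and T: "T \<in> tabloids n lam"
  shows "tabloid_monomial n lam T = col_monom entry (columns n lam T)"
proof -
  have "initial_minor (col_len n lam c) (\<lambda>r. T (r, c)) = minor entry (colset n lam T c)" if "1 \<le> c" for c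
  proof -
    have "T (Suc i, c) = sorted_list_of_set (colset n lam T c) ! i" if "i < col_len n lam c" for i
      using colset_nth [OF lam T \<open>1 \<le> c\<close>, of "Suc i"] that \<open>1 \<le> c\<close> by (simp add: shape_iff [OF lam])
    then have "rowdet entry (col_len n lam c) (\<lambda>i. T (Suc i, c)) = minor entry (colset n lam T c)"
      unfolding minor_def card_colset [OF lam T \<open>1 \<le> c\<close>] by (intro rowdet_cong)
    then show ?thesis
      by (simp add: initial_minor_def rowdet_def)
  qed
  then have "tabloid_monomial n lam T = (\<Prod>c = 1..lam 1. minor entry (colset n lam T c))"
    unfolding tabloid_monomial_def by (intro prod.cong) auto
  also have "\<dots> = (\<Prod>c\<leftarrow>rev [1..<Suc (lam 1)]. minor entry (colset n lam T c))"
    by (rule prod_rev_upt [symmetric])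
  finally show ?thesis
    by (simp add: col_monom_def columns_def comp_def del: upt_Suc)
qed

lemma tableau_weight_columns:
  assumes lam: "n_partition n lam" and n: "1 \<le> n" and T: "T \<in> tabloids n lam"
  shows "tableau_weight n lam y T = columns_weight y (columns n lam T)"
proof -
  have shape_eq: "shape n lam = (\<lambda>(c, r). (r, c)) ` (SIGMA c:{1..lam 1}. {1..col_len n lam c})"
  proof (intro equalityI subsetI)
    fix x assume x: "x \<in> shape n lam"
    obtain r c where rc: "x = (r, c)" by (cases x)
    then have "(c, r) \<in> (SIGMA c:{1..lam 1}. {1..col_len n lam c})"
      using x col_len_pos_iff [OF lam n, of c] by (auto simp: shape_iff [OF lam])
    then show "x \<in> (\<lambda>(c, r). (r, c)) ` (SIGMA c:{1..lam 1}. {1..col_len n lam c})"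
      using rc by (auto intro!: image_eqI [of _ _ "(c, r)"])
  qed (auto simp: shape_iff [OF lam])
  have fin: "finite (shape n lam)"
    unfolding shape_eq by simp
  have "tableau_weight n lam y T = (\<Prod>i = 1..n. \<Prod>x \<in> {x \<in> shape n lam. T x = i}. y (T x))"
    unfolding tableau_weight_def by (intro prod.cong refl) simp
  also have "\<dots> = (\<Prod>x \<in> shape n lam. y (T x))"
    using fin T by (intro prod.group) (auto simp: tabloids_def)
  also have "\<dots> = (\<Prod>(c, r) \<in> (SIGMA c:{1..lam 1}. {1..col_len n lam c}). y (T (r, c)))"
    unfolding shape_eq by (subst prod.reindex) (auto simp: inj_on_def intro!: prod.cong)
  also have "\<dots> = (\<Prod>c = 1..lam 1. \<Prod>r = 1..col_len n lam c. y (T (r, c)))"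
    by (subst prod.Sigma) auto
  also have "\<dots> = (\<Prod>c = 1..lam 1. \<Prod>v \<in> colset n lam T c. y v)"
  proof (rule prod.cong [OF refl])
    fix c assume "c \<in> {1..lam 1}"
    then have "card (colset n lam T c) = card {1..col_len n lam c}"
      using card_colset [OF lam T] by simp
    then have "inj_on (\<lambda>r. T (r, c)) {1..col_len n lam c}"
      unfolding colset_def by (intro eq_card_imp_inj_on) auto
    then show "(\<Prod>r = 1..col_len n lam c. y (T (r, c))) = (\<Prod>v \<in> colset n lam T c. y v)"
      unfolding colset_def by (simp add: prod.reindex)
  qed
  also have "\<dots> = (\<Prod>c\<leftarrow>rev [1..<Suc (lam 1)]. \<Prod>v \<in> colset n lam T c. y v)"
    by (rule prod_rev_upt [symmetric])
  finally show ?thesis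
    by (simp add: columns_weight_def columns_def comp_def del: upt_Suc)
qed

theorem corollary9p1:
  fixes n :: nat and Q :: "nat set" and lam :: "nat \<Rightarrow> nat" and \<pi> :: "nat set list"
    and y :: "nat \<Rightarrow> complex"
  assumes "n \<ge> 2"
    and "Q \<subseteq> {1..n - 1}" and "Q \<noteq> {}"
    and "n_partition n lam" and "short_col_lens n lam \<subseteq> Q"
    and "Q_chain n Q \<pi>"
    and "\<forall>i \<in> {1..n}. y i \<noteq> 0"
  shows "Gamma_character n lam \<pi> (torus_element n y) =
    (\<Sum>T \<in> demazure_tableaux n lam \<pi>. tableau_weight n lam y T)"
proof -
  note lam = assms(4) and y = assms(7)
  have n: "1 \<le> n" using assms(1) by simp
  have finQ: "finite Q" using assms(2) finite_subset by blast
  obtain w where w: "w permutes {1..n}" "\<And>P. P \<in> set \<pi> \<Longrightarrow> w ` {1..card P} = P"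
    using Q_chain_perm [OF assms(6)] by blast
  note key = lam n assms(5,6) finQ w
  let ?qs = "col_lens n lam" and ?cols = "columns n lam"
  have bij: "bij_betw ?cols (tabloids n lam) (col_lists n ?qs)"
    by (rule columns_bij [OF lam])
  have cols_img: "tabloid_monomial n lam ` {T \<in> tabloids n lam. P T} = col_monom entry ` {Cs \<in> col_lists n ?qs. R Cs}"
    if "\<And>T. T \<in> tabloids n lam \<Longrightarrow> P T \<longleftrightarrow> R (?cols T)" for P R
  proof -
    have "{Cs \<in> col_lists n ?qs. R Cs} = ?cols ` {T \<in> tabloids n lam. P T}"
      using that unfolding bij_betw_imp_surj_on [OF bij, symmetric] by auto
    then show ?thesis
      using tabloid_monomial_columns [OF lam] by (auto simp: image_image intro!: image_cong)
  qed
  have Gamma: "Gamma_space n lam = monoms n ?qs"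
    unfolding Gamma_space_def monoms_def using cols_img [of "\<lambda>_. True" "\<lambda>_. True"] by simp
  have Z: "Z_space n lam \<pi> = bad_monoms n w ?qs"
    unfolding Z_space_def bad_monoms_def
    using cols_img [of "\<lambda>T. \<not> filling_le n lam T (key_tableau n lam \<pi>)" "bad (perm_bound w)"]
      tabloid_le_key_iff [OF key] by simp
  have "bij_betw ?cols (demazure_tableaux n lam \<pi>) (standard n w ?qs)"
  proof (rule bij_betw_imageI)
    have sub: "demazure_tableaux n lam \<pi> \<subseteq> tabloids n lam"
      by (auto simp: demazure_tableaux_def tableaux_def)
    show "inj_on ?cols (demazure_tableaux n lam \<pi>)"
      by (rule inj_on_subset [OF bij_betw_imp_inj_on [OF bij] sub])
    show "?cols ` demazure_tableaux n lam \<pi> = standard n w ?qs"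
    proof (intro equalityI subsetI)
      fix Cs assume "Cs \<in> ?cols ` demazure_tableaux n lam \<pi>"
      then obtain T where T: "T \<in> demazure_tableaux n lam \<pi>" "Cs = ?cols T" by blast
      then have "T \<in> tableaux n lam" by (simp add: demazure_tableaux_def)
      then show "Cs \<in> standard n w ?qs"
        using T sub demazure_iff_dem [OF key] bij_betw_apply [OF bij] by (auto simp: standard_def)
    next
      \<comment> \<open>A list in \<open>standard\<close> only yields a tabloid at first;
        \<open>dem\<close> then forces its rows to increase weakly.\<close>
      fix Cs assume Cs: "Cs \<in> standard n w ?qs"
      then obtain T where T: "T \<in> tabloids n lam" "Cs = ?cols T"
        using bij_betw_imp_surj_on [OF bij] by (auto simp: standard_def)
      then have dem: "dem (perm_bound w) (?cols T)"
        using Cs by (simp add: standard_def)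
      then have "T \<in> tableaux n lam"
        by (intro dem_imp_tableau [OF key T(1)])
      then show "Cs \<in> ?cols ` demazure_tableaux n lam \<pi>"
        using demazure_iff_dem [OF key] dem T(2) by blast
    qed
  qed
  then have "(\<Sum>Cs \<in> standard n w ?qs. columns_weight y Cs) =
      (\<Sum>T \<in> demazure_tableaux n lam \<pi>. columns_weight y (?cols T))"
    by (rule sum.reindex_bij_betw [symmetric])
  also have "\<dots> = (\<Sum>T \<in> demazure_tableaux n lam \<pi>. tableau_weight n lam y T)"
    using tableau_weight_columns [OF lam n]
    by (intro sum.cong) (auto simp: demazure_tableaux_def tableaux_def)
  finally show ?thesis
    unfolding Gamma_character_def Gamma Z
    using quot_trace_monoms [OF w(1) sorted_col_lens y] by simp
qed

end
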